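(* Let $(M,F)$ be a complete, $n$-dimensional Finsler manifold such that $r_F<+\infty$. Then $(W_0^{1,2}(M,F,\mathsf m),\|\cdot\|_{F_s})$ is a reflexive Banach space, while the norm $\|\cdot\|_{F_s}$ and the asymmetric norm $\|\cdot\|_F$ are equivalent. In particular, $$\left(\frac{1+r_F^{2}}{2}\right)^{-1/2}\|u\|_{F}\le \|u\|_{F_s}\le \left(\frac{1+r_F^{-2}}{2}\right)^{-1/2}\|u\|_{F}\qquad \text{for all } u\in W_0^{1,2}(M,F,\mathsf m).$$
   Context: Finsler manifold: a connected $n$-dimensional $C^\infty$ manifold $M$ with a continuous function $F:TM\to[0,\infty)$ such that (a) $F\in C^\infty(TM\setminus\{0\})$; (b) $F(x,ty)=tF(x,y)$ for all $t\ge 0$, $(x,y)\in TM$; (c) the matrix $g_{ij}(x,y)=\left[\frac12F^2(x,y)\right]_{y^iy^j}$ is positive definite for all $(x,y)\in TM\setminus\{0\}$. $F$ need not be reversible (i.e. $F(x,-y)=F(x,y)$ is not assumed). Geodesics are taken with respect to the Chern connection, parametrized proportionally to arc-length. $(M,F)$ is forward (resp. backward) complete if every geodesic segment $\sigma:[0,a]\to M$ extends to $[0,\infty)$ (resp. $(-\infty,a]$), and complete if it is both forward and backward complete. Reversibility constant: $r_F=\sup_{x\in M}\sup_{y\in T_xM\setminus\{0\}}\frac{F(x,y)}{F(x,-y)}\in[1,+\infty]$. Polar transform of a Finsler metric $F$: $F^*(x,\alpha)=\sup_{y\in T_xM\setminus\{0\}}\frac{\alpha(y)}{F(x,y)}$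 for $(x,\alpha)\in T^*M$. Symmetrized metric: $F_s(x,y)=\left(\frac{F^2(x,y)+F^2(x,-y)}{2}\right)^{1/2}$; $F_s^*$ is the polar transform of $F_s$. Measure: $\mathsf m$ is the Hausdorff (Busemann) measure of $(M,F)$, $\mathrm d\mathsf m=\mathrm dV_F=\sigma_F(x)\,\mathrm dx^1\wedge\dots\wedge \mathrm dx^n$ with $\sigma_F(x)=\omega_n/\mathrm{Vol}(B_x(1))$, where $B_x(1)=\{(y^i)\in\mathbb R^n: F(x,y^i\partial/\partial x^i)<1\}$, $\mathrm{Vol}$ is Euclidean volume and $\omega_n$ is the volume of the Euclidean unit ball of $\mathbb R^n$. Norms ($Du$ is the distributional derivative of $u$): $$\|u\|_F=\left(\int_M F^{*2}(x,Du(x))\,\mathrm d\mathsf m(x)+\int_M u^2\,\mathrm d\mathsf m\right)^{1/2},\qquad \|u\|_{F_s}=\left(\int_M F_s^{*2}(x,Du(x))\,\mathrm d\mathsf m(x)+\int_M u^2\,\mathrm d\mathsf m\right)^{1/2};$$ in both cases $\mathsf m$ is the Hausdorff measure of $(M,F)$ (not of $(M,F_s)$). $W^{1,2}(M,F,\mathsf m)=\{u\in W^{1,2}_{\rm loc}(M):\int_M F^{*2}(x,Du(x))\,\mathrm d\mathsf m(x)<+\infty\}$, and $W_0^{1,2}(M,F,\mathsf m)$ is the closure of $C_0^\infty(M)$ with respect to the (asymmetric) norm $\|\cdot\|_F$. *)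

theory Defs
  imports "HOL-Analysis.Analysis"
begin

section \<open>Smooth functions on open subsets of Euclidean space\<close>

fun Ck_on :: "nat \<Rightarrow> 'a::euclidean_space set \<Rightarrow> ('a \<Rightarrow> 'b::real_normed_vector) \<Rightarrow> bool" where
  "Ck_on 0 S f \<longleftrightarrow> continuous_on S f"
| "Ck_on (Suc k) S f \<longleftrightarrow>
     (\<forall>x\<in>S. f differentiable (at x)) \<and> (\<forall>v. Ck_on k S (\<lambda>x. frechet_derivative f (at x) v))"

definition smooth_on :: "'a::euclidean_space set \<Rightarrow> ('a \<Rightarrow> 'b::real_normed_vector) \<Rightarrow> bool" where
  "smooth_on S f \<longleftrightarrow> (\<forall>k. Ck_on k S f)"


section \<open>Smooth manifolds\<close>

text \<open>
  The manifold is a whole type \<open>'m\<close> (Hausdorff and second countable by its type class) with a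
  smooth atlas, not necessarily maximal, of charts \<open>(U, \<phi>)\<close>, where \<open>U\<close> is the domain and
  \<open>\<phi>\<close> takes values in \<open>real ^ 'n\<close>; the dimension is \<open>CARD('n)\<close>.
\<close>

type_synonym ('m, 'n) chart = "'m set \<times> ('m \<Rightarrow> real ^ 'n)"

definition chart_inv :: "('m, 'n) chart \<Rightarrow> real ^ 'n \<Rightarrow> 'm" where
  "chart_inv c = inv_into (fst c) (snd c)"

definition chart_range :: "('m, 'n) chart \<Rightarrow> (real ^ 'n) set" where
  "chart_range c = snd c ` fst c"

definition smooth_atlas ::
  "('m::{t2_space, second_countable_topology}, 'n::finite) chart set \<Rightarrow> bool" where
  "smooth_atlas A \<longleftrightarrow>
     (\<forall>c\<in>A. open (fst c) \<and> open (chart_range c) \<and>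
        homeomorphism (fst c) (chart_range c) (snd c) (chart_inv c)) \<and>
     (\<Union>c\<in>A. fst c) = UNIV \<and>
     (\<forall>c\<in>A. \<forall>d\<in>A. smooth_on (snd c ` (fst c \<inter> fst d)) (snd d \<circ> chart_inv c))"

text \<open>
  Tangent and cotangent bundle. At each point \<open>x\<close> one chart \<open>pref_chart A x\<close> is singled out, and a
  tangent vector at \<open>x\<close> is represented by its component vector \<open>y :: real ^ 'n\<close> in that chart, a
  covector at \<open>x\<close> by its component vector \<open>\<alpha> :: real ^ 'n\<close>, the pairing being the inner product
  \<open>\<alpha> \<bullet> y\<close>. This is only a labelling of the fibres: \<open>x \<mapsto> pref_chart A x\<close> has no continuity, so all
  regularity is expressed in the components with respect to a fixed chart. \<open>tangent_of A c x \<eta>\<close> is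
  the tangent vector at \<open>x\<close> whose components in the chart \<open>c\<close> are \<open>\<eta>\<close>, and \<open>cov_comp A c w\<close> gives, on
  the range of \<open>c\<close>, the components in \<open>c\<close> of the covector field \<open>w\<close>.
\<close>

definition pref_chart :: "('m, 'n) chart set \<Rightarrow> 'm \<Rightarrow> ('m, 'n) chart" where
  "pref_chart A x = (SOME c. c \<in> A \<and> x \<in> fst c)"

definition tangent_of ::
  "('m, 'n::finite) chart set \<Rightarrow> ('m, 'n) chart \<Rightarrow> 'm \<Rightarrow> real ^ 'n \<Rightarrow> real ^ 'n" where
  "tangent_of A c x = frechet_derivative (snd (pref_chart A x) \<circ> chart_inv c) (at (snd c x))"

definition cov_comp ::
  "('m, 'n::finite) chart set \<Rightarrow> ('m, 'n) chart \<Rightarrow> ('m \<Rightarrow> real ^ 'n) \<Rightarrow> real ^ 'n \<Rightarrow> real ^ 'n" where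
  "cov_comp A c w \<xi> = (let x = chart_inv c \<xi> in (\<chi> i. w x \<bullet> tangent_of A c x (axis i 1)))"


section \<open>Finsler metrics\<close>

text \<open>\<open>F x y\<close> is the value of \<open>F\<close> at the tangent vector \<open>y\<close> at \<open>x\<close>; \<open>F_loc A F c \<xi> \<eta>\<close> is its
  expression in the coordinates \<open>(\<xi>, \<eta>)\<close> of the tangent bundle induced by the chart \<open>c\<close>.\<close>

definition F_loc :: "('m, 'n::finite) chart set \<Rightarrow> ('m \<Rightarrow> real ^ 'n \<Rightarrow> real) \<Rightarrow> ('m, 'n) chart \<Rightarrow>
    real ^ 'n \<Rightarrow> real ^ 'n \<Rightarrow> real" where
  "F_loc A F c \<xi> \<eta> = (let x = chart_inv c \<xi> in F x (tangent_of A c x \<eta>))"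

definition pd_x :: "'n::finite \<Rightarrow> (real ^ 'n \<Rightarrow> real ^ 'n \<Rightarrow> real) \<Rightarrow> real ^ 'n \<Rightarrow> real ^ 'n \<Rightarrow> real" where
  "pd_x i h \<xi> \<eta> = frechet_derivative (\<lambda>z. h z \<eta>) (at \<xi>) (axis i 1)"

definition pd_y :: "'n::finite \<Rightarrow> (real ^ 'n \<Rightarrow> real ^ 'n \<Rightarrow> real) \<Rightarrow> real ^ 'n \<Rightarrow> real ^ 'n \<Rightarrow> real" where
  "pd_y i h \<xi> \<eta> = frechet_derivative (\<lambda>z. h \<xi> z) (at \<eta>) (axis i 1)"

definition fund_tensor :: "(real ^ 'n::finite \<Rightarrow> real ^ 'n \<Rightarrow> real) \<Rightarrow> 'n \<Rightarrow> 'n \<Rightarrow>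
    real ^ 'n \<Rightarrow> real ^ 'n \<Rightarrow> real" where
  "fund_tensor f i j = pd_y j (pd_y i (\<lambda>\<xi> \<eta>. (f \<xi> \<eta>)\<^sup>2 / 2))"

definition fund_matrix :: "(real ^ 'n::finite \<Rightarrow> real ^ 'n \<Rightarrow> real) \<Rightarrow>
    real ^ 'n \<Rightarrow> real ^ 'n \<Rightarrow> real ^ 'n ^ 'n" where
  "fund_matrix f \<xi> \<eta> = (\<chi> i j. fund_tensor f i j \<xi> \<eta>)"

definition finsler_manifold :: "('m::{t2_space, second_countable_topology}, 'n::finite) chart set \<Rightarrow>
    ('m \<Rightarrow> real ^ 'n \<Rightarrow> real) \<Rightarrow> bool" where
  "finsler_manifold A F \<longleftrightarrow>
     smooth_atlas A \<and> connected (UNIV :: 'm set) \<and>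
     (\<forall>x y. F x y \<ge> 0) \<and>
     (\<forall>c\<in>A. continuous_on (chart_range c \<times> UNIV) (\<lambda>(\<xi>, \<eta>). F_loc A F c \<xi> \<eta>)) \<and>
     (\<forall>c\<in>A. smooth_on (chart_range c \<times> (- {0})) (\<lambda>(\<xi>, \<eta>). F_loc A F c \<xi> \<eta>)) \<and>
     (\<forall>x y t. t \<ge> 0 \<longrightarrow> F x (t *\<^sub>R y) = t * F x y) \<and>
     (\<forall>c\<in>A. \<forall>\<xi>\<in>chart_range c. \<forall>\<eta>. \<eta> \<noteq> 0 \<longrightarrow>
        (\<forall>v. v \<noteq> 0 \<longrightarrow> v \<bullet> (fund_matrix (F_loc A F c) \<xi> \<eta> *v v) > 0))"


section \<open>Chern connection, geodesics, completeness\<close>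

text \<open>
  Coefficients of the Chern connection in local coordinates: with the formal Christoffel symbols
  \<open>\<gamma>\<close> and the Cartan tensor \<open>C\<close> of the fundamental tensor, the nonlinear connection is
  \<open>N\<^sup>i\<^sub>j = \<gamma>\<^sup>i\<^sub>j\<^sub>k y\<^sup>k - C\<^sup>i\<^sub>j\<^sub>k \<gamma>\<^sup>k\<^sub>r\<^sub>s y\<^sup>r y\<^sup>s\<close>, and \<open>\<Gamma>\<^sup>i\<^sub>j\<^sub>k\<close> is obtained from the formula for the Christoffel
  symbols by replacing \<open>\<partial>/\<partial>x\<^sup>k\<close> with \<open>\<delta>/\<delta>x\<^sup>k = \<partial>/\<partial>x\<^sup>k - N\<^sup>m\<^sub>k \<partial>/\<partial>y\<^sup>m\<close>.
\<close>

definition formal_christoffel :: "(real ^ 'n::finite \<Rightarrow> real ^ 'n \<Rightarrow> real) \<Rightarrow> 'n \<Rightarrow> 'n \<Rightarrow> 'n \<Rightarrow>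
    real ^ 'n \<Rightarrow> real ^ 'n \<Rightarrow> real" where
  "formal_christoffel f i j k \<xi> \<eta> =
     (\<Sum>l\<in>UNIV. matrix_inv (fund_matrix f \<xi> \<eta>) $ i $ l *
        (pd_x k (fund_tensor f l j) \<xi> \<eta> + pd_x j (fund_tensor f l k) \<xi> \<eta>
          - pd_x l (fund_tensor f j k) \<xi> \<eta>) / 2)"

definition cartan :: "(real ^ 'n::finite \<Rightarrow> real ^ 'n \<Rightarrow> real) \<Rightarrow> 'n \<Rightarrow> 'n \<Rightarrow> 'n \<Rightarrow>
    real ^ 'n \<Rightarrow> real ^ 'n \<Rightarrow> real" where
  "cartan f i j k \<xi> \<eta> = pd_y k (fund_tensor f i j) \<xi> \<eta> / 2"

definition nonlinear_conn :: "(real ^ 'n::finite \<Rightarrow> real ^ 'n \<Rightarrow> real) \<Rightarrow> 'n \<Rightarrow> 'n \<Rightarrow>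
    real ^ 'n \<Rightarrow> real ^ 'n \<Rightarrow> real" where
  "nonlinear_conn f i j \<xi> \<eta> =
     (\<Sum>k\<in>UNIV. formal_christoffel f i j k \<xi> \<eta> * \<eta> $ k) -
     (\<Sum>k\<in>UNIV. \<Sum>r\<in>UNIV. \<Sum>s\<in>UNIV.
        (\<Sum>l\<in>UNIV. matrix_inv (fund_matrix f \<xi> \<eta>) $ i $ l * cartan f l j k \<xi> \<eta>) *
        formal_christoffel f k r s \<xi> \<eta> * \<eta> $ r * \<eta> $ s)"

definition delta_x :: "(real ^ 'n::finite \<Rightarrow> real ^ 'n \<Rightarrow> real) \<Rightarrow> 'n \<Rightarrow>
    (real ^ 'n \<Rightarrow> real ^ 'n \<Rightarrow> real) \<Rightarrow> real ^ 'n \<Rightarrow> real ^ 'n \<Rightarrow> real" where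
  "delta_x f k h \<xi> \<eta> = pd_x k h \<xi> \<eta> - (\<Sum>m\<in>UNIV. nonlinear_conn f m k \<xi> \<eta> * pd_y m h \<xi> \<eta>)"

definition chern :: "(real ^ 'n::finite \<Rightarrow> real ^ 'n \<Rightarrow> real) \<Rightarrow> 'n \<Rightarrow> 'n \<Rightarrow> 'n \<Rightarrow>
    real ^ 'n \<Rightarrow> real ^ 'n \<Rightarrow> real" where
  "chern f i j k \<xi> \<eta> =
     (\<Sum>l\<in>UNIV. matrix_inv (fund_matrix f \<xi> \<eta>) $ i $ l *
        (delta_x f k (fund_tensor f l j) \<xi> \<eta> + delta_x f j (fund_tensor f l k) \<xi> \<eta>
          - delta_x f l (fund_tensor f j k) \<xi> \<eta>) / 2)"

text \<open>
  The Chern connection lives over nonzero tangent vectors, so a geodesic is required to have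
  positive constant speed \<open>k\<close>; constant curves, which extend trivially, are left out. The function
  \<open>v\<close> is the velocity in the chart \<open>c\<close>; its values at times when the curve is outside \<open>c\<close> play no
  role.
\<close>

definition geodesic_on :: "('m::{t2_space, second_countable_topology}, 'n::finite) chart set \<Rightarrow>
    ('m \<Rightarrow> real ^ 'n \<Rightarrow> real) \<Rightarrow> real set \<Rightarrow> (real \<Rightarrow> 'm) \<Rightarrow> bool" where
  "geodesic_on A F I \<sigma> \<longleftrightarrow> continuous_on I \<sigma> \<and>
     (\<exists>k>0. \<forall>c\<in>A. \<exists>v. \<forall>t\<in>I. \<sigma> t \<in> fst c \<longrightarrow>
        ((snd c \<circ> \<sigma>) has_vector_derivative v t) (at t within I) \<and>
        (v has_vector_derivative
           (\<chi> i. - (\<Sum>j\<in>UNIV. \<Sum>l\<in>UNIV.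
              chern (F_loc A F c) i j l (snd c (\<sigma> t)) (v t) * v t $ j * v t $ l))) (at t within I) \<and>
        F_loc A F c (snd c (\<sigma> t)) (v t) = k)"

definition forward_complete :: "('m::{t2_space, second_countable_topology}, 'n::finite) chart set \<Rightarrow>
    ('m \<Rightarrow> real ^ 'n \<Rightarrow> real) \<Rightarrow> bool" where
  "forward_complete A F \<longleftrightarrow>
     (\<forall>a>0. \<forall>\<sigma>. geodesic_on A F {0..a} \<sigma> \<longrightarrow>
        (\<exists>\<tau>. geodesic_on A F {0..} \<tau> \<and> (\<forall>t\<in>{0..a}. \<tau> t = \<sigma> t)))"

definition backward_complete :: "('m::{t2_space, second_countable_topology}, 'n::finite) chart set \<Rightarrow>
    ('m \<Rightarrow> real ^ 'n \<Rightarrow> real) \<Rightarrow> bool" where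
  "backward_complete A F \<longleftrightarrow>
     (\<forall>a>0. \<forall>\<sigma>. geodesic_on A F {0..a} \<sigma> \<longrightarrow>
        (\<exists>\<tau>. geodesic_on A F {..a} \<tau> \<and> (\<forall>t\<in>{0..a}. \<tau> t = \<sigma> t)))"

definition finsler_complete :: "('m::{t2_space, second_countable_topology}, 'n::finite) chart set \<Rightarrow>
    ('m \<Rightarrow> real ^ 'n \<Rightarrow> real) \<Rightarrow> bool" where
  "finsler_complete A F \<longleftrightarrow> forward_complete A F \<and> backward_complete A F"


section \<open>Reversibility, polar transform, symmetrization, Busemann measure\<close>

definition reversibility :: "('m \<Rightarrow> real ^ 'n \<Rightarrow> real) \<Rightarrow> ereal" where
  "reversibility F = (SUP x. SUP y\<in>- {0}. ereal (F x y / F x (- y)))"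

definition polar :: "('m \<Rightarrow> real ^ 'n::finite \<Rightarrow> real) \<Rightarrow> 'm \<Rightarrow> real ^ 'n \<Rightarrow> real" where
  "polar F x \<alpha> = (SUP y\<in>- {0}. (\<alpha> \<bullet> y) / F x y)"

definition symm :: "('m \<Rightarrow> real ^ 'n \<Rightarrow> real) \<Rightarrow> 'm \<Rightarrow> real ^ 'n \<Rightarrow> real" where
  "symm F x y = sqrt (((F x y)\<^sup>2 + (F x (- y))\<^sup>2) / 2)"

definition busemann_density :: "('m, 'n::finite) chart set \<Rightarrow> ('m \<Rightarrow> real ^ 'n \<Rightarrow> real) \<Rightarrow>
    ('m, 'n) chart \<Rightarrow> real ^ 'n \<Rightarrow> real" where
  "busemann_density A F c \<xi> =
     unit_ball_vol (real CARD('n)) / measure lborel {\<eta>. F_loc A F c \<xi> \<eta> < 1}"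

text \<open>The Borel measure given by the density \<open>busemann_density A F c\<close> in every chart \<open>c\<close>; it is
  unique because countably many chart domains cover the manifold.\<close>

definition is_busemann_measure :: "('m::{t2_space, second_countable_topology}, 'n::finite) chart set \<Rightarrow>
    ('m \<Rightarrow> real ^ 'n \<Rightarrow> real) \<Rightarrow> 'm measure \<Rightarrow> bool" where
  "is_busemann_measure A F m \<longleftrightarrow> sets m = sets borel \<and>
     (\<forall>c\<in>A. \<forall>B\<in>sets borel. B \<subseteq> fst c \<longrightarrow>
        emeasure m B = (\<integral>\<^sup>+\<xi>\<in>snd c ` B. ennreal (busemann_density A F c \<xi>) \<partial>lborel))"


section \<open>Sobolev spaces\<close>

text \<open>\<open>w\<close> is a distributional derivative of \<open>u\<close>: a locally integrable covector field such that
  in every chart its components are the weak partial derivatives of \<open>u\<close>.\<close>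

definition weak_differential :: "('m, 'n::finite) chart set \<Rightarrow> ('m \<Rightarrow> real) \<Rightarrow>
    ('m \<Rightarrow> real ^ 'n) \<Rightarrow> bool" where
  "weak_differential A u w \<longleftrightarrow>
     (\<forall>c\<in>A.
        (\<forall>K. compact K \<and> K \<subseteq> chart_range c \<longrightarrow> set_integrable lborel K (cov_comp A c w)) \<and>
        (\<forall>\<psi> :: real ^ 'n \<Rightarrow> real. \<forall>K. smooth_on UNIV \<psi> \<and> compact K \<and> K \<subseteq> chart_range c \<and>
           (\<forall>\<xi>. \<xi> \<notin> K \<longrightarrow> \<psi> \<xi> = 0) \<longrightarrow>
           (\<forall>i. (LINT \<xi>:chart_range c|lborel.
                   u (chart_inv c \<xi>) * frechet_derivative \<psi> (at \<xi>) (axis i 1)) =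
                - (LINT \<xi>:chart_range c|lborel. cov_comp A c w \<xi> $ i * \<psi> \<xi>))))"

text \<open>Unique up to null sets whenever it exists.\<close>

definition Dweak :: "('m, 'n::finite) chart set \<Rightarrow> ('m \<Rightarrow> real) \<Rightarrow> 'm \<Rightarrow> real ^ 'n" where
  "Dweak A u = (SOME w. weak_differential A u w)"

definition W12_loc :: "('m::{t2_space, second_countable_topology}, 'n::finite) chart set \<Rightarrow>
    ('m \<Rightarrow> real) set" where
  "W12_loc A = {u. u \<in> borel_measurable borel \<and>
     (\<forall>c\<in>A. \<forall>K. compact K \<and> K \<subseteq> chart_range c \<longrightarrow>
        set_integrable lborel K (\<lambda>\<xi>. (u (chart_inv c \<xi>))\<^sup>2)) \<and>
     (\<exists>w. weak_differential A u w \<and>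
        (\<forall>c\<in>A. \<forall>K. compact K \<and> K \<subseteq> chart_range c \<longrightarrow>
           set_integrable lborel K (\<lambda>\<xi>. (norm (cov_comp A c w \<xi>))\<^sup>2)))}"

definition ennreal_sqrt :: "ennreal \<Rightarrow> ennreal" where
  "ennreal_sqrt a = (if a = top then top else ennreal (sqrt (enn2real a)))"

text \<open>The Sobolev norm with respect to the measure \<open>m\<close> and the polar transform of \<open>G\<close>, where
  \<open>G\<close> is \<open>F\<close> or \<open>symm F\<close>. It may be infinite.\<close>

definition sobolev_norm :: "('m, 'n::finite) chart set \<Rightarrow> 'm measure \<Rightarrow> ('m \<Rightarrow> real ^ 'n \<Rightarrow> real) \<Rightarrow>
    ('m \<Rightarrow> real) \<Rightarrow> ennreal" where
  "sobolev_norm A m G u = ennreal_sqrt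
     ((\<integral>\<^sup>+x. ennreal ((polar G x (Dweak A u x))\<^sup>2) \<partial>m) + (\<integral>\<^sup>+x. ennreal ((u x)\<^sup>2) \<partial>m))"

definition W12 :: "('m::{t2_space, second_countable_topology}, 'n::finite) chart set \<Rightarrow>
    ('m \<Rightarrow> real ^ 'n \<Rightarrow> real) \<Rightarrow> 'm measure \<Rightarrow> ('m \<Rightarrow> real) set" where
  "W12 A F m = {u \<in> W12_loc A. (\<integral>\<^sup>+x. ennreal ((polar F x (Dweak A u x))\<^sup>2) \<partial>m) < top}"

definition C0_infinity :: "('m::{t2_space, second_countable_topology}, 'n::finite) chart set \<Rightarrow>
    ('m \<Rightarrow> real) set" where
  "C0_infinity A = {u. (\<forall>c\<in>A. smooth_on (chart_range c) (u \<circ> chart_inv c)) \<and>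
     (\<exists>K. compact K \<and> (\<forall>x. x \<notin> K \<longrightarrow> u x = 0))}"

definition W12_0 :: "('m::{t2_space, second_countable_topology}, 'n::finite) chart set \<Rightarrow>
    ('m \<Rightarrow> real ^ 'n \<Rightarrow> real) \<Rightarrow> 'm measure \<Rightarrow> ('m \<Rightarrow> real) set" where
  "W12_0 A F m = {u \<in> W12 A F m. \<exists>\<phi>. (\<forall>k::nat. \<phi> k \<in> C0_infinity A) \<and>
     (\<lambda>k. sobolev_norm A m F (\<lambda>x. u x - \<phi> k x)) \<longlonglongrightarrow> 0}"


section \<open>Normed spaces on a carrier set, completeness, reflexivity\<close>

definition normed_space_on :: "'v set \<Rightarrow> ('v \<Rightarrow> 'v \<Rightarrow> 'v) \<Rightarrow> 'v \<Rightarrow> (real \<Rightarrow> 'v \<Rightarrow> 'v) \<Rightarrow>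
    ('v \<Rightarrow> real) \<Rightarrow> bool" where
  "normed_space_on V add zer scl nrm \<longleftrightarrow>
     zer \<in> V \<and> (\<forall>x\<in>V. \<forall>y\<in>V. add x y \<in> V) \<and> (\<forall>a. \<forall>x\<in>V. scl a x \<in> V) \<and>
     (\<forall>x\<in>V. \<forall>y\<in>V. \<forall>z\<in>V. add (add x y) z = add x (add y z)) \<and>
     (\<forall>x\<in>V. \<forall>y\<in>V. add x y = add y x) \<and>
     (\<forall>x\<in>V. add zer x = x) \<and> (\<forall>x\<in>V. add x (scl (-1) x) = zer) \<and>
     (\<forall>a. \<forall>x\<in>V. \<forall>y\<in>V. scl a (add x y) = add (scl a x) (scl a y)) \<and>
     (\<forall>a b. \<forall>x\<in>V. scl (a + b) x = add (scl a x) (scl b x)) \<and>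
     (\<forall>a b. \<forall>x\<in>V. scl a (scl b x) = scl (a * b) x) \<and>
     (\<forall>x\<in>V. scl 1 x = x) \<and>
     (\<forall>x\<in>V. nrm x = 0 \<longleftrightarrow> x = zer) \<and>
     (\<forall>a. \<forall>x\<in>V. nrm (scl a x) = \<bar>a\<bar> * nrm x) \<and>
     (\<forall>x\<in>V. \<forall>y\<in>V. nrm (add x y) \<le> nrm x + nrm y)"

definition banach_space_on :: "'v set \<Rightarrow> ('v \<Rightarrow> 'v \<Rightarrow> 'v) \<Rightarrow> 'v \<Rightarrow> (real \<Rightarrow> 'v \<Rightarrow> 'v) \<Rightarrow>
    ('v \<Rightarrow> real) \<Rightarrow> bool" where
  "banach_space_on V add zer scl nrm \<longleftrightarrow> normed_space_on V add zer scl nrm \<and>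
     (\<forall>X :: nat \<Rightarrow> 'v. range X \<subseteq> V \<and>
        (\<forall>\<epsilon>>0. \<exists>N. \<forall>i\<ge>N. \<forall>j\<ge>N. nrm (add (X i) (scl (-1) (X j))) < \<epsilon>) \<longrightarrow>
        (\<exists>l\<in>V. (\<lambda>i. nrm (add (X i) (scl (-1) l))) \<longlonglongrightarrow> 0))"

text \<open>The topological dual; functionals are normalised to vanish off \<open>V\<close>, so that equality in the
  dual is equality of functions.\<close>

definition dual_on :: "'v set \<Rightarrow> ('v \<Rightarrow> 'v \<Rightarrow> 'v) \<Rightarrow> (real \<Rightarrow> 'v \<Rightarrow> 'v) \<Rightarrow> ('v \<Rightarrow> real) \<Rightarrow>
    ('v \<Rightarrow> real) set" where
  "dual_on V add scl nrm = {f. (\<forall>x\<in>V. \<forall>y\<in>V. f (add x y) = f x + f y) \<and>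
     (\<forall>a. \<forall>x\<in>V. f (scl a x) = a * f x) \<and>
     (\<exists>C. \<forall>x\<in>V. \<bar>f x\<bar> \<le> C * nrm x) \<and> (\<forall>x. x \<notin> V \<longrightarrow> f x = 0)}"

definition dual_norm :: "'v set \<Rightarrow> ('v \<Rightarrow> real) \<Rightarrow> ('v \<Rightarrow> real) \<Rightarrow> real" where
  "dual_norm V nrm f = (SUP x\<in>{x \<in> V. nrm x \<le> 1}. \<bar>f x\<bar>)"

text \<open>Every bounded linear functional on the dual is the evaluation at some vector, i.e. the
  canonical map into the bidual is onto.\<close>

definition reflexive_on :: "'v set \<Rightarrow> ('v \<Rightarrow> 'v \<Rightarrow> 'v) \<Rightarrow> (real \<Rightarrow> 'v \<Rightarrow> 'v) \<Rightarrow>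
    ('v \<Rightarrow> real) \<Rightarrow> bool" where
  "reflexive_on V add scl nrm \<longleftrightarrow>
     (let V' = dual_on V add scl nrm in
      \<forall>\<Phi> \<in> dual_on V' (\<lambda>f g x. f x + g x) (\<lambda>a f x. a * f x) (dual_norm V nrm).
        \<exists>v\<in>V. \<forall>f\<in>V'. \<Phi> f = f v)"


section \<open>The space \<open>W12_0\<close> modulo equality almost everywhere\<close>

definition ae_class :: "'m::topological_space measure \<Rightarrow> ('m \<Rightarrow> real) \<Rightarrow> ('m \<Rightarrow> real) set" where
  "ae_class m u = {v \<in> borel_measurable borel. AE x in m. v x = u x}"

definition class_rep :: "('m \<Rightarrow> real) set \<Rightarrow> 'm \<Rightarrow> real" where
  "class_rep X = (SOME u. u \<in> X)"

definition class_add :: "'m::topological_space measure \<Rightarrow> ('m \<Rightarrow> real) set \<Rightarrow> ('m \<Rightarrow> real) set \<Rightarrow>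
    ('m \<Rightarrow> real) set" where
  "class_add m X Y = ae_class m (\<lambda>x. class_rep X x + class_rep Y x)"

definition class_scale :: "'m::topological_space measure \<Rightarrow> real \<Rightarrow> ('m \<Rightarrow> real) set \<Rightarrow>
    ('m \<Rightarrow> real) set" where
  "class_scale m a X = ae_class m (\<lambda>x. a * class_rep X x)"

text \<open>The first two conditions say that \<open>N\<close> is finite on \<open>W\<close> and independent of the representative,
  so that \<open>nrm\<close> below is the norm induced on the quotient.\<close>

definition reflexive_banach_mod_ae :: "'m::topological_space measure \<Rightarrow> ('m \<Rightarrow> real) set \<Rightarrow>
    (('m \<Rightarrow> real) \<Rightarrow> ennreal) \<Rightarrow> bool" where
  "reflexive_banach_mod_ae m W N \<longleftrightarrow>
     (\<forall>u\<in>W. N u < top) \<and>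
     (\<forall>u\<in>W. \<forall>v\<in>W. (AE x in m. u x = v x) \<longrightarrow> N u = N v) \<and>
     (let V = ae_class m ` W; nrm = (\<lambda>X. enn2real (N (class_rep X))) in
      banach_space_on V (class_add m) (ae_class m (\<lambda>x. 0)) (class_scale m) nrm \<and>
      reflexive_on V (class_add m) (class_scale m) nrm)"

definition equivalent_norms_on :: "'v set \<Rightarrow> ('v \<Rightarrow> ennreal) \<Rightarrow> ('v \<Rightarrow> ennreal) \<Rightarrow> bool" where
  "equivalent_norms_on W N N' \<longleftrightarrow>
     (\<exists>C>0. \<exists>C'>0. \<forall>u\<in>W. ennreal C * N u \<le> N' u \<and> N' u \<le> ennreal C' * N u)"

end

theory Submission
  imports Defs
begin

text \<open>
  Since \<open>F\<close> and \<open>symm F\<close> bound each other pointwise with constants depending on \<open>r\<^sub>F\<close> only, so do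
  their polar transforms in the reverse direction; integrating gives the two inequalities, and both
  norms define the same closure of the smooth functions. Completeness is the Riesz-Fischer argument
  for the pairs \<open>(u, Du)\<close>, the weak differential being closed because the Sobolev norm dominates the
  Euclidean \<open>L\<^sup>2\<close> norms in charts over compact sets.

  For reflexivity no uniform convexity is available, the convexity of the norms \<open>polar (symm F) x\<close>
  being arbitrary. Instead, the average of \<open>(\<alpha> \<bullet> y) (\<beta> \<bullet> y)\<close> over the unit ball of the bidual of
  \<open>symm F x\<close> is an inner product on covectors whose norm is comparable with \<open>polar (symm F) x\<close> up to
  a factor depending on the dimension only. It depends measurably on \<open>x\<close>, so the Sobolev norm is
  equivalent to a Hilbert norm, and Riesz representation applies.
\<close>

section \<open>Hilbertian norms on a carrier and modulo null sets\<close>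

text \<open>Fibres are labelled through \<open>pref_chart\<close>, which has no regularity in the
  point, and \<open>Dweak\<close> is an arbitrary choice among the weak differentials. Hence
  measurability of a covector field is tested on its components in charts, the inner product on
  covectors is assembled over a countable family of charts with Borel pieces, and linearity of
  \<open>Dweak\<close> is an almost everywhere statement resting on uniqueness of weak
  differentials. Since a limit of differentials is not yet known to be a differential, the energy is
  studied on arbitrary pairs of a function and a covector field. The constants of the theorem come
  from \<open>F x y / r \<le> F x (- y) \<le> r * F x y\<close>: inserted into \<open>symm F\<close>
  this gives \<open>symm F \<le> k1 * F\<close> and \<open>F \<le> k2 * symm F\<close>. Both factors
  are at least 1, so the term with \<open>u^2\<close>, common to both norms, may be enlarged by them
  as well. Averaging over the bidual ball rather than over the unit ball of \<open>symm F\<close>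
  makes convexity of the body automatic, and convexity is what lets a shrunk copy of the body fit
  inside it.\<close>

locale equiv_inner_space =
  fixes V :: "'v set" and add :: "'v \<Rightarrow> 'v \<Rightarrow> 'v" and zer :: 'v and scl :: "real \<Rightarrow> 'v \<Rightarrow> 'v"
    and nrm :: "'v \<Rightarrow> real" and ip :: "'v \<Rightarrow> 'v \<Rightarrow> real" and c C :: real
  assumes banach: "banach_space_on V add zer scl nrm"
    and ip_sym: "\<lbrakk>x \<in> V; y \<in> V\<rbrakk> \<Longrightarrow> ip x y = ip y x"
    and ip_add: "\<lbrakk>x \<in> V; y \<in> V; z \<in> V\<rbrakk> \<Longrightarrow> ip (add x y) z = ip x z + ip y z"
    and ip_scl: "\<lbrakk>x \<in> V; y \<in> V\<rbrakk> \<Longrightarrow> ip (scl a x) y = a * ip x y"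
    and c_pos: "c > 0" and C_nonneg: "C \<ge> 0"
    and ip_lower: "x \<in> V \<Longrightarrow> c * (nrm x)\<^sup>2 \<le> ip x x"
    and ip_upper: "x \<in> V \<Longrightarrow> ip x x \<le> C * (nrm x)\<^sup>2"
begin

lemma normed: "normed_space_on V add zer scl nrm"
  using banach by (simp add: banach_space_on_def)

lemma zer_in [simp]: "zer \<in> V"
  and add_in [simp]: "\<lbrakk>x \<in> V; y \<in> V\<rbrakk> \<Longrightarrow> add x y \<in> V"
  and scl_in [simp]: "x \<in> V \<Longrightarrow> scl a x \<in> V"
  and nrm_zer [simp]: "nrm zer = 0"
  and nrm_scl [simp]: "x \<in> V \<Longrightarrow> nrm (scl a x) = \<bar>a\<bar> * nrm x"
  and nrm_triangle: "\<lbrakk>x \<in> V; y \<in> V\<rbrakk> \<Longrightarrow> nrm (add x y) \<le> nrm x + nrm y"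
  and add_neg: "x \<in> V \<Longrightarrow> add x (scl (-1) x) = zer"
  using normed unfolding normed_space_on_def by auto

text \<open>The axioms in \<open>normed_space_on\<close> do not list this; it follows from
  \<open>0 = nrm zer \<le> nrm x + nrm (scl (-1) x) = 2 * nrm x\<close>.\<close>

lemma nrm_nonneg: assumes "x \<in> V" shows "nrm x \<ge> 0"
  using nrm_triangle[OF assms scl_in[OF assms, of "-1"]] assms by (simp add: add_neg)

lemma ip_add2: "\<lbrakk>x \<in> V; y \<in> V; z \<in> V\<rbrakk> \<Longrightarrow> ip z (add x y) = ip z x + ip z y"
  by (simp add: ip_sym[of z] ip_add)

lemma ip_scl2: "\<lbrakk>x \<in> V; y \<in> V\<rbrakk> \<Longrightarrow> ip y (scl a x) = a * ip y x"
  by (simp add: ip_sym[of y] ip_scl)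

lemma ip_nonneg: "x \<in> V \<Longrightarrow> ip x x \<ge> 0"
  using ip_lower[of x] c_pos by (meson order_trans mult_nonneg_nonneg less_imp_le zero_le_power2)

lemma ip_square:
  assumes "x \<in> V" "y \<in> V"
  shows "ip (add x (scl t y)) (add x (scl t y)) = ip x x + 2 * t * ip x y + t\<^sup>2 * ip y y"
  using assms by (simp add: ip_add ip_add2 ip_scl ip_scl2 ip_sym[of y x] power2_eq_square algebra_simps)

text \<open>When \<open>ip y y = 0\<close>, the nonnegative quadratic of \<open>ip_square\<close>
  becomes affine in \<open>t\<close>; were its slope nonzero, the chosen \<open>t\<close> would give
  it the value -1.\<close>

lemma ip_eq_0: assumes "x \<in> V" "y \<in> V" "ip y y = 0" shows "ip x y = 0"
proof (rule ccontr)
  assume n: "ip x y \<noteq> 0"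
  define t where "t = - (ip x x + 1) / (2 * ip x y)"
  have "0 \<le> ip x x + 2 * t * ip x y"
    using ip_nonneg[of "add x (scl t y)"] ip_square[of x y t] assms by simp
  then show False using n by (simp add: t_def field_simps)
qed

lemma ip_cauchy_schwarz:
  assumes "x \<in> V" "y \<in> V"
  shows "(ip x y)\<^sup>2 \<le> ip x x * ip y y"
proof (cases "ip y y = 0")
  case True
  then show ?thesis using ip_eq_0 assms by simp
next
  case False
  then have p: "ip y y > 0" using ip_nonneg assms by (simp add: order_less_le)
  \<comment> \<open>The minimiser of the quadratic in \<open>ip_square\<close>.\<close>
  define t where "t = - ip x y / ip y y"
  have "0 \<le> ip x x + 2 * t * ip x y + t\<^sup>2 * ip y y"
    using ip_nonneg[of "add x (scl t y)"] ip_square[of x y t] assms by simp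
  also have "\<dots> = ip x x - (ip x y)\<^sup>2 / ip y y"
    using p by (simp add: t_def field_simps power2_eq_square)
  finally show ?thesis using p by (simp add: field_simps)
qed

lemma ip_bounded:
  assumes "x \<in> V" "y \<in> V"
  shows "\<bar>ip x y\<bar> \<le> C * nrm x * nrm y"
proof -
  have "(ip x y)\<^sup>2 \<le> (C * (nrm x)\<^sup>2) * (C * (nrm y)\<^sup>2)"
    using ip_cauchy_schwarz[OF assms]
      mult_mono[OF ip_upper[OF assms(1)] ip_upper[OF assms(2)]] ip_nonneg assms C_nonneg
    by (meson order_trans mult_nonneg_nonneg zero_le_power2)
  also have "\<dots> = (C * nrm x * nrm y)\<^sup>2" by (simp add: power2_eq_square)
  finally show ?thesis
    using abs_le_square_iff[of "ip x y" "C * nrm x * nrm y"] nrm_nonneg assms C_nonneg by simp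
qed

text \<open>The Riesz representative minimises \<open>ip x x - 2 * f x\<close>.\<close>

lemma riesz:
  assumes fa: "\<And>x y. \<lbrakk>x \<in> V; y \<in> V\<rbrakk> \<Longrightarrow> f (add x y) = f x + f y"
    and fs: "\<And>a x. x \<in> V \<Longrightarrow> f (scl a x) = a * f x"
    and fb: "\<And>x. x \<in> V \<Longrightarrow> \<bar>f x\<bar> \<le> K * nrm x"
  obtains w where "w \<in> V" "\<And>x. x \<in> V \<Longrightarrow> f x = ip w x"
proof -
  define J where "J x = ip x x - 2 * f x" for x
  \<comment> \<open>Completing the square in \<open>nrm x\<close>: the quadratic growth from
    \<open>ip_lower\<close> beats the linear term bounded by \<open>fb\<close>, so \<open>J\<close>
    is bounded below.\<close>
  have Jlow: "J x \<ge> - (K\<^sup>2 / c)" if "x \<in> V" for x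
  proof -
    have "0 \<le> (c * nrm x - K)\<^sup>2 / c" using c_pos by simp
    also have "\<dots> = c * (nrm x)\<^sup>2 - 2 * (K * nrm x) + K\<^sup>2 / c"
      using c_pos by (simp add: field_simps power2_eq_square)
    finally show ?thesis using ip_lower[OF that] fb[OF that] unfolding J_def by linarith
  qed
  define I where "I = Inf (J ` V)"
  have bdd: "bdd_below (J ` V)" using Jlow by (auto intro!: bdd_belowI)
  have I_le: "I \<le> J x" if "x \<in> V" for x
    unfolding I_def by (rule cInf_lower) (use that bdd in auto)
  have "\<exists>x\<in>V. J x < I + inverse (real (Suc n))" for n
  proof -
    have "Inf (J ` V) < I + inverse (real (Suc n))" unfolding I_def by simp
    from cInf_lessD[OF _ this] show ?thesis using zer_in by blast
  qed
  then obtain X where X: "\<And>n. X n \<in> V" "\<And>n. J (X n) < I + inverse (real (Suc n))"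
    by metis
  \<comment> \<open>The parallelogram identity at the midpoint \<open>z\<close>, where the linear
    parts of \<open>J\<close> cancel. Near-minimisers are therefore close to each other, which makes
    a minimising sequence Cauchy.\<close>
  have close: "c * (nrm (add x (scl (-1) y)))\<^sup>2 \<le> 2 * (J x + J y - 2 * I)"
    if "x \<in> V" "y \<in> V" for x y
  proof -
    define z where "z = scl (1/2) (add x y)"
    have z: "z \<in> V" using that by (simp add: z_def)
    have "J x + J y - 2 * J z = ip (add x (scl (-1) y)) (add x (scl (-1) y)) / 2"
      using that unfolding J_def z_def
      by (simp add: ip_square ip_add ip_add2 ip_scl ip_scl2 fa fs ip_sym[of y x] algebra_simps)
    then show ?thesis using ip_lower[of "add x (scl (-1) y)"] I_le[OF z] that by simp
  qed
  have cauchy: "\<exists>M. \<forall>i\<ge>M. \<forall>j\<ge>M. nrm (add (X i) (scl (-1) (X j))) < e" if e: "e > 0" for e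
  proof -
    obtain M where M: "4 * inverse (real (Suc M)) < c * e\<^sup>2"
      using reals_Archimedean[of "c * e\<^sup>2 / 4"] e c_pos by (auto simp: field_simps)
    have "nrm (add (X i) (scl (-1) (X j))) < e" if "i \<ge> M" "j \<ge> M" for i j
    proof -
      have "J (X k) < I + inverse (real (Suc M))" if "k \<ge> M" for k
        by (rule less_le_trans[OF X(2)]) (use that in \<open>auto intro!: le_imp_inverse_le\<close>)
      from this[OF that(1)] this[OF that(2)]
      have "J (X i) + J (X j) - 2 * I < 2 * inverse (real (Suc M))" by simp
      then have "c * (nrm (add (X i) (scl (-1) (X j))))\<^sup>2 < c * e\<^sup>2"
        using close[OF X(1)[of i] X(1)[of j]] M by auto
      then show ?thesis using c_pos e by (simp add: power_less_imp_less_base)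
    qed
    then show ?thesis by blast
  qed
  obtain l where l: "l \<in> V" "(\<lambda>i. nrm (add (X i) (scl (-1) l))) \<longlonglongrightarrow> 0"
    using banach[unfolded banach_space_on_def, THEN conjunct2, THEN spec[of _ X]] X(1) cauchy
    by auto
  have "f y = ip l y" if y: "y \<in> V" for y
  proof -
    \<comment> \<open>First variation at the near-minimiser \<open>X n\<close>: moving by
      \<open>t = - b / a\<close> along \<open>y\<close> lowers \<open>J\<close> by at least
      \<open>b^2 / a\<close>, which near-minimality limits to \<open>1 / (n + 1)\<close>. The
      summand 1 in \<open>a\<close> keeps \<open>a\<close> positive.\<close>
    have bnd: "(ip (X n) y - f y)\<^sup>2 \<le> (ip y y + 1) * inverse (real (Suc n))" for n
    proof -
      define b where "b = ip (X n) y - f y"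
      define a where "a = ip y y + 1"
      have a: "a > 0" "ip y y \<le> a" using ip_nonneg[OF y] by (auto simp: a_def)
      define t where "t = - b / a"
      have "I \<le> J (add (X n) (scl t y))" using I_le X y by simp
      also have "\<dots> = J (X n) + 2 * t * b + t\<^sup>2 * ip y y"
        using X(1)[of n] y unfolding J_def b_def
        by (simp only: ip_square) (simp add: fa fs algebra_simps)
      finally have "0 \<le> inverse (real (Suc n)) + 2 * t * b + t\<^sup>2 * a"
        using X(2)[of n] mult_left_mono[OF a(2), of "t\<^sup>2"] by simp
      moreover have "2 * t * b + t\<^sup>2 * a = - (b\<^sup>2 / a)"
        using a by (simp add: t_def field_simps power2_eq_square)
      ultimately have "b\<^sup>2 / a \<le> inverse (real (Suc n))" by linarith
      then show ?thesis using a(1)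
        unfolding b_def[symmetric] a_def[symmetric] by (simp add: pos_divide_le_eq mult.commute)
    qed
    have "(\<lambda>n. (ip (X n) y - f y)\<^sup>2) \<longlonglongrightarrow> 0"
      by (rule real_tendsto_sandwich[OF _ _ tendsto_const
            tendsto_mult_right_zero[OF LIMSEQ_inverse_real_of_nat]])
        (use bnd in \<open>auto intro!: always_eventually simp del: of_nat_Suc\<close>)
    from tendsto_real_sqrt[OF this] have "(\<lambda>n. ip (X n) y - f y) \<longlonglongrightarrow> 0"
      by (simp add: tendsto_rabs_zero_iff)
    then have 1: "(\<lambda>n. ip (X n) y) \<longlonglongrightarrow> f y" by (rule LIM_zero_cancel)
    have "(\<lambda>n. C * nrm (add (X n) (scl (-1) l)) * nrm y) \<longlonglongrightarrow> C * 0 * nrm y"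
      by (intro tendsto_intros l(2))
    then have lim: "(\<lambda>n. C * nrm (add (X n) (scl (-1) l)) * nrm y) \<longlonglongrightarrow> 0" by simp
    have le: "norm (ip (X n) y - ip l y) \<le> C * nrm (add (X n) (scl (-1) l)) * nrm y" for n
      using ip_bounded[of "add (X n) (scl (-1) l)" y] X(1)[of n] l(1) y
      by (simp add: ip_add ip_scl)
    have "(\<lambda>n. ip (X n) y - ip l y) \<longlonglongrightarrow> 0"
      by (rule Lim_null_comparison[OF always_eventually[OF allI[OF le]] lim])
    then have 2: "(\<lambda>n. ip (X n) y) \<longlonglongrightarrow> ip l y" by (rule LIM_zero_cancel)
    show ?thesis using LIMSEQ_unique[OF 1 2] .
  qed
  with l(1) show ?thesis by (rule that)
qed

text \<open>Riesz representation is used twice. Applied to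
  \<open>w \<mapsto> \<Phi> (ip w _)\<close> it produces the vector \<open>v\<close>; applied to
  each \<open>f\<close> of the dual it writes \<open>f\<close> as \<open>ip w _\<close>. Then
  \<open>\<Phi> f = ip v w = ip w v = f v\<close>.\<close>

lemma reflexive: "reflexive_on V add scl nrm"
  unfolding reflexive_on_def Let_def
proof
  fix \<Phi>
  define V' where "V' = dual_on V add scl nrm"
  assume "\<Phi> \<in> dual_on (dual_on V add scl nrm) (\<lambda>f g x. f x + g x) (\<lambda>a f x. a * f x) (dual_norm V nrm)"
  then obtain K where
    Pa: "\<And>f g. \<lbrakk>f \<in> V'; g \<in> V'\<rbrakk> \<Longrightarrow> \<Phi> (\<lambda>x. f x + g x) = \<Phi> f + \<Phi> g"
    and Ps: "\<And>a f. f \<in> V' \<Longrightarrow> \<Phi> (\<lambda>x. a * f x) = a * \<Phi> f"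
    and Pb: "\<And>f. f \<in> V' \<Longrightarrow> \<bar>\<Phi> f\<bar> \<le> K * dual_norm V nrm f"
    unfolding dual_on_def[of "dual_on V add scl nrm"] V'_def by blast
  \<comment> \<open>The value 0 off \<open>V\<close> matches the normalisation in
    \<open>dual_on\<close>, so that functionals can later be identified as functions.\<close>
  define r where "r w = (\<lambda>x. if x \<in> V then ip w x else 0)" for w
  have r: "r w \<in> V'" if "w \<in> V" for w
    using that ip_bounded[OF that] unfolding V'_def dual_on_def r_def
    by (auto simp: ip_add2 ip_scl2 intro!: exI[of _ "C * nrm w"])
  \<comment> \<open>The sign of the bound \<open>K\<close> for \<open>\<Phi>\<close> is unknown;
    nonnegativity of the dual norm allows passing to its absolute value.\<close>
  have dn: "0 \<le> dual_norm V nrm (r w)" "dual_norm V nrm (r w) \<le> C * nrm w" if "w \<in> V" for w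
  proof -
    have b: "\<bar>r w x\<bar> \<le> C * nrm w" if x: "x \<in> {x \<in> V. nrm x \<le> 1}" for x
    proof -
      have "C * nrm w * nrm x \<le> C * nrm w * 1"
        by (intro mult_left_mono) (use x nrm_nonneg \<open>w \<in> V\<close> C_nonneg in auto)
      then show ?thesis using ip_bounded[of w x] x \<open>w \<in> V\<close> by (simp add: r_def)
    qed
    have z: "zer \<in> {x \<in> V. nrm x \<le> 1}" by simp
    have bd: "bdd_above ((\<lambda>x. \<bar>r w x\<bar>) ` {x \<in> V. nrm x \<le> 1})"
      using b by (auto intro!: bdd_aboveI)
    have "\<bar>r w zer\<bar> \<le> dual_norm V nrm (r w)"
      unfolding dual_norm_def by (rule cSUP_upper[OF z bd])
    then show "0 \<le> dual_norm V nrm (r w)" by linarith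
    show "dual_norm V nrm (r w) \<le> C * nrm w"
      unfolding dual_norm_def by (rule cSUP_least) (use z b in blast)+
  qed
  obtain v where v: "v \<in> V" "\<And>w. w \<in> V \<Longrightarrow> \<Phi> (r w) = ip v w"
  proof (rule riesz[of "\<lambda>w. \<Phi> (r w)" "\<bar>K\<bar> * C"])
    fix x y assume "x \<in> V" "y \<in> V"
    moreover have "r (add x y) = (\<lambda>z. r x z + r y z)" using \<open>x \<in> V\<close> \<open>y \<in> V\<close>
      by (auto simp: r_def ip_add)
    ultimately show "\<Phi> (r (add x y)) = \<Phi> (r x) + \<Phi> (r y)" using Pa[OF r r] by simp
  next
    fix a x assume "x \<in> V"
    moreover have "r (scl a x) = (\<lambda>z. a * r x z)" using \<open>x \<in> V\<close> by (auto simp: r_def ip_scl)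
    ultimately show "\<Phi> (r (scl a x)) = a * \<Phi> (r x)" using Ps[OF r] by simp
  next
    fix x assume x: "x \<in> V"
    have "\<bar>\<Phi> (r x)\<bar> \<le> \<bar>K\<bar> * dual_norm V nrm (r x)"
      using Pb[OF r[OF x]] dn(1)[OF x] by (meson abs_ge_self mult_right_mono order_trans)
    also have "\<dots> \<le> \<bar>K\<bar> * (C * nrm x)" using dn(2)[OF x] by (intro mult_left_mono) auto
    finally show "\<bar>\<Phi> (r x)\<bar> \<le> \<bar>K\<bar> * C * nrm x" by (simp add: mult.assoc)
  qed blast
  have "\<Phi> f = f v" if "f \<in> V'" for f
  proof -
    have f: "\<And>x y. \<lbrakk>x \<in> V; y \<in> V\<rbrakk> \<Longrightarrow> f (add x y) = f x + f y"
      "\<And>a x. x \<in> V \<Longrightarrow> f (scl a x) = a * f x" "\<And>x. x \<notin> V \<Longrightarrow> f x = 0"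
      using that unfolding V'_def dual_on_def by auto
    have "\<exists>k. \<forall>x\<in>V. \<bar>f x\<bar> \<le> k * nrm x"
      using that unfolding V'_def dual_on_def by auto
    then obtain k where k: "\<And>x. x \<in> V \<Longrightarrow> \<bar>f x\<bar> \<le> k * nrm x" by blast
    obtain w where w: "w \<in> V" "\<And>x. x \<in> V \<Longrightarrow> f x = ip w x"
      using riesz[OF f(1,2) k] by metis
    have "f = r w" using w f(3) by (auto simp: r_def)
    then show ?thesis using v w ip_sym by simp
  qed
  then show "\<exists>v\<in>V. \<forall>f\<in>dual_on V add scl nrm. \<Phi> f = f v" using v(1) unfolding V'_def by blast
qed

end

text \<open>The operations on classes act through chosen representatives. For this reason
  \<open>W\<close>, \<open>N\<close> and \<open>ip\<close> are all required to be stable under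
  changes on null sets; everything else is assumed on the level of functions.\<close>

locale ae_inner_space =
  fixes m :: "'m::topological_space measure" and W :: "('m \<Rightarrow> real) set"
    and N :: "('m \<Rightarrow> real) \<Rightarrow> ennreal" and ip :: "('m \<Rightarrow> real) \<Rightarrow> ('m \<Rightarrow> real) \<Rightarrow> real" and c C :: real
  assumes W_borel: "u \<in> W \<Longrightarrow> u \<in> borel_measurable borel"
    and W_zero: "(\<lambda>x. 0) \<in> W"
    and W_add: "\<lbrakk>u \<in> W; v \<in> W\<rbrakk> \<Longrightarrow> (\<lambda>x. u x + v x) \<in> W"
    and W_scale: "u \<in> W \<Longrightarrow> (\<lambda>x. a * u x) \<in> W"
    and W_ae: "\<lbrakk>u \<in> W; v \<in> borel_measurable borel; AE x in m. v x = u x\<rbrakk> \<Longrightarrow> v \<in> W"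
    and N_fin: "u \<in> W \<Longrightarrow> N u < top"
    and N_add: "\<lbrakk>u \<in> W; v \<in> W\<rbrakk> \<Longrightarrow> N (\<lambda>x. u x + v x) \<le> N u + N v"
    and N_scale: "u \<in> W \<Longrightarrow> N (\<lambda>x. a * u x) = ennreal \<bar>a\<bar> * N u"
    and N_ae: "\<lbrakk>u \<in> W; v \<in> W; AE x in m. u x = v x\<rbrakk> \<Longrightarrow> N u = N v"
    and N_zero: "\<lbrakk>u \<in> W; N u = 0\<rbrakk> \<Longrightarrow> AE x in m. u x = 0"
    and N_complete: "\<lbrakk>\<And>k::nat. X k \<in> W;
        \<And>e::real. e > 0 \<Longrightarrow> \<exists>M. \<forall>i\<ge>M. \<forall>j\<ge>M. N (\<lambda>x. X i x - X j x) < ennreal e\<rbrakk>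
        \<Longrightarrow> \<exists>u\<in>W. (\<lambda>k. N (\<lambda>x. X k x - u x)) \<longlonglongrightarrow> 0"
    and ip_ae: "\<lbrakk>u \<in> W; u' \<in> W; v \<in> W; v' \<in> W; AE x in m. u' x = u x; AE x in m. v' x = v x\<rbrakk>
        \<Longrightarrow> ip u' v' = ip u v"
    and ip_sym: "\<lbrakk>u \<in> W; v \<in> W\<rbrakk> \<Longrightarrow> ip u v = ip v u"
    and ip_add: "\<lbrakk>u \<in> W; v \<in> W; w \<in> W\<rbrakk> \<Longrightarrow> ip (\<lambda>x. u x + v x) w = ip u w + ip v w"
    and ip_scale: "\<lbrakk>u \<in> W; v \<in> W\<rbrakk> \<Longrightarrow> ip (\<lambda>x. a * u x) v = a * ip u v"
    and c_pos: "c > 0" and C_nonneg: "C \<ge> 0"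
    and ip_lower: "u \<in> W \<Longrightarrow> c * (enn2real (N u))\<^sup>2 \<le> ip u u"
    and ip_upper: "u \<in> W \<Longrightarrow> ip u u \<le> C * (enn2real (N u))\<^sup>2"
begin

abbreviation "cls \<equiv> ae_class m"
abbreviation "rep \<equiv> class_rep :: ('m \<Rightarrow> real) set \<Rightarrow> 'm \<Rightarrow> real"
abbreviation "nrm \<equiv> (\<lambda>X. enn2real (N (class_rep X)))"

lemma cls_eqI: "AE x in m. u x = v x \<Longrightarrow> cls u = cls v"
  unfolding ae_class_def by (auto elim!: eventually_elim2)

text \<open>The \<open>SOME\<close> in \<open>class_rep\<close> is well founded because the class
  contains \<open>u\<close> itself, and \<open>W_ae\<close> keeps whatever is chosen inside
  \<open>W\<close>.\<close>

lemma rep_in: assumes "u \<in> W" shows "rep (cls u) \<in> W" "AE x in m. rep (cls u) x = u x"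
proof -
  have "u \<in> cls u" using W_borel[OF assms] by (simp add: ae_class_def)
  then have "rep (cls u) \<in> cls u" unfolding class_rep_def by (rule someI[of "\<lambda>v. v \<in> cls u"])
  then show "rep (cls u) \<in> W" "AE x in m. rep (cls u) x = u x"
    using W_ae[OF assms] by (auto simp: ae_class_def)
qed

lemma cls_add: "\<lbrakk>u \<in> W; v \<in> W\<rbrakk> \<Longrightarrow> class_add m (cls u) (cls v) = cls (\<lambda>x. u x + v x)"
  unfolding class_add_def
  by (rule cls_eqI) (use rep_in(2)[of u] rep_in(2)[of v] in \<open>auto elim!: eventually_elim2\<close>)

lemma cls_scale: "u \<in> W \<Longrightarrow> class_scale m a (cls u) = cls (\<lambda>x. a * u x)"
  unfolding class_scale_def
  by (rule cls_eqI) (use rep_in(2)[of u] in \<open>auto elim!: eventually_mono\<close>)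

lemma nrm_cls: "u \<in> W \<Longrightarrow> nrm (cls u) = enn2real (N u)"
  using N_ae[OF rep_in(1) _ rep_in(2)] by simp

lemma W_diff: assumes "u \<in> W" "v \<in> W" shows "(\<lambda>x. u x - v x) \<in> W"
  using W_add[OF assms(1) W_scale[OF assms(2), of "-1"]] by simp

lemma nrm_diff:
  assumes "u \<in> W" "v \<in> W"
  shows "nrm (class_add m (cls u) (class_scale m (-1) (cls v))) = enn2real (N (\<lambda>x. u x - v x))"
  using assms W_scale[of v "-1"] W_diff by (simp add: cls_add cls_scale nrm_cls)

lemma cls_eqD: "\<lbrakk>u \<in> W; v \<in> W; cls u = cls v\<rbrakk> \<Longrightarrow> AE x in m. u x = v x"
  using W_borel[of u] by (auto simp: ae_class_def)

lemma N_zero_iff: assumes "u \<in> W" shows "enn2real (N u) = 0 \<longleftrightarrow> cls u = cls (\<lambda>x. 0)"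
proof
  assume "enn2real (N u) = 0"
  \<comment> \<open>\<open>enn2real\<close> also sends \<open>top\<close> to 0; \<open>N_fin\<close>
    rules that case out.\<close>
  then have "N u = 0" using N_fin[OF assms] by (auto simp: enn2real_eq_0_iff)
  then show "cls u = cls (\<lambda>x. 0)" using N_zero assms by (intro cls_eqI) auto
next
  assume "cls u = cls (\<lambda>x. 0)"
  then have "N u = N (\<lambda>x. 0)" using N_ae[OF assms W_zero] cls_eqD[OF assms W_zero] by simp
  also have "\<dots> = 0" using N_scale[OF W_zero, of 0] by simp
  finally show "enn2real (N u) = 0" by simp
qed

lemma normed: "normed_space_on (cls ` W) (class_add m) (cls (\<lambda>x. 0)) (class_scale m) nrm"
  unfolding normed_space_on_def ball_simps
proof (intro conjI ballI allI)
  fix u v assume "u \<in> W" "v \<in> W"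
  have "enn2real (N (\<lambda>x. u x + v x)) \<le> enn2real (N u + N v)"
    using N_add[OF \<open>u \<in> W\<close> \<open>v \<in> W\<close>] N_fin \<open>u \<in> W\<close> \<open>v \<in> W\<close> by (intro enn2real_mono) auto
  also have "\<dots> = enn2real (N u) + enn2real (N v)"
    using N_fin \<open>u \<in> W\<close> \<open>v \<in> W\<close> by (intro enn2real_plus) auto
  finally show "nrm (class_add m (cls u) (cls v)) \<le> nrm (cls u) + nrm (cls v)"
    using \<open>u \<in> W\<close> \<open>v \<in> W\<close> by (simp add: cls_add nrm_cls W_add)
next
  fix u assume "u \<in> W"
  then show "class_add m (cls u) (class_scale m (-1) (cls u)) = cls (\<lambda>x. 0)"
    using W_scale[of u "-1"] by (simp add: cls_add cls_scale)
qed (simp_all add: cls_add cls_scale nrm_cls N_zero_iff W_zero W_add W_scale N_scale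
      enn2real_mult algebra_simps)

lemma banach: "banach_space_on (cls ` W) (class_add m) (cls (\<lambda>x. 0)) (class_scale m) nrm"
  unfolding banach_space_on_def
proof (intro conjI allI impI normed)
  fix X :: "nat \<Rightarrow> ('m \<Rightarrow> real) set"
  assume *: "range X \<subseteq> cls ` W \<and> (\<forall>\<epsilon>>0. \<exists>M. \<forall>i\<ge>M. \<forall>j\<ge>M.
    nrm (class_add m (X i) (class_scale m (-1) (X j))) < \<epsilon>)"
  then have "\<forall>k. \<exists>u\<in>W. X k = cls u" by blast
  then obtain Y where Y: "\<And>k. Y k \<in> W" "\<And>k. X k = cls (Y k)" by metis
  have "\<exists>M. \<forall>i\<ge>M. \<forall>j\<ge>M. N (\<lambda>x. Y i x - Y j x) < ennreal e" if "e > 0" for e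
  proof -
    obtain M where M: "\<And>i j. \<lbrakk>i \<ge> M; j \<ge> M\<rbrakk> \<Longrightarrow> enn2real (N (\<lambda>x. Y i x - Y j x)) < e"
      using conjunct2[OF *, unfolded Y(2) nrm_diff[OF Y(1) Y(1)]] \<open>e > 0\<close> by blast
    have "N (\<lambda>x. Y i x - Y j x) < ennreal e" if "i \<ge> M" "j \<ge> M" for i j
      using M[OF that] N_fin[OF W_diff[OF Y(1) Y(1)], of i j] \<open>e > 0\<close>
      by (metis enn2real_nonneg ennreal_enn2real ennreal_lessI)
    then show ?thesis by blast
  qed
  from N_complete[OF Y(1) this] obtain u where u: "u \<in> W"
    "(\<lambda>k. N (\<lambda>x. Y k x - u x)) \<longlonglongrightarrow> 0" by blast
  have "(\<lambda>k. enn2real (N (\<lambda>x. Y k x - u x))) \<longlonglongrightarrow> 0"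
    by (rule tendsto_enn2real) (use u(2) in auto)
  then show "\<exists>l\<in>cls ` W. (\<lambda>i. nrm (class_add m (X i) (class_scale m (-1) l))) \<longlonglongrightarrow> 0"
    by (intro bexI[of _ "cls u"]) (simp_all add: Y(2) nrm_diff[OF Y(1) u(1)] u(1))
qed

lemma reflexive_banach: "reflexive_banach_mod_ae m W N"
proof -
  have ip: "ip (rep (cls u)) (rep (cls v)) = ip u v" if "u \<in> W" "v \<in> W" for u v
    using that rep_in by (intro ip_ae) auto
  interpret equiv_inner_space "cls ` W" "class_add m" "cls (\<lambda>x. 0)" "class_scale m" nrm
    "\<lambda>X Y. ip (rep X) (rep Y)" c C
  proof (unfold_locales, goal_cases)
    case 1 show ?case by (rule banach)
  next
    case (2 x y) then show ?case using rep_in ip_sym by auto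
  next
    case (3 x y z) then show ?case by (auto simp: cls_add ip W_add ip_add)
  next
    case (4 x y a) then show ?case by (auto simp: cls_scale ip W_scale ip_scale)
  next
    case (7 x) then show ?case using rep_in ip_lower by auto
  next
    case (8 x) then show ?case using rep_in ip_upper by auto
  qed (use c_pos C_nonneg in auto)
  show ?thesis
    unfolding reflexive_banach_mod_ae_def Let_def using N_fin N_ae banach reflexive by blast
qed

end

section \<open>Smooth test functions\<close>

lemma Ck_on_cong:
  assumes "open S" "\<And>x. x \<in> S \<Longrightarrow> f x = g x"
  shows "Ck_on k S f \<Longrightarrow> Ck_on k S g"
  using assms(2)
proof (induction k arbitrary: f g)
  case 0
  then show ?case using continuous_on_cong[of S S f g] by simp
next
  case (Suc k)
  have d: "f differentiable (at x)" if "x \<in> S" for x using Suc.prems(1) that by simp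
  have "g differentiable (at x)" if "x \<in> S" for x
    using d[OF that] Suc.prems(2) assms(1) that
    by (meson differentiable_def has_derivative_transform_within_open)
  moreover have "frechet_derivative f (at x) v = frechet_derivative g (at x) v" if "x \<in> S" for x v
    using frechet_derivative_transform_within_open[OF d[OF that] assms(1) that Suc.prems(2)] by simp
  then have "Ck_on k S (\<lambda>x. frechet_derivative g (at x) v)" for v
    using Suc.IH[of "\<lambda>x. frechet_derivative f (at x) v"] Suc.prems(1) by simp
  ultimately show ?case by simp
qed

lemma Ck_on_Suc_D: "Ck_on (Suc k) S f \<Longrightarrow> Ck_on k S f"
proof (induction k arbitrary: f)
  case 0
  then show ?case
    by (auto intro!: continuous_at_imp_continuous_on differentiable_imp_continuous_within)
next
  case (Suc k)
  then show ?case unfolding Ck_on.simps(2)[of k] Ck_on.simps(2)[of "Suc k"] by blast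
qed

text \<open>Allows an explicit formula for the derivative in place of
  \<open>frechet_derivative\<close>; openness of \<open>S\<close> transfers the regularity of the
  formula.\<close>

lemma Ck_on_SucI:
  assumes "open S" "\<And>x. x \<in> S \<Longrightarrow> (f has_derivative f' x) (at x)"
    "\<And>v. Ck_on k S (\<lambda>x. f' x v)"
  shows "Ck_on (Suc k) S f"
proof -
  have "f' x v = frechet_derivative f (at x) v" if "x \<in> S" for x v
    using frechet_derivative_at[OF assms(2)[OF that]] by simp
  then show ?thesis
    using Ck_on_cong[OF assms(1) _ assms(3)] differentiableI[OF assms(2)] by auto
qed

lemma Ck_on_add:
  assumes "open S"
  shows "Ck_on k S f \<Longrightarrow> Ck_on k S g \<Longrightarrow> Ck_on k S (\<lambda>x. f x + g x)"
proof (induction k arbitrary: f g)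
  case 0
  then show ?case by (auto intro: continuous_intros)
next
  case (Suc k)
  then show ?case
    by (intro Ck_on_SucI[OF assms, where f'="\<lambda>x v. frechet_derivative f (at x) v + frechet_derivative g (at x) v"])
      (auto intro!: has_derivative_add simp flip: frechet_derivative_works)
qed

lemma Ck_on_scaleR:
  fixes f :: "'a::euclidean_space \<Rightarrow> 'b::real_normed_vector"
  assumes "open S"
  shows "Ck_on k S f \<Longrightarrow> Ck_on k S (\<lambda>x. a *\<^sub>R f x)"
proof (induction k arbitrary: f)
  case 0
  then show ?case by (auto intro: continuous_intros)
next
  case (Suc k)
  then show ?case
    by (intro Ck_on_SucI[OF assms, where f'="\<lambda>x v. a *\<^sub>R frechet_derivative f (at x) v"])
      (auto intro!: derivative_intros simp flip: frechet_derivative_works)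
qed

lemma Ck_on_mult:
  fixes f g :: "'a::euclidean_space \<Rightarrow> real"
  assumes "open S"
  shows "Ck_on k S f \<Longrightarrow> Ck_on k S g \<Longrightarrow> Ck_on k S (\<lambda>x. f x * g x)"
proof (induction k arbitrary: f g)
  case 0
  then show ?case by (auto intro: continuous_intros)
next
  case (Suc k)
  \<comment> \<open>The product rule keeps one factor undifferentiated, and the induction hypothesis
    applies to it only after lowering its order by \<open>Ck_on_Suc_D\<close>.\<close>
  have "Ck_on k S (\<lambda>x. f x * frechet_derivative g (at x) v + frechet_derivative f (at x) v * g x)" for v
    using Suc.prems Ck_on_Suc_D[OF Suc.prems(1)] Ck_on_Suc_D[OF Suc.prems(2)]
    by (intro Ck_on_add[OF assms] Suc.IH) auto
  with Suc.prems show ?case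
    by (intro Ck_on_SucI[OF assms, where f'="\<lambda>x v. f x * frechet_derivative g (at x) v + frechet_derivative f (at x) v * g x"])
      (auto intro!: has_derivative_mult simp flip: frechet_derivative_works)
qed

lemma Ck_on_const: "open S \<Longrightarrow> Ck_on k S (\<lambda>x. a)"
proof (induction k arbitrary: a)
  case (Suc k)
  show ?case by (rule Ck_on_SucI[OF Suc.prems has_derivative_const Suc.IH[OF Suc.prems]])
qed auto

lemma Ck_on_prod:
  fixes f :: "'i \<Rightarrow> 'a::euclidean_space \<Rightarrow> real"
  assumes "open S" "\<And>i. i \<in> I \<Longrightarrow> Ck_on k S (f i)"
  shows "Ck_on k S (\<lambda>x. \<Prod>i\<in>I. f i x)"
  using assms(2)
  by (induction I rule: infinite_finite_induct) (simp_all add: Ck_on_const Ck_on_mult assms(1))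

text \<open>On \<open>t > 0\<close> the \<open>j\<close>-th derivative of \<open>exp (- 1 / t)\<close> is \<open>P\<^sub>j (1 / t) * exp (- 1 / t)\<close> with
  \<open>P\<^sub>j = flat_poly j\<close>.\<close>

primrec flat_poly :: "nat \<Rightarrow> real poly" where
  "flat_poly 0 = 1"
| "flat_poly (Suc j) = monom 1 2 * (flat_poly j - pderiv (flat_poly j))"

definition flat :: "nat \<Rightarrow> real \<Rightarrow> real" where
  "flat j t = (if t > 0 then poly (flat_poly j) (inverse t) * exp (- inverse t) else 0)"

lemma poly_times_exp_minus_tendsto_0:
  fixes p :: "real poly"
  shows "((\<lambda>s. poly p s * exp (- s)) \<longlongrightarrow> 0) at_top"
proof -
  have "((\<lambda>s. \<Sum>i\<le>degree p. coeff p i * (s ^ i / exp s)) \<longlongrightarrow> (\<Sum>i\<le>degree p. coeff p i * 0)) at_top"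
    by (intro tendsto_intros tendsto_power_div_exp_0)
  then show ?thesis
    by (simp add: poly_altdef sum_distrib_right exp_minus field_simps sum_divide_distrib)
qed

text \<open>For \<open>t > 0\<close> the recursion of \<open>flat_poly\<close> is the chain rule in
  \<open>s = 1 / t\<close>. At 0 the right difference quotient is \<open>s * P s * exp (- s)\<close>
  with \<open>s\<close> tending to infinity, and the left one is identically 0.\<close>

lemma flat_has_derivative: "(flat j has_real_derivative flat (Suc j) t) (at t)"
proof -
  consider "t > 0" | "t < 0" | "t = 0" by linarith
  then show ?thesis
  proof cases
    case 1
    have "((\<lambda>t. poly (flat_poly j) (inverse t) * exp (- inverse t)) has_real_derivative flat (Suc j) t) (at t)"
      using 1 by (auto intro!: derivative_eq_intros simp: flat_def poly_monom power2_eq_square algebra_simps)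
    then show ?thesis
      by (rule DERIV_cong_ev[THEN iffD1, OF refl _ refl, rotated])
        (use eventually_nhds_in_open[of "{0<..}" t] 1 in \<open>auto elim!: eventually_mono simp: flat_def\<close>)
  next
    case 2
    have "((\<lambda>t. 0) has_real_derivative flat (Suc j) t) (at t)"
      using 2 by (simp add: flat_def)
    then show ?thesis
      by (rule DERIV_cong_ev[THEN iffD1, OF refl _ refl, rotated])
        (use eventually_nhds_in_open[of "{..<0}" t] 2 in \<open>auto elim!: eventually_mono simp: flat_def\<close>)
  next
    case 3
    have "((\<lambda>h. flat j h / h) \<longlongrightarrow> 0) (at_right 0)"
    proof (rule Lim_transform_eventually)
      show "((\<lambda>h. poly (pCons 0 (flat_poly j)) (inverse h) * exp (- inverse h)) \<longlongrightarrow> 0) (at_right 0)"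
        by (rule filterlim_compose[OF poly_times_exp_minus_tendsto_0 filterlim_inverse_at_top_right])
      show "\<forall>\<^sub>F h in at_right 0. poly (pCons 0 (flat_poly j)) (inverse h) * exp (- inverse h) = flat j h / h"
        by (auto simp: eventually_at_filter flat_def field_simps)
    qed
    moreover have "((\<lambda>h. flat j h / h) \<longlongrightarrow> 0) (at_left 0)"
      by (rule Lim_transform_eventually[OF tendsto_const])
        (auto simp: eventually_at_filter flat_def)
    ultimately have "((\<lambda>h. flat j h / h) \<longlongrightarrow> 0) (at 0)" by (simp add: filterlim_split_at)
    then show ?thesis using 3 by (simp add: DERIV_def flat_def)
  qed
qed

text \<open>Differentiation turns \<open>flat j\<close> into \<open>flat (Suc j)\<close> up to a
  constant factor, so the induction on \<open>k\<close> has to leave \<open>j\<close> free.\<close>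

lemma Ck_on_flat: "Ck_on k UNIV (\<lambda>\<xi>::'a::euclidean_space. flat j (l * (\<xi> \<bullet> e) + c))"
proof (induction k arbitrary: j)
  case 0
  have "continuous_on UNIV (flat j)"
    using flat_has_derivative DERIV_isCont continuous_at_imp_continuous_on by blast
  then have "continuous_on UNIV (flat j \<circ> (\<lambda>\<xi>::'a. l * (\<xi> \<bullet> e) + c))"
    by (intro continuous_on_compose continuous_intros) (auto intro: continuous_on_subset)
  then show ?case by (simp add: o_def)
next
  case (Suc k)
  have d: "((\<lambda>\<xi>. flat j (l * (\<xi> \<bullet> e) + c)) has_derivative
      (\<lambda>v. (l * (v \<bullet> e)) *\<^sub>R flat (Suc j) (l * (x \<bullet> e) + c))) (at x)" for x :: 'a
  proof -
    have "((\<lambda>\<xi>. l * (\<xi> \<bullet> e) + c) has_derivative (\<lambda>v. l * (v \<bullet> e))) (at x)"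
      by (auto intro!: derivative_eq_intros)
    from has_derivative_compose[OF this flat_has_derivative[unfolded has_field_derivative_def]]
    show ?thesis by (simp add: mult_ac)
  qed
  show ?case by (rule Ck_on_SucI[OF open_UNIV d Ck_on_scaleR[OF open_UNIV Suc]])
qed

text \<open>A smooth approximation of the indicator of \<open>box a b\<close>: inside the box every
  argument of \<open>flat 0\<close> tends to infinity with \<open>k\<close>, and there
  \<open>flat 0\<close> tends to 1. \<open>Suc k\<close> avoids the vanishing factor at
  \<open>k = 0\<close>.\<close>

definition bump :: "'a \<Rightarrow> 'a \<Rightarrow> nat \<Rightarrow> 'a::euclidean_space \<Rightarrow> real" where
  "bump a b k \<xi> = (\<Prod>e\<in>Basis. flat 0 (real (Suc k) * (\<xi> \<bullet> e - a \<bullet> e)) * flat 0 (real (Suc k) * (b \<bullet> e - \<xi> \<bullet> e)))"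

lemma flat_0_range: "0 \<le> flat 0 t" "flat 0 t \<le> 1"
  by (auto simp: flat_def)

lemma smooth_on_bump: "smooth_on UNIV (bump a b k)"
proof -
  have "Ck_on j UNIV (\<lambda>\<xi>. flat 0 (real (Suc k) * (\<xi> \<bullet> e) + (- real (Suc k) * (a \<bullet> e)))
      * flat 0 ((- real (Suc k)) * (\<xi> \<bullet> e) + real (Suc k) * (b \<bullet> e)))" for j e
    by (intro Ck_on_mult Ck_on_flat open_UNIV)
  then have "Ck_on j UNIV (\<lambda>\<xi>. flat 0 (real (Suc k) * (\<xi> \<bullet> e - a \<bullet> e)) * flat 0 (real (Suc k) * (b \<bullet> e - \<xi> \<bullet> e)))" for j e
    by (simp add: algebra_simps del: of_nat_Suc)
  then show ?thesis unfolding smooth_on_def bump_def[abs_def] by (intro allI Ck_on_prod open_UNIV)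
qed

lemma bump_eq_0: assumes "\<xi> \<notin> box a b" shows "bump a b k \<xi> = 0"
proof -
  obtain e where e: "e \<in> Basis" "\<xi> \<bullet> e \<le> a \<bullet> e \<or> b \<bullet> e \<le> \<xi> \<bullet> e"
    using assms by (auto simp: mem_box not_less)
  then have "\<not> real (Suc k) * (\<xi> \<bullet> e - a \<bullet> e) > 0 \<or> \<not> real (Suc k) * (b \<bullet> e - \<xi> \<bullet> e) > 0"
    unfolding zero_less_mult_iff by auto
  then have "flat 0 (real (Suc k) * (\<xi> \<bullet> e - a \<bullet> e)) * flat 0 (real (Suc k) * (b \<bullet> e - \<xi> \<bullet> e)) = 0"
    unfolding flat_def by auto
  then show ?thesis using e(1) unfolding bump_def by (intro prod_zero) auto
qed

lemma bump_range: "0 \<le> bump a b k \<xi>" "bump a b k \<xi> \<le> 1"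
  unfolding bump_def using flat_0_range by (auto intro!: prod_nonneg prod_le_1 mult_le_one)

lemma bump_tendsto: "(\<lambda>k. bump a b k \<xi>) \<longlonglongrightarrow> indicator (box a b) \<xi>"
proof (cases "\<xi> \<in> box a b")
  case True
  have "(\<lambda>k. flat 0 (real (Suc k) * t)) \<longlonglongrightarrow> 1" if "t > 0" for t
  proof -
    have "(\<lambda>k. exp (- (inverse (real (Suc k)) * inverse t))) \<longlonglongrightarrow> exp (- (0 * inverse t))"
      by (intro tendsto_intros LIMSEQ_inverse_real_of_nat)
    then show ?thesis using that by (simp add: flat_def field_simps del: of_nat_Suc)
  qed
  note lim = this
  have "(\<lambda>k. bump a b k \<xi>) \<longlonglongrightarrow> (\<Prod>e\<in>(Basis::'a set). 1 * 1)"
    unfolding bump_def using True by (intro tendsto_prod tendsto_mult lim) (auto simp: mem_box)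
  then show ?thesis using True by simp
next
  case False
  then show ?thesis by (simp add: bump_eq_0)
qed

section \<open>Fundamental lemma of the calculus of variations and integration by parts\<close>

lemma smooth_on_UNIV_continuous: "smooth_on UNIV f \<Longrightarrow> continuous_on UNIV f"
  unfolding smooth_on_def by (metis Ck_on.simps(1))

text \<open>Inside a fixed box the positive and negative parts of \<open>g\<close> are densities of
  two measures that agree on all boxes. Boxes form an intersection-stable generator, so the measures
  and hence their densities coincide. Lindelof then covers \<open>S\<close> by countably many such
  boxes.\<close>

lemma AE_eq_0_on_open_if_boxes:
  fixes g :: "'a::euclidean_space \<Rightarrow> real"
  assumes S: "open S"
    and int: "\<And>a b. cbox a b \<subseteq> S \<Longrightarrow> set_integrable lborel (cbox a b) g"
    and zero: "\<And>a b. cbox a b \<subseteq> S \<Longrightarrow> (LINT x:box a b|lborel. g x) = 0"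
  shows "AE x in lborel. x \<in> S \<longrightarrow> g x = 0"
proof -
  have box: "AE x in lborel. x \<in> box a b \<longrightarrow> g x = 0" if ab: "cbox a b \<subseteq> S" for a b
  proof -
    define h where "h x = indicator (box a b) x * g x" for x
    have hi: "integrable lborel h"
      using set_integrable_subset[OF int[OF ab] _ box_subset_cbox]
      by (simp add: set_integrable_def h_def[abs_def])
    then have [measurable]: "h \<in> borel_measurable lborel" by auto
    have fin: "(\<integral>\<^sup>+x. ennreal (h x) \<partial>lborel) \<noteq> \<infinity>" "(\<integral>\<^sup>+x. ennreal (- h x) \<partial>lborel) \<noteq> \<infinity>"
      using hi unfolding real_integrable_def by auto
    have "density lborel (\<lambda>x. ennreal (h x)) = density lborel (\<lambda>x. ennreal (- h x))"
    proof (rule measure_eqI_generator_eq)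
      let ?E = "range (\<lambda>(a, b). box a b::'a set)"
      show "Int_stable ?E" by (auto simp: Int_stable_def box_Int_box)
      show "?E \<subseteq> Pow UNIV" "sets (density lborel (\<lambda>x. ennreal (h x))) = sigma_sets UNIV ?E"
        "sets (density lborel (\<lambda>x. ennreal (- h x))) = sigma_sets UNIV ?E"
        by (simp_all add: borel_eq_box)
      let ?A = "\<lambda>n::nat. box (- (real n *\<^sub>R One)) (real n *\<^sub>R One) :: 'a set"
      show "range ?A \<subseteq> ?E" "(\<Union>i. ?A i) = UNIV" unfolding UN_box_eq_UNIV by auto
      show "emeasure (density lborel (\<lambda>x. ennreal (h x))) (?A i) \<noteq> \<infinity>" for i
      proof -
        have "emeasure (density lborel (\<lambda>x. ennreal (h x))) (?A i) \<le> (\<integral>\<^sup>+x. ennreal (h x) \<partial>lborel)"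
          by (subst emeasure_density) (auto intro!: nn_integral_mono simp: indicator_def)
        then show ?thesis using fin(1) by (auto simp: top_unique)
      qed
      fix X assume "X \<in> ?E"
      then obtain c d where X: "X = box c d" by auto
      \<comment> \<open>The hypothesis \<open>zero\<close> speaks of boxes whose closure lies in
        \<open>S\<close>, so the intersection has to be written as such a box.\<close>
      have "\<exists>p q. box a b \<inter> X = box p q \<and> cbox p q \<subseteq> cbox a b"
        unfolding X box_Int_box by (intro exI conjI, rule refl) (auto simp: mem_box)
      then obtain p q where pq: "box a b \<inter> X = box p q" "cbox p q \<subseteq> cbox a b" by blast
      have hX: "h x * indicator X x = indicator (box p q) x * g x" for x
        unfolding h_def pq(1)[symmetric] by (auto simp: indicator_def)
      have i: "integrable lborel (\<lambda>x. h x * indicator X x)"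
        using integrable_mult_indicator[of X lborel h] hi X by (simp add: mult.commute)
      have "(\<integral>x. h x * indicator X x \<partial>lborel) = 0"
        using zero[of p q] pq(2) ab by (simp add: set_lebesgue_integral_def hX)
      then have "enn2real (\<integral>\<^sup>+x. ennreal (h x * indicator X x) \<partial>lborel) = enn2real (\<integral>\<^sup>+x. ennreal (- (h x * indicator X x)) \<partial>lborel)"
        unfolding real_lebesgue_integral_def[OF i] by simp
      moreover have "(\<integral>\<^sup>+x. ennreal (h x * indicator X x) \<partial>lborel) < top" "(\<integral>\<^sup>+x. ennreal (- (h x * indicator X x)) \<partial>lborel) < top"
        using i unfolding real_integrable_def by (simp_all add: less_top)
      ultimately have "(\<integral>\<^sup>+x. ennreal (h x * indicator X x) \<partial>lborel) = (\<integral>\<^sup>+x. ennreal (- (h x * indicator X x)) \<partial>lborel)"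
        by (metis ennreal_enn2real)
      moreover have "ennreal (h x * indicator X x) = ennreal (h x) * indicator X x"
        "ennreal (- (h x * indicator X x)) = ennreal (- h x) * indicator X x" for x
        by (auto simp: indicator_def)
      ultimately show "emeasure (density lborel (\<lambda>x. ennreal (h x))) X = emeasure (density lborel (\<lambda>x. ennreal (- h x))) X"
        using X by (simp add: emeasure_density)
    qed
    then have "AE x in lborel. ennreal (h x) = ennreal (- h x)"
      using finite_density_unique[of "\<lambda>x. ennreal (h x)" lborel "\<lambda>x. ennreal (- h x)"] fin(1) by auto
    then show ?thesis
    proof eventually_elim
      case (elim x)
      have "h x = 0"
        using elim by (cases "h x \<ge> 0") (auto simp: ennreal_neg ennreal_eq_0_iff dest: sym)
      then show ?case by (auto simp: h_def)
    qed
  qed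
  define \<F> where "\<F> = {box a b | a b. cbox a b \<subseteq> S}"
  obtain \<F>' where F': "\<F>' \<subseteq> \<F>" "countable \<F>'" "\<Union>\<F>' = \<Union>\<F>"
    using Lindelof[of \<F>] by (auto simp: \<F>_def)
  have "S \<subseteq> \<Union>\<F>'"
  proof
    fix x assume "x \<in> S"
    then obtain e where e: "e > 0" "ball x e \<subseteq> S" using S open_contains_ball by blast
    obtain a b where "x \<in> box a b" "cbox a b \<subseteq> ball x e"
      using open_contains_cbox[OF open_ball, of x x e] e(1) by (metis centre_in_ball)
    then show "x \<in> \<Union>\<F>'" unfolding F'(3) \<F>_def using e(2) by blast
  qed
  moreover have "AE x in lborel. \<forall>B\<in>\<F>'. x \<in> B \<longrightarrow> g x = 0"
    using F'(1) box by (subst AE_ball_countable[OF F'(2)]) (auto simp: \<F>_def)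
  ultimately show ?thesis by (auto elim!: eventually_mono)
qed

text \<open>The functions \<open>bump a b k\<close> are admissible test functions, bounded by 1 and
  converging to the indicator of the box. Dominated convergence turns the hypothesis into vanishing
  integrals over boxes.\<close>

lemma AE_eq_0_on_open_if_test:
  fixes g :: "'a::euclidean_space \<Rightarrow> real"
  assumes S: "open S"
    and int: "\<And>K. compact K \<Longrightarrow> K \<subseteq> S \<Longrightarrow> set_integrable lborel K g"
    and test: "\<And>\<psi> K. \<lbrakk>smooth_on UNIV \<psi>; compact K; K \<subseteq> S; \<And>\<xi>. \<xi> \<notin> K \<Longrightarrow> \<psi> \<xi> = 0\<rbrakk>
      \<Longrightarrow> (LINT \<xi>:S|lborel. g \<xi> * \<psi> \<xi>) = 0"
  shows "AE x in lborel. x \<in> S \<longrightarrow> g x = 0"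
proof (rule AE_eq_0_on_open_if_boxes[OF S int])
  fix a b assume ab: "cbox a b \<subseteq> S"
  have i: "integrable lborel (\<lambda>x. indicator (cbox a b) x * g x)"
    using int[OF compact_cbox ab] by (simp add: set_integrable_def)
  have [measurable]: "(bump a b k) \<in> borel_measurable borel" for k
    using smooth_on_UNIV_continuous[OF smooth_on_bump] by (rule borel_measurable_continuous_onI)
  have [measurable]: "(\<lambda>x. indicator (cbox a b) x * g x) \<in> borel_measurable lborel"
    using i by auto
  have "(\<lambda>k. \<integral>x. (indicator (cbox a b) x * g x) * bump a b k x \<partial>lborel) \<longlonglongrightarrow>
     (\<integral>x. (indicator (cbox a b) x * g x) * indicator (box a b) x \<partial>lborel)"
  proof (rule integral_dominated_convergence)
    show "integrable lborel (\<lambda>x. norm (indicator (cbox a b) x * g x))"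
      using i by (rule integrable_norm)
    show "AE x in lborel. (\<lambda>k. indicator (cbox a b) x * g x * bump a b k x) \<longlonglongrightarrow> indicator (cbox a b) x * g x * indicator (box a b) x"
      by (intro always_eventually allI tendsto_intros bump_tendsto)
    show "AE x in lborel. norm (indicator (cbox a b) x * g x * bump a b k x) \<le> norm (indicator (cbox a b) x * g x)" for k
      using bump_range[of a b k] by (auto simp: abs_mult intro!: mult_left_le always_eventually)
  qed measurable
  moreover have "(\<integral>x. (indicator (cbox a b) x * g x) * bump a b k x \<partial>lborel) = 0" for k
  proof -
    have "bump a b k \<xi> = 0" if "\<xi> \<notin> cbox a b" for \<xi>
      using bump_eq_0[of \<xi> a b k] that box_subset_cbox by blast
    then have "(LINT \<xi>:S|lborel. g \<xi> * bump a b k \<xi>) = 0"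
      by (intro test[OF smooth_on_bump compact_cbox ab])
    moreover have eq: "indicator S \<xi> *\<^sub>R (g \<xi> * bump a b k \<xi>) = indicator (cbox a b) \<xi> * g \<xi> * bump a b k \<xi>" for \<xi>
      using bump_eq_0[of \<xi> a b k] box_subset_cbox[of a b] ab by (auto simp: indicator_def)
    ultimately show ?thesis by (simp only: set_lebesgue_integral_def eq)
  qed
  ultimately have "(\<integral>x. (indicator (cbox a b) x * g x) * indicator (box a b) x \<partial>lborel) = 0"
    by (simp add: LIMSEQ_const_iff)
  moreover have "indicator (cbox a b) x * g x * indicator (box a b) x = indicator (box a b) x *\<^sub>R g x" for x
    using box_subset_cbox[of a b] by (auto simp: indicator_def)
  ultimately show "(LINT x:box a b|lborel. g x) = 0"
    by (simp add: set_lebesgue_integral_def)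
qed auto

text \<open>Translation invariance makes the integral of every difference quotient vanish.\<close>

lemma integral_directional_derivative_eq_0:
  fixes f :: "'a::euclidean_space \<Rightarrow> real"
  assumes d: "\<And>x. f differentiable (at x)"
    and c: "continuous_on UNIV (\<lambda>x. frechet_derivative f (at x) v)"
    and K: "compact K" "\<And>x. x \<notin> K \<Longrightarrow> f x = 0"
  shows "(\<integral>x. frechet_derivative f (at x) v \<partial>lborel) = 0"
proof -
  define D where "D x = frechet_derivative f (at x) v" for x
  have cD: "continuous_on UNIV D" using c by (simp add: D_def[abs_def])
  have D0: "D x = 0" if "x \<notin> K" for x
  proof -
    have "frechet_derivative f (at x) = frechet_derivative (\<lambda>x. 0) (at x)"
      by (rule frechet_derivative_transform_within_open[of f x "- K"])
        (use d K that compact_imp_closed in auto)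
    then show ?thesis by (simp add: D_def)
  qed
  have fder: "(f has_derivative frechet_derivative f (at x)) (at x)" for x
    using d frechet_derivative_works by blast
  have ray: "((\<lambda>t. f (x + t *\<^sub>R v)) has_real_derivative D (x + t *\<^sub>R v)) (at t)" for x t
  proof -
    have "((\<lambda>t. f (x + t *\<^sub>R v)) has_derivative (\<lambda>h. frechet_derivative f (at (x + t *\<^sub>R v)) (h *\<^sub>R v))) (at t)"
      by (rule has_derivative_compose[OF _ fder]) (auto intro!: derivative_eq_intros)
    moreover have "frechet_derivative f (at (x + t *\<^sub>R v)) (h *\<^sub>R v) = D (x + t *\<^sub>R v) * h" for h
      using linear_cmul[OF has_derivative_linear[OF fder]] by (simp add: D_def mult.commute)
    ultimately show ?thesis by (simp add: has_field_derivative_def)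
  qed
  have "compact (D ` K)" using compact_continuous_image continuous_on_subset[OF cD] K(1) by blast
  then obtain B where B: "\<And>x. x \<in> K \<Longrightarrow> \<bar>D x\<bar> \<le> B" "B > 0"
    using compact_imp_bounded bounded_pos by (metis imageI real_norm_def)
  have DB: "\<bar>D x\<bar> \<le> B" for x using B D0[of x] by (cases "x \<in> K") auto
  obtain r where r: "\<And>x. x \<in> K \<Longrightarrow> norm x \<le> r"
    using compact_imp_bounded[OF K(1)] bounded_pos by metis
  \<comment> \<open>If \<open>norm x > R\<close>, then neither \<open>x\<close> nor
    \<open>x + h v\<close> with \<open>0 < h \<le> 1\<close> lies in \<open>K\<close>, so all
    difference quotients vanish there. With the mean value theorem inside, \<open>B\<close> on
    \<open>cball 0 R\<close> dominates them.\<close>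
  define R where "R = r + norm v"
  define q where "q n x = real (Suc n) * (f (x + inverse (real (Suc n)) *\<^sub>R v) - f x)" for n x
  have fc: "continuous_on UNIV f"
    using d by (auto intro!: continuous_at_imp_continuous_on differentiable_imp_continuous_within)
  have [measurable]: "f \<in> borel_measurable borel" "D \<in> borel_measurable borel"
    using fc cD by (auto intro: borel_measurable_continuous_onI)
  have fi: "integrable lborel f"
  proof -
    have "integrable lborel (\<lambda>x. indicator K x *\<^sub>R f x)"
      by (rule borel_integrable_compact[OF K(1)]) (rule continuous_on_subset[OF fc], simp)
    moreover have "(\<lambda>x. indicator K x *\<^sub>R f x) = f" using K(2) by (auto simp: indicator_def fun_eq_iff)
    ultimately show ?thesis by simp
  qed
  have fs: "integrable lborel (\<lambda>x. f (x + y)) \<and> (\<integral>x. f (x + y) \<partial>lborel) = (\<integral>x. f x \<partial>lborel)" for y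
  proof -
    have "integrable (distr lborel borel ((+) y)) f" using fi by (simp add: lborel_distr_plus)
    moreover have "(\<integral>x. f x \<partial>lborel) = (\<integral>x. f x \<partial>distr lborel borel ((+) y))"
      by (simp add: lborel_distr_plus)
    ultimately show ?thesis by (simp add: integrable_distr_eq integral_distr add.commute)
  qed
  have "(\<lambda>n. \<integral>x. q n x \<partial>lborel) \<longlonglongrightarrow> (\<integral>x. D x \<partial>lborel)"
  proof (rule integral_dominated_convergence)
    show "integrable lborel (\<lambda>x. indicator (cball (0::'a) R) x *\<^sub>R B)"
      by (rule borel_integrable_compact) auto
    show "AE x in lborel. (\<lambda>n. q n x) \<longlonglongrightarrow> D x"
    proof (intro always_eventually allI)
      fix x
      have "(\<lambda>h. (f (x + h *\<^sub>R v) - f x) / h) \<midarrow>0\<rightarrow> D x"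
        using ray[of x 0] by (simp add: DERIV_def)
      moreover have "filterlim (\<lambda>n. inverse (real (Suc n))) (at 0) sequentially"
        using LIMSEQ_inverse_real_of_nat by (simp add: filterlim_at)
      ultimately have "(\<lambda>n. (f (x + inverse (real (Suc n)) *\<^sub>R v) - f x) / inverse (real (Suc n))) \<longlonglongrightarrow> D x"
        by (rule filterlim_compose)
      then show "(\<lambda>n. q n x) \<longlonglongrightarrow> D x" by (simp add: q_def field_simps)
    qed
    show "AE x in lborel. norm (q n x) \<le> indicator (cball (0::'a) R) x *\<^sub>R B" for n
    proof (intro always_eventually allI)
      fix x
      define h where "h = inverse (real (Suc n))"
      have h: "0 < h" "h \<le> 1" by (auto simp: h_def field_simps)
      obtain z where z: "f (x + h *\<^sub>R v) - f (x + 0 *\<^sub>R v) = (h - 0) * D (x + z *\<^sub>R v)"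
        using MVT2[of 0 h "\<lambda>t. f (x + t *\<^sub>R v)" "\<lambda>t. D (x + t *\<^sub>R v)"] h ray by blast
      then have qz: "q n x = D (x + z *\<^sub>R v)"
        unfolding q_def h_def[symmetric] using h by (simp add: h_def)
      show "norm (q n x) \<le> indicator (cball (0::'a) R) x *\<^sub>R B"
      proof (cases "x \<in> cball 0 R")
        case True then show ?thesis using qz DB by simp
      next
        case False
        have "norm x \<le> norm (x + h *\<^sub>R v) + norm (h *\<^sub>R v)"
          using norm_triangle_ineq4[of "x + h *\<^sub>R v" "h *\<^sub>R v"] by simp
        also have "norm (h *\<^sub>R v) \<le> norm v" using h by (simp add: mult_left_le_one_le)
        finally have "x + h *\<^sub>R v \<notin> K" using False r[of "x + h *\<^sub>R v"] by (auto simp: R_def)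
        moreover have "x \<notin> K" using False r[of x] norm_ge_zero[of v] unfolding R_def by fastforce
        ultimately show ?thesis using K(2) False by (simp add: q_def h_def)
      qed
    qed
  qed (auto simp: q_def[abs_def])
  moreover have "(\<integral>x. q n x \<partial>lborel) = 0" for n
    using fs fi unfolding q_def by (simp add: Bochner_Integration.integral_diff)
  ultimately show ?thesis by (simp add: LIMSEQ_const_iff D_def)
qed

lemma integrable_continuous_compact_support:
  fixes h :: "'a::euclidean_space \<Rightarrow> real"
  assumes "compact K" "continuous_on K h" "\<And>x. x \<notin> K \<Longrightarrow> h x = 0"
  shows "integrable lborel h"
proof -
  have "(\<lambda>x. indicator K x *\<^sub>R h x) = h" using assms(3) by (auto simp: indicator_def fun_eq_iff)
  then show ?thesis using borel_integrable_compact[OF assms(1,2)] by simp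
qed

lemma frechet_derivative_eq_0_outside:
  assumes "compact K" "\<And>x. x \<notin> K \<Longrightarrow> f x = 0" "x \<notin> K"
  shows "(f has_derivative (\<lambda>_. 0)) (at x)" "frechet_derivative f (at x) v = 0"
proof -
  show "(f has_derivative (\<lambda>_. 0)) (at x)"
    by (rule has_derivative_transform_within_open[of "\<lambda>_. 0" _ x UNIV "- K"])
      (use assms compact_imp_closed in auto)
  from frechet_derivative_at[OF this] show "frechet_derivative f (at x) v = 0" by metis
qed

text \<open>The product \<open>f * \<psi>\<close>, extended by 0 outside \<open>S\<close>, is
  differentiable everywhere with compact support, because \<open>\<psi>\<close> vanishes off the
  compact set \<open>K\<close> inside \<open>S\<close>. Its directional derivative has integral 0,
  and the product rule splits that integral.\<close>

lemma integration_by_parts_test: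
  fixes f \<psi> :: "'a::euclidean_space \<Rightarrow> real"
  assumes S: "open S" and f: "Ck_on 1 S f" and p: "Ck_on 1 UNIV \<psi>"
    and K: "compact K" "K \<subseteq> S" "\<And>x. x \<notin> K \<Longrightarrow> \<psi> x = 0"
  shows "(LINT x:S|lborel. f x * frechet_derivative \<psi> (at x) v) =
    - (LINT x:S|lborel. frechet_derivative f (at x) v * \<psi> x)"
proof -
  define h where "h x = (if x \<in> S then f x * \<psi> x else 0)" for x
  define D where "D x = f x * frechet_derivative \<psi> (at x) v + frechet_derivative f (at x) v * \<psi> x" for x
  have K0: "x \<notin> K \<Longrightarrow> h x = 0" "x \<notin> K \<Longrightarrow> D x = 0" for x
    using K(3) frechet_derivative_eq_0_outside[OF K(1,3)] by (auto simp: h_def D_def)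
  have pd: "(\<psi> has_derivative frechet_derivative \<psi> (at x)) (at x)" for x
    using p frechet_derivative_works by auto
  have fd: "(f has_derivative frechet_derivative f (at x)) (at x)" if "x \<in> S" for x
    using f that frechet_derivative_works by auto
  have hS: "(h has_derivative (\<lambda>v. f x * frechet_derivative \<psi> (at x) v + frechet_derivative f (at x) v * \<psi> x)) (at x)"
    if "x \<in> S" for x
    by (rule has_derivative_transform_within_open[OF has_derivative_mult[OF fd[OF that] pd] S that])
      (simp add: h_def)
  have hD: "h differentiable (at x) \<and> frechet_derivative h (at x) v = D x" for x
  proof (cases "x \<in> S")
    case True
    then show ?thesis using hS[OF True] frechet_derivative_at[OF hS[OF True]]
      by (metis D_def differentiable_def)
  next
    case False
    then have "x \<notin> K" using K(2) by auto
    then show ?thesis using frechet_derivative_eq_0_outside[OF K(1), of h x, OF K0(1)] K0(2)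
      by (auto simp: differentiable_def)
  qed
  have fc: "continuous_on S f" "continuous_on S (\<lambda>x. frechet_derivative f (at x) v)"
    using f Ck_on_Suc_D[of 0 S f] by auto
  have pc: "continuous_on UNIV \<psi>" "continuous_on UNIV (\<lambda>x. frechet_derivative \<psi> (at x) v)"
    using p Ck_on_Suc_D[of 0 UNIV \<psi>] by auto
  note c = continuous_on_subset[OF fc(1)] continuous_on_subset[OF fc(2)]
     continuous_on_subset[OF pc(1) subset_UNIV] continuous_on_subset[OF pc(2) subset_UNIV]
  \<comment> \<open>\<open>S\<close> and the complement of \<open>K\<close> are open and cover the
    space; on the second set \<open>D\<close> vanishes.\<close>
  have "continuous_on (S \<union> - K) D"
  proof (rule continuous_on_open_Un[OF S])
    show "continuous_on S D" unfolding D_def by (intro continuous_intros c subset_refl)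
    show "continuous_on (- K) D" by (rule continuous_on_eq[of _ "\<lambda>_. 0"]) (auto simp: K0)
  qed (use K(1) compact_imp_closed in auto)
  moreover have "S \<union> - K = UNIV" using K(2) by auto
  ultimately have "(\<integral>x. D x \<partial>lborel) = 0"
    using integral_directional_derivative_eq_0[of h v K] hD K(1) K0 by simp
  moreover have "integrable lborel (\<lambda>x. indicator S x *\<^sub>R (f x * frechet_derivative \<psi> (at x) v))"
    using K(2) frechet_derivative_eq_0_outside[OF K(1,3)]
    by (intro integrable_continuous_compact_support[OF K(1)] continuous_intros c
          continuous_on_eq[OF continuous_on_const[of K "1::real"]]) (auto simp: indicator_def)
  moreover have "integrable lborel (\<lambda>x. indicator S x *\<^sub>R (frechet_derivative f (at x) v * \<psi> x))"
    using K(2,3)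
    by (intro integrable_continuous_compact_support[OF K(1)] continuous_intros c
          continuous_on_eq[OF continuous_on_const[of K "1::real"]]) (auto simp: indicator_def)
  moreover have "D x = indicator S x *\<^sub>R (f x * frechet_derivative \<psi> (at x) v) +
      indicator S x *\<^sub>R (frechet_derivative f (at x) v * \<psi> x)" for x
    using K0(2)[of x] K(2) by (auto simp: D_def indicator_def)
  ultimately show ?thesis unfolding set_lebesgue_integral_def by simp
qed

section \<open>Charts and covector fields\<close>

definition chart_transition :: "('m, 'n::finite) chart \<Rightarrow> ('m, 'n) chart \<Rightarrow> real ^ 'n \<Rightarrow> real ^ 'n \<Rightarrow> real ^ 'n" where
  "chart_transition c d \<xi> = frechet_derivative (snd d \<circ> chart_inv c) (at \<xi>)"

locale atlas =
  fixes A :: "('m::{t2_space, second_countable_topology}, 'n::finite) chart set"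
  assumes smooth_atlas: "smooth_atlas A"
begin

lemma open_domain: "c \<in> A \<Longrightarrow> open (fst c)"
  and open_chart_range: "c \<in> A \<Longrightarrow> open (chart_range c)"
  and chart_homeomorphism: "c \<in> A \<Longrightarrow> homeomorphism (fst c) (chart_range c) (snd c) (chart_inv c)"
  and charts_cover: "(\<Union>c\<in>A. fst c) = UNIV"
  and smooth_transition: "\<lbrakk>c \<in> A; d \<in> A\<rbrakk> \<Longrightarrow> smooth_on (snd c ` (fst c \<inter> fst d)) (snd d \<circ> chart_inv c)"
  using smooth_atlas unfolding smooth_atlas_def by blast+

lemma chart_inv_chart [simp]: "\<lbrakk>c \<in> A; x \<in> fst c\<rbrakk> \<Longrightarrow> chart_inv c (snd c x) = x"
  and chart_chart_inv [simp]: "\<lbrakk>c \<in> A; \<xi> \<in> chart_range c\<rbrakk> \<Longrightarrow> snd c (chart_inv c \<xi>) = \<xi>"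
  and chart_inv_in [simp]: "\<lbrakk>c \<in> A; \<xi> \<in> chart_range c\<rbrakk> \<Longrightarrow> chart_inv c \<xi> \<in> fst c"
  and chart_in [simp]: "\<lbrakk>c \<in> A; x \<in> fst c\<rbrakk> \<Longrightarrow> snd c x \<in> chart_range c"
  and continuous_on_chart: "c \<in> A \<Longrightarrow> continuous_on (fst c) (snd c)"
  and continuous_on_chart_inv: "c \<in> A \<Longrightarrow> continuous_on (chart_range c) (chart_inv c)"
  using chart_homeomorphism[of c] unfolding homeomorphism_def by blast+

lemma open_chart_image:
  assumes "c \<in> A" "open U"
  shows "open (snd c ` (fst c \<inter> U))"
proof -
  have "openin (top_of_set (fst c)) (fst c \<inter> U)" using assms(2) by (rule openin_open_Int)
  from homeomorphism_imp_open_map[OF chart_homeomorphism[OF assms(1)] this]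
  show ?thesis using open_chart_range[OF assms(1)] openin_open_eq by blast
qed

lemma pref_chart: "pref_chart A x \<in> A" "x \<in> fst (pref_chart A x)"
proof -
  have "\<exists>c. c \<in> A \<and> x \<in> fst c" using charts_cover by blast
  from someI_ex[OF this] show "pref_chart A x \<in> A" "x \<in> fst (pref_chart A x)"
    unfolding pref_chart_def by auto
qed

lemma has_derivative_chart_transition:
  assumes "c \<in> A" "d \<in> A" "x \<in> fst c" "x \<in> fst d"
  shows "((snd d \<circ> chart_inv c) has_derivative chart_transition c d (snd c x)) (at (snd c x))"
proof -
  have "Ck_on 1 (snd c ` (fst c \<inter> fst d)) (snd d \<circ> chart_inv c)"
    using smooth_transition[OF assms(1,2)] unfolding smooth_on_def by blast
  then have "(snd d \<circ> chart_inv c) differentiable (at (snd c x))" using assms(3,4) by auto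
  then show ?thesis unfolding chart_transition_def by (simp add: frechet_derivative_works)
qed

text \<open>The chain rule on the triple overlap, combined with uniqueness of derivatives. Taking
  \<open>e = c\<close> makes the transitions inverse to each other.\<close>

lemma chart_transition_compose:
  assumes "c \<in> A" "d \<in> A" "e \<in> A" "x \<in> fst c" "x \<in> fst d" "x \<in> fst e"
  shows "chart_transition c e (snd c x) = chart_transition d e (snd d x) \<circ> chart_transition c d (snd c x)"
proof -
  have "((snd e \<circ> chart_inv d) \<circ> (snd d \<circ> chart_inv c) has_derivative
      chart_transition d e (snd d x) \<circ> chart_transition c d (snd c x)) (at (snd c x))"
    using assms has_derivative_chart_transition[of d e x]
    by (intro diff_chain_at has_derivative_chart_transition) auto
  moreover have "open (snd c ` (fst c \<inter> (fst d \<inter> fst e)))"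
    using assms open_domain by (intro open_chart_image open_Int) auto
  ultimately have "(snd e \<circ> chart_inv c has_derivative chart_transition d e (snd d x) \<circ> chart_transition c d (snd c x)) (at (snd c x))"
    by (rule has_derivative_transform_within_open) (use assms in auto)
  with has_derivative_chart_transition[of c e x] assms show ?thesis by (blast intro: has_derivative_unique)
qed

lemma chart_transition_refl: assumes "c \<in> A" "x \<in> fst c" shows "chart_transition c c (snd c x) = id"
proof -
  have "(snd c \<circ> chart_inv c has_derivative id) (at (snd c x))"
    by (rule has_derivative_transform_within_open[OF has_derivative_id open_chart_range[OF assms(1)]])
      (use assms in auto)
  with has_derivative_chart_transition[of c c x] assms show ?thesis by (blast intro: has_derivative_unique)
qed

lemma tangent_of_eq: "tangent_of A c x = chart_transition c (pref_chart A x) (snd c x)"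
  by (simp add: tangent_of_def chart_transition_def)

lemma tangent_of_pref: "tangent_of A (pref_chart A x) x = id"
  by (simp add: tangent_of_eq chart_transition_refl pref_chart)

lemma linear_chart_transition: "\<lbrakk>c \<in> A; d \<in> A; x \<in> fst c; x \<in> fst d\<rbrakk> \<Longrightarrow> linear (chart_transition c d (snd c x))"
  using has_derivative_chart_transition has_derivative_linear by blast

lemma linear_tangent_of: "\<lbrakk>c \<in> A; x \<in> fst c\<rbrakk> \<Longrightarrow> linear (tangent_of A c x)"
  unfolding tangent_of_eq by (intro linear_chart_transition pref_chart)

text \<open>The inverse is the transition in the opposite direction, by the cocycle rule
  \<open>chart_transition_compose\<close>.\<close>

lemma bij_tangent_of: assumes "c \<in> A" "x \<in> fst c" shows "bij (tangent_of A c x)"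
proof -
  have "chart_transition (pref_chart A x) c (snd (pref_chart A x) x) \<circ> tangent_of A c x = id"
    "tangent_of A c x \<circ> chart_transition (pref_chart A x) c (snd (pref_chart A x) x) = id"
    using assms pref_chart[of x] unfolding tangent_of_eq
    by (simp_all add: chart_transition_refl flip: chart_transition_compose)
  then show ?thesis by (metis o_bij)
qed

lemma tangent_of_eq_0_iff: "\<lbrakk>c \<in> A; x \<in> fst c\<rbrakk> \<Longrightarrow> tangent_of A c x \<eta> = 0 \<longleftrightarrow> \<eta> = 0"
  using linear_injective_0[OF linear_tangent_of] bij_tangent_of[of c x]
  by (metis bij_def linear_0 linear_tangent_of)

lemma cov_comp_inner:
  assumes "c \<in> A" "x \<in> fst c"
  shows "cov_comp A c w (snd c x) \<bullet> \<eta> = w x \<bullet> tangent_of A c x \<eta>"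
proof -
  have "\<eta> = (\<Sum>i\<in>UNIV. \<eta> $ i *\<^sub>R axis i 1)"
    using basis_expansion[of \<eta>] by (simp add: scalar_mult_eq_scaleR)
  then have "tangent_of A c x \<eta> = (\<Sum>i\<in>UNIV. \<eta> $ i *\<^sub>R tangent_of A c x (axis i 1))"
    using linear_tangent_of[OF assms] by (metis (no_types, lifting) linear_sum linear_cmul sum.cong)
  then show ?thesis
    using assms by (simp add: cov_comp_def inner_vec_def[of _ \<eta>] inner_sum_right mult.commute)
qed

lemma cov_comp_inner':
  "\<lbrakk>c \<in> A; \<xi> \<in> chart_range c\<rbrakk> \<Longrightarrow>
    cov_comp A c w \<xi> \<bullet> \<eta> = w (chart_inv c \<xi>) \<bullet> tangent_of A c (chart_inv c \<xi>) \<eta>"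
  using cov_comp_inner[of c "chart_inv c \<xi>" w \<eta>] by simp

lemma cov_comp_add: "cov_comp A c (\<lambda>x. v x + w x) \<xi> = cov_comp A c v \<xi> + cov_comp A c w \<xi>"
  by (simp add: cov_comp_def Let_def inner_add_left vec_eq_iff)

lemma cov_comp_scale: "cov_comp A c (\<lambda>x. a *\<^sub>R w x) \<xi> = a *\<^sub>R cov_comp A c w \<xi>"
  by (simp add: cov_comp_def Let_def vec_eq_iff)

lemma cov_comp_diff: "cov_comp A c (\<lambda>x. v x - w x) \<xi> = cov_comp A c v \<xi> - cov_comp A c w \<xi>"
  by (simp add: cov_comp_def Let_def inner_diff_left vec_eq_iff)

lemma cov_comp_eq_iff:
  assumes "c \<in> A" "\<xi> \<in> chart_range c"
  shows "cov_comp A c v \<xi> = cov_comp A c w \<xi> \<longleftrightarrow> v (chart_inv c \<xi>) = w (chart_inv c \<xi>)"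
proof
  assume eq: "cov_comp A c v \<xi> = cov_comp A c w \<xi>"
  let ?x = "chart_inv c \<xi>"
  have "(v ?x - w ?x) \<bullet> y = 0" for y
  proof -
    obtain \<eta> where "y = tangent_of A c ?x \<eta>"
      using bij_tangent_of[of c ?x] assms by (metis bij_pointE chart_inv_in)
    then show ?thesis
      using eq cov_comp_inner'[OF assms, of v \<eta>] cov_comp_inner'[OF assms, of w \<eta>]
      by (simp add: inner_diff_left)
  qed
  then show "v ?x = w ?x" by (metis eq_iff_diff_eq_0 inner_eq_zero_iff)
next
  assume "v (chart_inv c \<xi>) = w (chart_inv c \<xi>)"
  then show "cov_comp A c v \<xi> = cov_comp A c w \<xi>" by (simp add: cov_comp_def)
qed

lemma cov_comp_tendsto:
  assumes "(\<lambda>k. W k (chart_inv c \<xi>)) \<longlonglongrightarrow> w (chart_inv c \<xi>)"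
  shows "(\<lambda>k. cov_comp A c (W k) \<xi>) \<longlonglongrightarrow> cov_comp A c w \<xi>"
  unfolding cov_comp_def Let_def by (intro tendsto_vec_lambda tendsto_intros assms)

section \<open>A countable atlas and Borel measurability\<close>

definition chart_seq :: "nat \<Rightarrow> ('m, 'n) chart" where
  "chart_seq = (SOME f. range f \<subseteq> A \<and> (\<Union>i. fst (f i)) = UNIV)"

lemma chart_seq: "chart_seq i \<in> A" "(\<Union>i. fst (chart_seq i)) = UNIV"
proof -
  obtain \<F>' where F: "\<F>' \<subseteq> fst ` A" "countable \<F>'" "\<Union>\<F>' = \<Union>(fst ` A)"
    using Lindelof[of "fst ` A"] open_domain by blast
  then have cov: "\<Union>\<F>' = UNIV" using charts_cover by simp
  then have ne: "\<F>' \<noteq> {}" by auto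
  have "\<exists>c\<in>A. fst c = from_nat_into \<F>' i" for i
    using from_nat_into[OF ne, of i] F(1) by (metis image_iff subsetD)
  then obtain f where f: "\<And>i. f i \<in> A" "\<And>i. fst (f i) = from_nat_into \<F>' i" by metis
  have "(\<Union>i. fst (f i)) = UNIV"
    unfolding f(2) range_from_nat_into[OF ne F(2)] by (rule cov)
  moreover have "range f \<subseteq> A" using f(1) by auto
  ultimately have "range f \<subseteq> A \<and> (\<Union>i. fst (f i)) = UNIV" by simp
  then have "\<exists>f :: nat \<Rightarrow> _. range f \<subseteq> A \<and> (\<Union>i. fst (f i)) = UNIV"
    by (rule exI[where x=f and P="\<lambda>f. range f \<subseteq> A \<and> (\<Union>i. fst (f i)) = UNIV"])
  then have "range chart_seq \<subseteq> A \<and> (\<Union>i. fst (chart_seq i)) = UNIV"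
    unfolding chart_seq_def by (rule someI_ex)
  then show "chart_seq i \<in> A" "(\<Union>i. fst (chart_seq i)) = UNIV" by auto
qed

text \<open>Unlike \<open>pref_chart\<close>, the first chart of the sequence that contains a point
  is a choice with Borel level sets, so objects defined through it can be measurable.\<close>

definition chart_index :: "'m \<Rightarrow> nat" where
  "chart_index x = (LEAST i. x \<in> fst (chart_seq i))"

abbreviation chart_at :: "'m \<Rightarrow> ('m, 'n) chart" where
  "chart_at x \<equiv> chart_seq (chart_index x)"

lemma chart_at: "x \<in> fst (chart_at x)"
proof -
  obtain i where "x \<in> fst (chart_seq i)" using chart_seq(2) by blast
  then show ?thesis unfolding chart_index_def by (rule LeastI)
qed

lemma chart_index_sets: "{x. chart_index x = i} \<in> sets borel"
proof -
  have "chart_index x = i \<longleftrightarrow> x \<in> fst (chart_seq i) \<and> (\<forall>j<i. x \<notin> fst (chart_seq j))" for x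
  proof
    have "x \<notin> fst (chart_seq j)" if "j < chart_index x" for j
      using that unfolding chart_index_def by (rule not_less_Least)
    moreover assume "chart_index x = i"
    ultimately show "x \<in> fst (chart_seq i) \<and> (\<forall>j<i. x \<notin> fst (chart_seq j))"
      using chart_at[of x] by simp
  next
    assume *: "x \<in> fst (chart_seq i) \<and> (\<forall>j<i. x \<notin> fst (chart_seq j))"
    show "chart_index x = i" unfolding chart_index_def
      by (rule Least_equality) (use * not_less in blast)+
  qed
  then have "{x. chart_index x = i} = fst (chart_seq i) - (\<Union>j<i. fst (chart_seq j))" by auto
  then show ?thesis using open_domain chart_seq(1) by (auto intro!: borel_open)
qed

text \<open>On each of the countably many Borel level sets of \<open>chart_index\<close>,
  \<open>h\<close> is the coordinate expression of \<open>H i\<close> composed with the continuous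
  chart map.\<close>

lemma measurable_chart_piecewise:
  fixes h :: "'m \<Rightarrow> 'b::topological_space"
  assumes "\<And>i. (\<lambda>\<xi>. H i (chart_inv (chart_seq i) \<xi>)) \<in> borel_measurable (restrict_space borel (chart_range (chart_seq i)))"
    and "\<And>x. h x = H (chart_index x) x"
  shows "h \<in> borel_measurable borel"
proof (rule measurable_piecewise_restrict[of "range (\<lambda>i. {x. chart_index x = i})"])
  fix S assume "S \<in> range (\<lambda>i. {x. chart_index x = i})"
  then obtain i where S: "S = {x. chart_index x = i}" by blast
  let ?c = "chart_seq i"
  have sub: "S \<subseteq> fst ?c" using chart_at unfolding S by blast
  show "S \<inter> space borel \<in> sets borel" using chart_index_sets S by simp
  have "snd ?c \<in> borel_measurable (restrict_space borel S)"
    using continuous_on_subset[OF continuous_on_chart[OF chart_seq(1)] sub]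
    by (rule borel_measurable_continuous_on_restrict)
  moreover have "snd ?c \<in> space (restrict_space borel S) \<rightarrow> chart_range ?c"
    using sub chart_seq(1) by (auto simp: space_restrict_space)
  ultimately have "snd ?c \<in> measurable (restrict_space borel S) (restrict_space borel (chart_range ?c))"
    by (intro measurable_restrict_space2)
  from measurable_compose[OF this assms(1)]
  have "(\<lambda>x. H i (chart_inv ?c (snd ?c x))) \<in> borel_measurable (restrict_space borel S)" .
  then show "h \<in> borel_measurable (restrict_space borel S)"
    by (rule measurable_cong[THEN iffD1, rotated])
      (use sub chart_seq(1) S assms(2) in \<open>auto simp: space_restrict_space\<close>)
qed auto

lemma measurable_chartwise:
  fixes h :: "'m \<Rightarrow> 'b::topological_space"
  assumes "\<And>c. c \<in> A \<Longrightarrow> (\<lambda>\<xi>. h (chart_inv c \<xi>)) \<in> borel_measurable (restrict_space borel (chart_range c))"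
  shows "h \<in> borel_measurable borel"
  by (rule measurable_chart_piecewise[where H="\<lambda>_. h"]) (use assms chart_seq(1) in auto)

lemma measurable_chart_inv:
  assumes "c \<in> A" shows "chart_inv c \<in> measurable (restrict_space borel (chart_range c)) borel"
  using continuous_on_chart_inv[OF assms] by (rule borel_measurable_continuous_on_restrict)

text \<open>Integrability and the comparison of measures are available over compact sets;
  countability of the exhaustion extends measurability and null set statements to the full chart
  range.\<close>

lemma chart_range_exhaustion:
  assumes "c \<in> A"
  obtains \<K> where "countable \<K>" "\<forall>K\<in>\<K>. compact K \<and> K \<subseteq> chart_range c" "\<Union>\<K> = chart_range c"
proof -
  obtain D where D: "countable D" "D \<subseteq> Pow (chart_range c)" "\<And>X. X \<in> D \<Longrightarrow> \<exists>a b. X = cbox a b"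
    "\<Union>D = chart_range c"
    using open_countable_Union_open_cbox[OF open_chart_range[OF assms]] by metis
  have "compact K \<and> K \<subseteq> chart_range c" if "K \<in> D" for K
    using D(3)[OF that] D(2) that by auto
  with D(1,4) show ?thesis by (intro that) auto
qed

end

section \<open>Polar gauges and the Binet-Legendre form\<close>

text \<open>The comparison constants \<open>a\<close> and \<open>b\<close> are parameters so that
  one pair can serve all points of a compact set. Symmetry and convexity of the gauge are left out,
  since the locale has to cover both \<open>F\<close> and \<open>symm F\<close>.\<close>

locale polar_gauge =
  fixes f :: "'x \<Rightarrow> real ^ 'n::finite \<Rightarrow> real" and x :: 'x and a b :: real
  assumes a_pos: "a > 0" and b_pos: "b > 0"
    and gauge_lower: "a * norm y \<le> f x y" and gauge_upper: "f x y \<le> b * norm y"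
    and gauge_scale: "t \<ge> 0 \<Longrightarrow> f x (t *\<^sub>R y) = t * f x y"
begin

lemma gauge_pos: "y \<noteq> 0 \<Longrightarrow> f x y > 0"
  using gauge_lower[of y] a_pos by (smt (verit) mult_pos_pos zero_less_norm_iff)

lemma gauge_0: "f x 0 = 0" using gauge_scale[of 0 0] by simp

lemma polar_bdd: "bdd_above ((\<lambda>y. (\<alpha> \<bullet> y) / f x y) ` (- {0}))"
proof (rule bdd_aboveI2)
  fix y :: "real ^ 'n" assume "y \<in> - {0}"
  then have y: "y \<noteq> 0" by simp
  have "\<alpha> \<bullet> y \<le> norm \<alpha> * norm y" by (rule norm_cauchy_schwarz)
  also have "\<dots> = (norm \<alpha> / a) * (a * norm y)" using a_pos by simp
  also have "\<dots> \<le> (norm \<alpha> / a) * f x y" using a_pos gauge_lower by (intro mult_left_mono) auto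
  finally show "(\<alpha> \<bullet> y) / f x y \<le> norm \<alpha> / a" using gauge_pos[OF y] by (simp add: pos_divide_le_eq)
qed

lemma inner_le_polar: "\<alpha> \<bullet> y \<le> polar f x \<alpha> * f x y"
proof (cases "y = 0")
  case True then show ?thesis by (simp add: gauge_0)
next
  case False
  then have "(\<alpha> \<bullet> y) / f x y \<le> polar f x \<alpha>"
    unfolding polar_def by (intro cSUP_upper polar_bdd) auto
  then show ?thesis using gauge_pos[OF False] by (simp add: pos_divide_le_eq)
qed

lemma nonzero_nonempty: "- {0 :: real ^ 'n} \<noteq> {}"
proof -
  have "axis undefined (1::real) \<in> - {0 :: real ^ 'n}" by (simp add: axis_eq_0_iff)
  then show ?thesis by blast
qed

lemma polar_le:
  assumes "\<And>y. y \<noteq> 0 \<Longrightarrow> \<alpha> \<bullet> y \<le> t * f x y"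
  shows "polar f x \<alpha> \<le> t"
  unfolding polar_def
  by (rule cSUP_least[OF nonzero_nonempty]) (use assms gauge_pos in \<open>auto simp: pos_divide_le_eq\<close>)

lemma polar_le_iff: "polar f x \<alpha> \<le> t \<longleftrightarrow> (\<forall>y. y \<noteq> 0 \<longrightarrow> \<alpha> \<bullet> y \<le> t * f x y)"
  using polar_le inner_le_polar[of \<alpha>] gauge_pos
  by (meson less_imp_le mult_right_mono order_trans)

lemma polar_upper: "polar f x \<alpha> \<le> norm \<alpha> / a"
proof (rule polar_le)
  fix y
  have "\<alpha> \<bullet> y \<le> norm \<alpha> * norm y" by (rule norm_cauchy_schwarz)
  also have "\<dots> = (norm \<alpha> / a) * (a * norm y)" using a_pos by simp
  also have "\<dots> \<le> (norm \<alpha> / a) * f x y" using a_pos gauge_lower by (intro mult_left_mono) auto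
  finally show "\<alpha> \<bullet> y \<le> norm \<alpha> / a * f x y" .
qed

text \<open>In the absence of symmetry, a negative value would make both
  \<open>\<alpha> \<bullet> y\<close> and \<open>\<alpha> \<bullet> (- y)\<close> negative.\<close>

lemma polar_nonneg: "polar f x \<alpha> \<ge> 0"
proof (rule ccontr)
  assume n: "\<not> polar f x \<alpha> \<ge> 0"
  obtain y :: "real ^ 'n" where y: "y \<noteq> 0" using nonzero_nonempty by auto
  have "\<alpha> \<bullet> y < 0" "\<alpha> \<bullet> (- y) < 0"
    using inner_le_polar[of \<alpha> y] inner_le_polar[of \<alpha> "- y"] gauge_pos[of y] gauge_pos[of "- y"] y n
    by (smt (verit) mult_neg_pos neg_equal_0_iff_equal)+
  then show False by simp
qed

lemma polar_lower: "norm \<alpha> / b \<le> polar f x \<alpha>"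
proof (cases "\<alpha> = 0")
  case True then show ?thesis using polar_nonneg by simp
next
  case False
  \<comment> \<open>The test vector is \<open>y = \<alpha>\<close>, covector and vector sharing the
    same component space.\<close>
  have "norm \<alpha> * norm \<alpha> \<le> polar f x \<alpha> * (b * norm \<alpha>)"
    using inner_le_polar[of \<alpha> \<alpha>] mult_left_mono[OF gauge_upper polar_nonneg, of \<alpha> \<alpha>]
    by (simp add: dot_square_norm power2_eq_square)
  then show ?thesis using False b_pos by (simp add: field_simps)
qed

lemma polar_add: "polar f x (\<alpha> + \<beta>) \<le> polar f x \<alpha> + polar f x \<beta>"
  by (rule polar_le)
    (use inner_le_polar[of \<alpha>] inner_le_polar[of \<beta>] in \<open>auto simp: inner_add_left distrib_right intro: add_mono\<close>)

lemma polar_zero: "polar f x 0 = 0"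
  using polar_upper[of 0] polar_nonneg[of 0] by simp

lemma polar_scale_le: assumes "t \<ge> 0" shows "polar f x (t *\<^sub>R \<alpha>) \<le> t * polar f x \<alpha>"
  by (rule polar_le) (use mult_left_mono[OF inner_le_polar assms] in \<open>simp add: mult.assoc\<close>)

lemma polar_scale: assumes "t \<ge> 0" shows "polar f x (t *\<^sub>R \<alpha>) = t * polar f x \<alpha>"
proof (cases "t = 0")
  case True then show ?thesis by (simp add: polar_zero)
next
  case False
  with assms have t: "t > 0" by simp
  have "polar f x \<alpha> \<le> inverse t * polar f x (t *\<^sub>R \<alpha>)"
    using polar_scale_le[of "inverse t" "t *\<^sub>R \<alpha>"] t by simp
  then show ?thesis using polar_scale_le[OF assms, of \<alpha>] t by (simp add: field_simps)
qed

text \<open>Subadditivity in both orders reduces the difference to \<open>polar_upper\<close> of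
  \<open>\<alpha> - \<beta>\<close>. The resulting continuity is what later allows countable dense
  sets and pointwise limits.\<close>

lemma polar_lipschitz: "\<bar>polar f x \<alpha> - polar f x \<beta>\<bar> \<le> norm (\<alpha> - \<beta>) / a"
  using polar_add[of "\<alpha> - \<beta>" \<beta>] polar_add[of "\<beta> - \<alpha>" \<alpha>] polar_upper[of "\<alpha> - \<beta>"]
    polar_upper[of "\<beta> - \<alpha>"] by (simp add: norm_minus_commute)

lemma continuous_on_polar: "continuous_on S (polar f x)"
proof (rule continuous_on_subset[OF lipschitz_on_continuous_on])
  show "lipschitz_on (1 / a) UNIV (polar f x)"
    using a_pos polar_lipschitz by (auto simp: lipschitz_on_def dist_real_def dist_norm)
qed auto

end

text \<open>The unit ball of the bidual gauge: unlike the unit ball of \<open>f x\<close>, it is convex for every \<open>f\<close>.\<close>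

definition polar_body :: "('x \<Rightarrow> real ^ 'n::finite \<Rightarrow> real) \<Rightarrow> 'x \<Rightarrow> (real ^ 'n) set" where
  "polar_body f x = {y. \<forall>\<alpha>. \<alpha> \<bullet> y \<le> polar f x \<alpha>}"

text \<open>The Binet-Legendre form: a Euclidean structure on covectors which is comparable with the
  square of the polar gauge, with constants depending only on the dimension.\<close>

definition binet_legendre :: "('x \<Rightarrow> real ^ 'n::finite \<Rightarrow> real) \<Rightarrow> 'x \<Rightarrow> real ^ 'n \<Rightarrow> real ^ 'n \<Rightarrow> real" where
  "binet_legendre f x \<alpha> \<beta> =
    (LINT y:polar_body f x|lborel. (\<alpha> \<bullet> y) * (\<beta> \<bullet> y)) / measure lborel (polar_body f x)"

locale symmetric_polar_gauge = polar_gauge f x a b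
  for f :: "'x \<Rightarrow> real ^ 'n::finite \<Rightarrow> real" and x a b +
  assumes gauge_minus: "f x (- y) = f x y"
begin

lemma polar_minus: "polar f x (- \<alpha>) = polar f x \<alpha>"
proof -
  have "polar f x (- \<beta>) \<le> polar f x \<beta>" for \<beta>
    by (rule polar_le) (use inner_le_polar[of \<beta> "- y" for y] in \<open>simp add: gauge_minus\<close>)
  from this[of \<alpha>] this[of "- \<alpha>"] show ?thesis by simp
qed

lemma polar_scale_abs: "polar f x (t *\<^sub>R \<alpha>) = \<bar>t\<bar> * polar f x \<alpha>"
  using polar_scale[of "\<bar>t\<bar>" \<alpha>] polar_minus[of "t *\<^sub>R \<alpha>"] by (cases "t \<ge> 0") auto

lemma abs_inner_le: "y \<in> polar_body f x \<Longrightarrow> \<bar>\<alpha> \<bullet> y\<bar> \<le> polar f x \<alpha>"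
  using polar_minus[of \<alpha>] unfolding polar_body_def
  by (smt (verit) inner_minus_left mem_Collect_eq)

text \<open>The easy inclusion into the bidual ball. It gives the body interior points and supplies
  vectors of the body at which a covector is nearly maximal.\<close>

lemma gauge_ball_subset: "f x y \<le> 1 \<Longrightarrow> y \<in> polar_body f x"
  using inner_le_polar[of _ y] polar_nonneg mult_left_mono[of "f x y" 1 "polar f x _"]
  unfolding polar_body_def by (auto intro: order_trans)

lemma compact_polar_body: "compact (polar_body f x)"
proof -
  have "closed (\<Inter>\<alpha>. {y. \<alpha> \<bullet> y \<le> polar f x \<alpha>})"
    by (intro closed_INT ballI closed_halfspace_le)
  moreover have "(\<Inter>\<alpha>. {y. \<alpha> \<bullet> y \<le> polar f x \<alpha>}) = polar_body f x" by (auto simp: polar_body_def)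
  moreover have "norm y \<le> 1 / a" if "y \<in> polar_body f x" for y
  proof (cases "y = 0")
    case False
    have "norm y * norm y \<le> norm y / a"
      using that polar_upper[of y] unfolding polar_body_def
      by (smt (verit) dot_square_norm mem_Collect_eq power2_eq_square)
    then have "norm y * norm y \<le> norm y * (1 / a)" by simp
    then show ?thesis using False mult_le_cancel_left_pos[of "norm y" "norm y" "1 / a"] by simp
  qed (use a_pos in auto)
  ultimately show ?thesis by (auto simp: compact_eq_bounded_closed bounded_iff)
qed

lemma measure_polar_body_pos: "measure lborel (polar_body f x) > 0"
proof -
  have "ball 0 (1 / b) \<subseteq> polar_body f x"
    using gauge_upper b_pos by (intro subsetI gauge_ball_subset) (force simp: field_simps intro: order_trans)
  then have "measure lborel (ball (0::real^'n) (1 / b)) \<le> measure lborel (polar_body f x)"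
    by (rule measure_mono_fmeasurable) (use compact_polar_body fmeasurable_compact in auto)
  moreover have "measure lborel (ball (0::real^'n) (1 / b)) > 0"
    using b_pos content_ball_pos[of "1 / b" 0] by simp
  ultimately show ?thesis by linarith
qed

lemma set_integrable_body:
  assumes "continuous_on (polar_body f x) g"
  shows "set_integrable lborel (polar_body f x) (g :: _ \<Rightarrow> real)"
  unfolding set_integrable_def by (rule borel_integrable_compact[OF compact_polar_body assms])

lemma binet_legendre_commute: "binet_legendre f x \<alpha> \<beta> = binet_legendre f x \<beta> \<alpha>"
  by (simp add: binet_legendre_def mult.commute)

lemma binet_legendre_add:
  "binet_legendre f x (\<alpha> + \<alpha>') \<beta> = binet_legendre f x \<alpha> \<beta> + binet_legendre f x \<alpha>' \<beta>"
proof -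
  have "(LINT y:polar_body f x|lborel. ((\<alpha> + \<alpha>') \<bullet> y) * (\<beta> \<bullet> y)) =
     (LINT y:polar_body f x|lborel. (\<alpha> \<bullet> y) * (\<beta> \<bullet> y)) + (LINT y:polar_body f x|lborel. (\<alpha>' \<bullet> y) * (\<beta> \<bullet> y))"
    unfolding inner_add_left distrib_right
    by (intro set_integral_add set_integrable_body continuous_intros)
  then show ?thesis by (simp add: binet_legendre_def add_divide_distrib)
qed

lemma binet_legendre_scale: "binet_legendre f x (t *\<^sub>R \<alpha>) \<beta> = t * binet_legendre f x \<alpha> \<beta>"
  by (simp add: binet_legendre_def mult.assoc)

text \<open>The integrand is bounded by the square of the polar on the whole body, and the form is
  an average over the body.\<close>

lemma binet_legendre_upper: "binet_legendre f x \<alpha> \<alpha> \<le> (polar f x \<alpha>)\<^sup>2"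
proof -
  have "(LINT y:polar_body f x|lborel. (\<alpha> \<bullet> y) * (\<alpha> \<bullet> y)) \<le> (LINT y:polar_body f x|lborel. (polar f x \<alpha>)\<^sup>2)"
  proof (intro set_integral_mono set_integrable_body continuous_intros)
    fix y assume "y \<in> polar_body f x"
    from abs_inner_le[OF this, of \<alpha>] show "(\<alpha> \<bullet> y) * (\<alpha> \<bullet> y) \<le> (polar f x \<alpha>)\<^sup>2"
      by (metis abs_ge_zero power2_abs power2_eq_square power_mono)
  qed
  also have "\<dots> = measure lborel (polar_body f x) * (polar f x \<alpha>)\<^sup>2"
    using compact_polar_body by (simp add: set_lebesgue_integral_def)
  finally show ?thesis
    using measure_polar_body_pos by (simp add: binet_legendre_def pos_divide_le_eq mult.commute)
qed

text \<open>If \<open>\<alpha>\<close> is almost maximal at \<open>y0\<close>, it is still large on the copy of the body shrunk by a factor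
  \<open>1/3\<close> towards \<open>y0\<close>.\<close>

lemma binet_legendre_lower:
  "(polar f x \<alpha>)\<^sup>2 / (36 * 3 ^ CARD('n)) \<le> binet_legendre f x \<alpha> \<alpha>"
proof (cases "polar f x \<alpha> = 0")
  case True
  then show ?thesis
    by (auto simp: binet_legendre_def set_lebesgue_integral_def intro!: divide_nonneg_nonneg integral_nonneg)
next
  case False
  define s where "s = polar f x \<alpha>"
  have s: "s > 0" using False polar_nonneg[of \<alpha>] by (simp add: s_def)
  \<comment> \<open>Any fraction above 1/2 would do. With 3/4 the shrunk copy retains
    \<open>2/3 * 3/4 - 1/3 = 1/6\<close> of the polar value, whence the factor
    \<open>36 = 6^2\<close>; the power of 3 is the volume ratio of the two bodies.\<close>
  have "\<not> polar f x \<alpha> \<le> 3/4 * s" using s by (simp add: s_def)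
  then obtain z where z: "z \<noteq> 0" "\<alpha> \<bullet> z > 3/4 * s * f x z"
    unfolding polar_le_iff by (auto simp: not_le)
  define y0 where "y0 = inverse (f x z) *\<^sub>R z"
  have y0: "y0 \<in> polar_body f x" "\<alpha> \<bullet> y0 \<ge> 3/4 * s"
    using gauge_pos[OF z(1)] z gauge_scale[of "inverse (f x z)" z]
    by (auto simp: y0_def field_simps intro!: gauge_ball_subset)
  define B where "B = (\<lambda>w. (1/3) *\<^sub>R w + (2/3) *\<^sub>R y0) ` polar_body f x"
  have cB: "compact B"
    unfolding B_def by (intro compact_continuous_image continuous_intros compact_polar_body)
  have sub: "B \<subseteq> polar_body f x"
  proof
    fix y assume "y \<in> B"
    then obtain w where w: "w \<in> polar_body f x" "y = (1/3) *\<^sub>R w + (2/3) *\<^sub>R y0" by (auto simp: B_def)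
    have "\<beta> \<bullet> y \<le> polar f x \<beta>" for \<beta>
    proof -
      have "\<beta> \<bullet> y0 \<le> polar f x \<beta>" "\<beta> \<bullet> w \<le> polar f x \<beta>"
        using y0(1) w(1) by (auto simp: polar_body_def)
      then show ?thesis unfolding w(2) by (simp add: inner_add_right)
    qed
    then show "y \<in> polar_body f x" by (simp add: polar_body_def)
  qed
  have large: "\<alpha> \<bullet> y \<ge> s / 6" if "y \<in> B" for y
  proof -
    obtain w where w: "w \<in> polar_body f x" "y = (1/3) *\<^sub>R w + (2/3) *\<^sub>R y0"
      using \<open>y \<in> B\<close> by (auto simp: B_def)
    show ?thesis using abs_inner_le[OF w(1), of \<alpha>] y0(2) by (simp add: w(2) inner_add_right s_def)
  qed
  have "measure lebesgue B = \<bar>1/3\<bar> ^ CARD('n) * measure lebesgue (polar_body f x)"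
    unfolding B_def using measure_lebesgue_affine[of "1/3" "(2/3) *\<^sub>R y0" "polar_body f x"] by simp
  then have mB: "measure lborel B = measure lborel (polar_body f x) / 3 ^ CARD('n)"
    using cB compact_polar_body by (simp add: power_one_over measure_completion compact_imp_closed)
  have "(s / 6)\<^sup>2 * measure lborel B = (LINT y:B|lborel. (s / 6)\<^sup>2)"
    using cB by (simp add: set_lebesgue_integral_def)
  also have "\<dots> \<le> (LINT y:B|lborel. (\<alpha> \<bullet> y) * (\<alpha> \<bullet> y))"
  proof (rule set_integral_mono)
    show "set_integrable lborel B (\<lambda>y. (s / 6)\<^sup>2)" "set_integrable lborel B (\<lambda>y. (\<alpha> \<bullet> y) * (\<alpha> \<bullet> y))"
      unfolding set_integrable_def by (intro borel_integrable_compact cB continuous_intros)+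
    fix y assume "y \<in> B"
    from large[OF this] s show "(s / 6)\<^sup>2 \<le> (\<alpha> \<bullet> y) * (\<alpha> \<bullet> y)"
      unfolding power2_eq_square by (intro mult_mono) auto
  qed
  also have "\<dots> \<le> (LINT y:polar_body f x|lborel. (\<alpha> \<bullet> y) * (\<alpha> \<bullet> y))"
    unfolding set_lebesgue_integral_def
    by (intro integral_mono borel_integrable_compact cB compact_polar_body continuous_intros)
      (use sub in \<open>auto simp: indicator_def\<close>)
  finally have "(s / 6)\<^sup>2 * (measure lborel (polar_body f x) / 3 ^ CARD('n)) / measure lborel (polar_body f x)
     \<le> binet_legendre f x \<alpha> \<alpha>"
    unfolding mB binet_legendre_def using measure_polar_body_pos by (intro divide_right_mono) auto
  then show ?thesis using measure_polar_body_pos by (simp add: s_def power_divide)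
qed

end

section \<open>Metrics on the tangent bundle\<close>

text \<open>The properties shared by \<open>F\<close> and \<open>symm F\<close>, so that the
  compactness and measurability arguments for polars are carried out once.\<close>

locale metric_field = atlas A
  for A :: "('m::{t2_space, second_countable_topology}, 'n::finite) chart set" +
  fixes G :: "'m \<Rightarrow> real ^ 'n \<Rightarrow> real"
  assumes G_pos: "y \<noteq> 0 \<Longrightarrow> G x y > 0"
    and G_scale: "t \<ge> 0 \<Longrightarrow> G x (t *\<^sub>R y) = t * G x y"
    and F_loc_cont: "c \<in> A \<Longrightarrow> continuous_on (chart_range c \<times> UNIV) (\<lambda>(\<xi>, \<eta>). F_loc A G c \<xi> \<eta>)"
begin

abbreviation "G_loc \<equiv> F_loc A G"

lemma G_loc_chart: "\<lbrakk>c \<in> A; x \<in> fst c\<rbrakk> \<Longrightarrow> G_loc c (snd c x) \<eta> = G x (tangent_of A c x \<eta>)"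
  by (simp add: F_loc_def)

lemma G_loc_pos:
  assumes "c \<in> A" "\<xi> \<in> chart_range c" "\<eta> \<noteq> 0" shows "G_loc c \<xi> \<eta> > 0"
  using assms tangent_of_eq_0_iff[of c "chart_inv c \<xi>" \<eta>] by (auto simp: F_loc_def Let_def intro: G_pos)

lemma G_loc_scale:
  assumes "c \<in> A" "\<xi> \<in> chart_range c" "t \<ge> 0"
  shows "G_loc c \<xi> (t *\<^sub>R \<eta>) = t * G_loc c \<xi> \<eta>"
  using assms linear_cmul[OF linear_tangent_of[of c "chart_inv c \<xi>"]] by (simp add: F_loc_def Let_def G_scale)

text \<open>The constants are the minimum and the maximum of \<open>G_loc c\<close> on the compact
  product of \<open>K\<close> with the unit sphere; positivity makes the minimum positive and
  homogeneity extends the bounds to all vectors.\<close>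

lemma compact_polar_gauge:
  assumes c: "c \<in> A" and K: "compact K" "K \<subseteq> chart_range c"
  obtains a b where "a > 0" "b > 0" "\<And>\<xi>. \<xi> \<in> K \<Longrightarrow> polar_gauge (G_loc c) \<xi> a b"
proof (cases "K = {}")
  case True then show ?thesis using that[of 1 1] by auto
next
  case False
  let ?S = "K \<times> sphere (0 :: real ^ 'n) 1"
  have cS: "compact ?S" using K(1) by (intro compact_Times) auto
  have neS: "?S \<noteq> {}" using False norm_axis_1[of undefined] by (force simp: dist_norm)
  have cont: "continuous_on ?S (\<lambda>(\<xi>, \<eta>). G_loc c \<xi> \<eta>)"
    by (rule continuous_on_subset[OF F_loc_cont[OF c]]) (use K(2) in auto)
  obtain p where p: "p \<in> ?S" "\<And>q. q \<in> ?S \<Longrightarrow> G_loc c (fst p) (snd p) \<le> G_loc c (fst q) (snd q)"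
    using continuous_attains_inf[OF cS neS cont] by (auto simp: case_prod_beta)
  obtain r where r: "r \<in> ?S" "\<And>q. q \<in> ?S \<Longrightarrow> G_loc c (fst q) (snd q) \<le> G_loc c (fst r) (snd r)"
    using continuous_attains_sup[OF cS neS cont] by (auto simp: case_prod_beta)
  have pos: "G_loc c (fst q) (snd q) > 0" if "q \<in> ?S" for q
    using that K(2) by (intro G_loc_pos[OF c]) auto
  show ?thesis
  proof (rule that[OF pos[OF p(1)] pos[OF r(1)]])
    fix \<xi> assume \<xi>: "\<xi> \<in> K"
    have *: "G_loc c (fst p) (snd p) * norm \<eta> \<le> G_loc c \<xi> \<eta> \<and> G_loc c \<xi> \<eta> \<le> G_loc c (fst r) (snd r) * norm \<eta>" for \<eta>
    proof (cases "\<eta> = 0")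
      case True
      then show ?thesis using G_loc_scale[OF c, of \<xi> 0 0] \<xi> K(2) by auto
    next
      case False
      define e where "e = inverse (norm \<eta>) *\<^sub>R \<eta>"
      have e: "(\<xi>, e) \<in> ?S" using False \<xi> by (auto simp: e_def)
      have "\<eta> = norm \<eta> *\<^sub>R e" using False by (simp add: e_def)
      then have "G_loc c \<xi> \<eta> = norm \<eta> * G_loc c \<xi> e"
        using G_loc_scale[OF c, of \<xi> "norm \<eta>" e] \<xi> K(2) by auto
      then show ?thesis
        using mult_left_mono[OF p(2)[OF e], of "norm \<eta>"] mult_left_mono[OF r(2)[OF e], of "norm \<eta>"]
        by (simp add: mult.commute)
    qed
    show "polar_gauge (G_loc c) \<xi> (G_loc c (fst p) (snd p)) (G_loc c (fst r) (snd r))"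
      by unfold_locales (use * pos p r G_loc_scale[OF c] \<xi> K(2) in auto)
  qed
qed

lemma polar_gauge_loc:
  assumes "c \<in> A" "\<xi> \<in> chart_range c"
  obtains a b where "polar_gauge (G_loc c) \<xi> a b"
proof (rule compact_polar_gauge[of c "{\<xi>}"])
  fix a b assume "\<And>\<zeta>. \<zeta> \<in> {\<xi>} \<Longrightarrow> polar_gauge (G_loc c) \<zeta> a b"
  then show ?thesis using that by blast
qed (use assms in auto)

text \<open>In the preferred chart of \<open>x\<close> the labelling \<open>tangent_of\<close> is
  the identity, so the local expression there is \<open>G x\<close> itself.\<close>

lemma polar_gauge_G: obtains a b where "polar_gauge G x a b"
proof -
  let ?c = "pref_chart A x"
  obtain a b where ab: "polar_gauge (G_loc ?c) (snd ?c x) a b"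
    using polar_gauge_loc[of ?c "snd ?c x"] pref_chart by auto
  have "G_loc ?c (snd ?c x) = G x"
    using pref_chart by (simp add: fun_eq_iff G_loc_chart tangent_of_pref)
  with ab have "polar_gauge G x a b" unfolding polar_gauge_def by simp
  then show ?thesis by (rule that)
qed

text \<open>The polar is intrinsic: \<open>tangent_of\<close> permutes the nonzero vectors, so both
  suprema run over the same set of quotients.\<close>

lemma polar_loc:
  assumes "c \<in> A" "\<xi> \<in> chart_range c"
  shows "polar (G_loc c) \<xi> (cov_comp A c w \<xi>) = polar G (chart_inv c \<xi>) (w (chart_inv c \<xi>))"
proof -
  let ?x = "chart_inv c \<xi>"
  have x: "?x \<in> fst c" using assms by simp
  have "tangent_of A c ?x ` (- {0}) = - {0}"
  proof -
    have "bij (tangent_of A c ?x)" by (rule bij_tangent_of[OF assms(1) x])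
    then have "tangent_of A c ?x ` (- {0}) = - (tangent_of A c ?x ` {0})" by (rule bij_image_Compl_eq)
    then show ?thesis using tangent_of_eq_0_iff[OF assms(1) x] by simp
  qed
  then have "(\<lambda>y. (w ?x \<bullet> y) / G ?x y) ` (- {0}) =
    (\<lambda>y. (w ?x \<bullet> y) / G ?x y) ` (tangent_of A c ?x ` (- {0}))"
    by (simp only:)
  also have "\<dots> = (\<lambda>\<eta>. (w ?x \<bullet> tangent_of A c ?x \<eta>) / G ?x (tangent_of A c ?x \<eta>)) ` (- {0})"
    by (simp only: image_image)
  also have "\<dots> = (\<lambda>\<eta>. (cov_comp A c w \<xi> \<bullet> \<eta>) / G_loc c \<xi> \<eta>) ` (- {0})"
    using cov_comp_inner'[OF assms] by (simp add: F_loc_def Let_def)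
  finally show ?thesis by (simp add: polar_def)
qed

lemma polar_G_nonneg: "polar G x \<alpha> \<ge> 0"
  and polar_G_add: "polar G x (\<alpha> + \<beta>) \<le> polar G x \<alpha> + polar G x \<beta>"
  and continuous_on_polar_G: "continuous_on S (polar G x)"
  by (rule polar_gauge_G[of x]; rule polar_gauge.polar_nonneg polar_gauge.polar_add
      polar_gauge.continuous_on_polar; assumption)+

lemma polar_G_lower: obtains k where "k > 0" "\<And>\<alpha>. k * norm \<alpha> \<le> polar G x \<alpha>"
proof (rule polar_gauge_G[of x])
  fix a b assume ab: "polar_gauge G x a b"
  show ?thesis
    using polar_gauge.polar_lower[OF ab] polar_gauge.b_pos[OF ab] by (intro that[of "1 / b"]) auto
qed

lemma continuous_on_G_loc: "\<lbrakk>c \<in> A; \<xi> \<in> chart_range c\<rbrakk> \<Longrightarrow> continuous_on S (G_loc c \<xi>)"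
proof -
  assume "c \<in> A" "\<xi> \<in> chart_range c"
  then have "continuous_on S ((\<lambda>(\<xi>, \<eta>). G_loc c \<xi> \<eta>) \<circ> (\<lambda>\<eta>. (\<xi>, \<eta>)))"
    by (intro continuous_on_compose continuous_intros continuous_on_subset[OF F_loc_cont]) auto
  then show ?thesis by (simp add: o_def)
qed

lemma measurable_G_loc:
  assumes "c \<in> A"
  shows "(\<lambda>\<xi>. G_loc c \<xi> \<eta>) \<in> borel_measurable (restrict_space borel (chart_range c))"
proof -
  have "continuous_on (chart_range c) ((\<lambda>(\<xi>, \<eta>). G_loc c \<xi> \<eta>) \<circ> (\<lambda>\<xi>. (\<xi>, \<eta>)))"
    by (intro continuous_on_compose continuous_intros continuous_on_subset[OF F_loc_cont[OF assms]]) auto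
  then show ?thesis by (intro borel_measurable_continuous_on_restrict) (simp add: o_def)
qed

text \<open>The supremum is uncountable, but the vectors violating
  \<open>w \<bullet> y \<le> t * G_loc c \<xi> y\<close> form an open set. Testing a countable dense
  set therefore decides whether the polar is at most \<open>t\<close>.\<close>

lemma measurable_polar_loc:
  assumes c: "c \<in> A" and w: "w \<in> borel_measurable (restrict_space borel (chart_range c))"
  shows "(\<lambda>\<xi>. polar (G_loc c) \<xi> (w \<xi>)) \<in> borel_measurable (restrict_space borel (chart_range c))"
  (is "_ \<in> borel_measurable ?M")
proof (rule borel_measurable_iff_le[THEN iffD2, rule_format])
  fix t
  note [measurable] = w measurable_G_loc[OF c]
  obtain D :: "(real ^ 'n) set" where D: "countable D"
    "\<And>X. open X \<Longrightarrow> X \<noteq> {} \<Longrightarrow> \<exists>d\<in>D. d \<in> X"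
    using countable_dense_exists by metis
  have "polar (G_loc c) \<xi> (w \<xi>) \<le> t \<longleftrightarrow> (\<forall>y\<in>D. w \<xi> \<bullet> y \<le> t * G_loc c \<xi> y)" if \<xi>: "\<xi> \<in> chart_range c" for \<xi>
  proof -
    obtain a b where "polar_gauge (G_loc c) \<xi> a b" using polar_gauge_loc[OF c \<xi>] .
    then interpret polar_gauge "G_loc c" \<xi> a b .
    have "\<forall>y. w \<xi> \<bullet> y \<le> t * G_loc c \<xi> y" if *: "\<forall>y\<in>D. w \<xi> \<bullet> y \<le> t * G_loc c \<xi> y"
    proof -
      have "open {y. t * G_loc c \<xi> y < w \<xi> \<bullet> y}"
        by (intro open_Collect_less continuous_intros continuous_on_G_loc[OF c \<xi>])
      then have "{y. t * G_loc c \<xi> y < w \<xi> \<bullet> y} = {}"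
        using D(2) * by (metis (no_types, lifting) mem_Collect_eq not_less)
      then show ?thesis by (auto simp: not_less)
    qed
    moreover have "w \<xi> \<bullet> 0 \<le> t * G_loc c \<xi> 0" by (simp add: gauge_0)
    ultimately show ?thesis unfolding polar_le_iff by (metis gauge_0 inner_zero_right mult_zero_right order_refl)
  qed
  then have "{\<xi> \<in> space ?M. polar (G_loc c) \<xi> (w \<xi>) \<le> t} = {\<xi> \<in> space ?M. \<forall>y\<in>D. w \<xi> \<bullet> y \<le> t * G_loc c \<xi> y}"
    by (auto simp: space_restrict_space)
  also have "\<dots> \<in> sets ?M"
    by (rule sets.sets_Collect_countable_All'[OF _ D(1)]) measurable
  finally show "{\<xi> \<in> space ?M. polar (G_loc c) \<xi> (w \<xi>) \<le> t} \<in> sets ?M" .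
qed

end

context atlas
begin

text \<open>The map \<open>w\<close> itself carries the irregular labelling of the fibres, so its
  Borel measurability would mean nothing; components in charts of the atlas are the invariant
  test.\<close>

definition measurable_section :: "('m \<Rightarrow> real ^ 'n) \<Rightarrow> bool" where
  "measurable_section w \<longleftrightarrow>
    (\<forall>c\<in>A. cov_comp A c w \<in> borel_measurable (restrict_space borel (chart_range c)))"

lemma measurable_sectionD:
  "\<lbrakk>measurable_section w; c \<in> A\<rbrakk> \<Longrightarrow> cov_comp A c w \<in> borel_measurable (restrict_space borel (chart_range c))"
  by (simp add: measurable_section_def)

lemma measurable_section_diff:
  "\<lbrakk>measurable_section v; measurable_section w\<rbrakk> \<Longrightarrow> measurable_section (\<lambda>x. v x - w x)"
  by (auto simp: measurable_section_def cov_comp_diff[abs_def] intro!: borel_measurable_diff)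

end

context metric_field
begin

lemma measurable_polar_section:
  assumes "measurable_section w" shows "(\<lambda>x. polar G x (w x)) \<in> borel_measurable borel"
proof (rule measurable_chartwise)
  fix c assume c: "c \<in> A"
  from measurable_polar_loc[OF c measurable_sectionD[OF assms c]]
  show "(\<lambda>\<xi>. polar G (chart_inv c \<xi>) (w (chart_inv c \<xi>))) \<in> borel_measurable (restrict_space borel (chart_range c))"
    by (rule measurable_cong[THEN iffD1, rotated]) (simp add: polar_loc[OF c] space_restrict_space)
qed

end

locale symmetric_metric_field = metric_field A G
  for A :: "('m::{t2_space, second_countable_topology}, 'n::finite) chart set" and G +
  assumes G_minus: "G x (- y) = G x y"
begin

lemma symmetric_polar_gauge_loc:
  assumes "c \<in> A" "\<xi> \<in> chart_range c"
  obtains a b where "symmetric_polar_gauge (G_loc c) \<xi> a b"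
proof -
  obtain a b where ab: "polar_gauge (G_loc c) \<xi> a b" using polar_gauge_loc[OF assms] .
  have "G_loc c \<xi> (- y) = G_loc c \<xi> y" for y
    using linear_neg[OF linear_tangent_of[of c "chart_inv c \<xi>"]] assms by (simp add: F_loc_def Let_def G_minus)
  with ab have "symmetric_polar_gauge (G_loc c) \<xi> a b"
    by (simp add: symmetric_polar_gauge_def symmetric_polar_gauge_axioms_def)
  then show ?thesis by (rule that)
qed

lemma polar_G_scale_abs: "polar G x (t *\<^sub>R \<alpha>) = \<bar>t\<bar> * polar G x \<alpha>"
proof -
  obtain a b where "polar_gauge G x a b" using polar_gauge_G .
  then have "symmetric_polar_gauge G x a b"
    by (simp add: symmetric_polar_gauge_def symmetric_polar_gauge_axioms_def G_minus)
  then show ?thesis by (rule symmetric_polar_gauge.polar_scale_abs)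
qed

text \<open>By continuity of the polar, membership in the body is decided by countably many
  covectors. Its indicator is thus jointly measurable in the point and the vector, and integrals
  depending on a parameter are measurable.\<close>

lemma measurable_binet_legendre_loc:
  assumes c: "c \<in> A" and v: "v \<in> borel_measurable (restrict_space borel (chart_range c))"
    and w: "w \<in> borel_measurable (restrict_space borel (chart_range c))"
  shows "(\<lambda>\<xi>. binet_legendre (G_loc c) \<xi> (v \<xi>) (w \<xi>)) \<in> borel_measurable (restrict_space borel (chart_range c))"
  (is "_ \<in> borel_measurable ?M")
proof -
  note [measurable] = v w
  have [measurable]: "(\<lambda>\<xi>. polar (G_loc c) \<xi> \<alpha>) \<in> borel_measurable ?M" for \<alpha>
    by (rule measurable_polar_loc[OF c]) simp
  obtain D :: "(real ^ 'n) set" where D: "countable D"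
    "\<And>X. open X \<Longrightarrow> X \<noteq> {} \<Longrightarrow> \<exists>d\<in>D. d \<in> X"
    using countable_dense_exists by metis
  have body: "y \<in> polar_body (G_loc c) \<xi> \<longleftrightarrow> (\<forall>\<alpha>\<in>D. \<alpha> \<bullet> y \<le> polar (G_loc c) \<xi> \<alpha>)"
    if \<xi>: "\<xi> \<in> chart_range c" for \<xi> y
  proof -
    obtain a b where "polar_gauge (G_loc c) \<xi> a b" using polar_gauge_loc[OF c \<xi>] .
    then interpret polar_gauge "G_loc c" \<xi> a b .
    have "open {\<alpha>. polar (G_loc c) \<xi> \<alpha> < \<alpha> \<bullet> y}"
      by (intro open_Collect_less continuous_intros continuous_on_polar)
    then show ?thesis using D(2)[of "{\<alpha>. polar (G_loc c) \<xi> \<alpha> < \<alpha> \<bullet> y}"]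
      unfolding polar_body_def by (fastforce simp: not_less[symmetric])
  qed
  define I where "I \<xi> y = (if \<forall>\<alpha>\<in>D. \<alpha> \<bullet> y \<le> polar (G_loc c) \<xi> \<alpha> then 1 else 0 :: real)" for \<xi> y
  have "{p \<in> space (?M \<Otimes>\<^sub>M lborel). \<forall>\<alpha>\<in>D. \<alpha> \<bullet> snd p \<le> polar (G_loc c) (fst p) \<alpha>} \<in> sets (?M \<Otimes>\<^sub>M lborel)"
    by (rule sets.sets_Collect_countable_All'[OF _ D(1)]) measurable
  then have [measurable]: "(\<lambda>p. I (fst p) (snd p)) \<in> borel_measurable (?M \<Otimes>\<^sub>M lborel)"
    unfolding I_def by (intro measurable_If) auto
  have "(\<lambda>\<xi>. (\<integral>y. I \<xi> y * ((v \<xi> \<bullet> y) * (w \<xi> \<bullet> y)) \<partial>lborel) / (\<integral>y. I \<xi> y \<partial>lborel)) \<in> borel_measurable ?M"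
    by measurable
  then show ?thesis
  proof (rule measurable_cong[THEN iffD1, rotated])
    fix \<xi> assume "\<xi> \<in> space ?M"
    then have ind: "indicator (polar_body (G_loc c) \<xi>) = I \<xi>"
      using body by (auto simp: I_def indicator_def fun_eq_iff space_restrict_space)
    have "measure lborel (polar_body (G_loc c) \<xi>) = (\<integral>y. indicator (polar_body (G_loc c) \<xi>) y \<partial>lborel)"
      by simp
    then show "(\<integral>y. I \<xi> y * ((v \<xi> \<bullet> y) * (w \<xi> \<bullet> y)) \<partial>lborel) / (\<integral>y. I \<xi> y \<partial>lborel) =
      binet_legendre (G_loc c) \<xi> (v \<xi>) (w \<xi>)"
      unfolding binet_legendre_def set_lebesgue_integral_def
      by (simp only: real_scaleR_def ind)
  qed
qed

text \<open>The chart is \<open>chart_at x\<close>, whose Borel pieces make the form measurable; the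
  comparison with the polar holds in every chart by \<open>polar_loc\<close>. The constant fields
  merely convert a covector at \<open>x\<close> into its components in that chart.\<close>

definition form :: "'m \<Rightarrow> real ^ 'n \<Rightarrow> real ^ 'n \<Rightarrow> real" where
  "form x \<alpha> \<beta> = binet_legendre (G_loc (chart_at x)) (snd (chart_at x) x)
     (cov_comp A (chart_at x) (\<lambda>_. \<alpha>) (snd (chart_at x) x)) (cov_comp A (chart_at x) (\<lambda>_. \<beta>) (snd (chart_at x) x))"

definition form_const :: real where "form_const = inverse (36 * 3 ^ CARD('n))"

text \<open>The bound by 1 lets the term \<open>u^2\<close> of the inner product satisfy the same
  lower estimate as the term with the differential.\<close>

lemma form_const_pos: "form_const > 0" "form_const \<le> 1"
proof -
  show "form_const > 0" by (simp add: form_const_def)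
  have "1 \<le> (36 :: real) * 3 ^ CARD('n)" by (rule order_trans[of 1 "36 * 1"]) (auto intro!: mult_left_mono)
  then show "form_const \<le> 1" unfolding form_const_def by (rule inverse_le_1_iff[THEN iffD2, OF disjI2])
qed

lemma form_commute: "form x \<alpha> \<beta> = form x \<beta> \<alpha>"
  and form_add: "form x (\<alpha> + \<alpha>') \<beta> = form x \<alpha> \<beta> + form x \<alpha>' \<beta>"
  and form_scale: "form x (t *\<^sub>R \<alpha>) \<beta> = t * form x \<alpha> \<beta>"
  and form_upper: "form x \<alpha> \<alpha> \<le> (polar G x \<alpha>)\<^sup>2"
  and form_lower: "form_const * (polar G x \<alpha>)\<^sup>2 \<le> form x \<alpha> \<alpha>"
proof -
  let ?c = "chart_at x" and ?\<xi> = "snd (chart_at x) x"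
  have in_r: "?c \<in> A" "?\<xi> \<in> chart_range ?c" using chart_seq(1) chart_at by auto
  obtain a b where "symmetric_polar_gauge (G_loc ?c) ?\<xi> a b"
    using symmetric_polar_gauge_loc[OF in_r] .
  then interpret symmetric_polar_gauge "G_loc ?c" ?\<xi> a b .
  have pol: "polar (G_loc ?c) ?\<xi> (cov_comp A ?c (\<lambda>_. \<alpha>) ?\<xi>) = polar G x \<alpha>" for \<alpha>
    using polar_loc[OF in_r, of "\<lambda>_. \<alpha>"] chart_seq(1) chart_at[of x] by simp
  show "form x \<alpha> \<beta> = form x \<beta> \<alpha>" unfolding form_def by (rule binet_legendre_commute)
  show "form x (\<alpha> + \<alpha>') \<beta> = form x \<alpha> \<beta> + form x \<alpha>' \<beta>"
    unfolding form_def cov_comp_add by (rule binet_legendre_add)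
  show "form x (t *\<^sub>R \<alpha>) \<beta> = t * form x \<alpha> \<beta>"
    unfolding form_def cov_comp_scale by (rule binet_legendre_scale)
  show "form x \<alpha> \<alpha> \<le> (polar G x \<alpha>)\<^sup>2" unfolding form_def pol[symmetric] by (rule binet_legendre_upper)
  have "form_const * s = s / (36 * 3 ^ CARD('n))" for s
    by (simp only: form_const_def divide_inverse mult.commute)
  then show "form_const * (polar G x \<alpha>)\<^sup>2 \<le> form x \<alpha> \<alpha>"
    unfolding form_def pol[symmetric] by (simp only: binet_legendre_lower)
qed

lemma measurable_form_section:
  assumes "measurable_section v" "measurable_section w"
  shows "(\<lambda>x. form x (v x) (w x)) \<in> borel_measurable borel"
proof (rule measurable_chart_piecewise[where H="\<lambda>i x. binet_legendre (G_loc (chart_seq i)) (snd (chart_seq i) x)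
     (cov_comp A (chart_seq i) (\<lambda>_. v x) (snd (chart_seq i) x)) (cov_comp A (chart_seq i) (\<lambda>_. w x) (snd (chart_seq i) x))"])
  fix i
  let ?c = "chart_seq i"
  have c: "?c \<in> A" by (rule chart_seq)
  have "cov_comp A ?c (\<lambda>_. u (chart_inv ?c \<xi>)) \<xi> = cov_comp A ?c u \<xi>" for u \<xi>
    by (simp add: cov_comp_def Let_def)
  with measurable_binet_legendre_loc[OF c measurable_sectionD[OF assms(1) c] measurable_sectionD[OF assms(2) c]]
  show "(\<lambda>\<xi>. binet_legendre (G_loc ?c) (snd ?c (chart_inv ?c \<xi>))
     (cov_comp A ?c (\<lambda>_. v (chart_inv ?c \<xi>)) (snd ?c (chart_inv ?c \<xi>)))
     (cov_comp A ?c (\<lambda>_. w (chart_inv ?c \<xi>)) (snd ?c (chart_inv ?c \<xi>))))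
     \<in> borel_measurable (restrict_space borel (chart_range ?c))"
    by (subst measurable_cong[where g="\<lambda>\<xi>. binet_legendre (G_loc ?c) \<xi> (cov_comp A ?c v \<xi>) (cov_comp A ?c w \<xi>)"])
      (use c in \<open>auto simp: space_restrict_space\<close>)
qed (simp add: form_def)

end

text \<open>If \<open>F\<close> vanished at \<open>\<eta> \<noteq> 0\<close>, it would vanish on the ray through \<open>\<eta>\<close>, and the fundamental tensor at
  \<open>\<eta>\<close> would annihilate \<open>\<eta>\<close>.\<close>

lemma finsler_F_loc_pos:
  fixes A :: "('m::{t2_space, second_countable_topology}, 'n::finite) chart set"
  assumes fin: "finsler_manifold A F" and c: "c \<in> A" and \<xi>: "\<xi> \<in> chart_range c" and \<eta>: "\<eta> \<noteq> 0"
  shows "F_loc A F c \<xi> \<eta> > 0"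
proof (rule ccontr)
  interpret atlas A using fin by unfold_locales (simp add: finsler_manifold_def)
  assume "\<not> F_loc A F c \<xi> \<eta> > 0"
  moreover have "F_loc A F c \<xi> \<eta> \<ge> 0" using fin by (simp add: finsler_manifold_def F_loc_def Let_def)
  ultimately have f0: "F_loc A F c \<xi> \<eta> = 0" by simp
  define f where "f = F_loc A F c"
  have ray0: "f \<xi> (t *\<^sub>R \<eta>) = 0" if "t \<ge> 0" for t
    using that f0 fin linear_cmul[OF linear_tangent_of[of c "chart_inv c \<xi>"]] c \<xi>
    by (simp add: finsler_manifold_def F_loc_def Let_def f_def)
  define S where "S = chart_range c \<times> (- {0 :: real ^ 'n})"
  define U where "U = (\<lambda>(\<xi>, \<eta>). f \<xi> \<eta>)"
  have "smooth_on S U" using fin c by (auto simp: finsler_manifold_def S_def U_def f_def)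
  then have Ck: "Ck_on (Suc (Suc 0)) S U" unfolding smooth_on_def by blast
  define DU where "DU p = frechet_derivative U (at p)" for p
  have dU: "(U has_derivative DU p) (at p)" if "p \<in> S" for p
    using Ck that unfolding DU_def by (simp add: frechet_derivative_works)
  have dDU: "(\<lambda>p. DU p v) differentiable (at p)" if "p \<in> S" for p v
    using Ck that unfolding DU_def by (cases v) simp
  have emb: "((\<lambda>z. (\<xi>, z)) has_derivative (\<lambda>v. (0, v))) (at z)" for z :: "real ^ 'n"
    by (auto intro!: derivative_eq_intros)
  have S: "(\<xi>, z) \<in> S" if "z \<noteq> 0" for z using \<xi> that by (simp add: S_def)
  have df: "((\<lambda>z. f \<xi> z) has_derivative (\<lambda>v. DU (\<xi>, z) (0, v))) (at z)" if "z \<noteq> 0" for z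
    using has_derivative_compose[OF emb dU[OF S[OF that]]] by (simp add: U_def)
  define L where "L = (\<lambda>\<xi> \<eta>. (f \<xi> \<eta>)\<^sup>2 / 2)"
  have g: "pd_y i L \<xi> z = f \<xi> z * DU (\<xi>, z) (0, axis i 1)" if "z \<noteq> 0" for i z
  proof -
    have "((\<lambda>z. L \<xi> z) has_derivative (\<lambda>v. f \<xi> z * DU (\<xi>, z) (0, v))) (at z)"
      unfolding L_def by (auto intro!: derivative_eq_intros df[OF that] simp: power2_eq_square)
    then show ?thesis unfolding pd_y_def using frechet_derivative_at by metis
  qed
  \<comment> \<open>By \<open>g\<close> the first derivatives of \<open>f^2 / 2\<close> contain the
    factor \<open>f\<close> and so vanish along the whole ray. Differentiating them along the ray at
    \<open>t = 1\<close> gives \<open>D \<eta>\<close>, which by linearity is the contraction of the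
    fundamental tensor with \<open>\<eta>\<close>.\<close>
  have "(\<Sum>j\<in>UNIV. fund_tensor f i j \<xi> \<eta> * \<eta> $ j) = 0" for i
  proof -
    have "(\<lambda>z. DU (\<xi>, z) (0, axis i 1)) differentiable (at \<eta>)"
      using differentiable_chain_at[OF differentiableI[OF emb] dDU[OF S[OF \<eta>]]] by (simp add: o_def)
    then have "(\<lambda>z. f \<xi> z * DU (\<xi>, z) (0, axis i 1)) differentiable (at \<eta>)"
      using differentiableI[OF df[OF \<eta>]] by (intro differentiable_mult)
    then obtain D where "((\<lambda>z. f \<xi> z * DU (\<xi>, z) (0, axis i 1)) has_derivative D) (at \<eta>)"
      by (auto simp: differentiable_def)
    then have D: "(pd_y i L \<xi> has_derivative D) (at \<eta>)"
      by (rule has_derivative_transform_within_open[of _ _ \<eta> UNIV "- {0}"]) (use \<eta> g in auto)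
    have ft: "fund_tensor f i j \<xi> \<eta> = D (axis j 1)" for j
      using frechet_derivative_at[OF D] by (simp add: fund_tensor_def pd_y_def[of j] L_def)
    have linD: "linear D" using D by (rule has_derivative_linear)
    have "\<eta> = (\<Sum>j\<in>UNIV. \<eta> $ j *\<^sub>R axis j 1)"
      using basis_expansion[of \<eta>] by (simp add: scalar_mult_eq_scaleR)
    then have "D \<eta> = D (\<Sum>j\<in>UNIV. \<eta> $ j *\<^sub>R axis j 1)" by simp
    also have "\<dots> = (\<Sum>j\<in>UNIV. fund_tensor f i j \<xi> \<eta> * \<eta> $ j)"
      using linD by (simp add: linear_sum linear_cmul ft mult.commute)
    finally have sum: "(\<Sum>j\<in>UNIV. fund_tensor f i j \<xi> \<eta> * \<eta> $ j) = D \<eta>" by simp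
    have ray: "((\<lambda>t. t *\<^sub>R \<eta>) has_derivative (\<lambda>t. t *\<^sub>R \<eta>)) (at 1)"
      by (auto intro!: derivative_eq_intros)
    have "((\<lambda>t::real. pd_y i L \<xi> (t *\<^sub>R \<eta>)) has_derivative (\<lambda>t. D (t *\<^sub>R \<eta>))) (at 1)"
      using has_derivative_compose[OF ray, of "pd_y i L \<xi>" D] D by simp
    then have "((\<lambda>t::real. 0::real) has_derivative (\<lambda>t. D (t *\<^sub>R \<eta>))) (at 1)"
      by (rule has_derivative_transform_within_open[of _ _ 1 UNIV "{0<..}"])
        (use \<eta> g ray0 in auto)
    then have "(\<lambda>t. D (t *\<^sub>R \<eta>)) = (\<lambda>t. 0)"
      using has_derivative_unique[OF _ has_derivative_const] by blast
    from fun_cong[OF this, of 1] show ?thesis using sum by simp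
  qed
  then have "fund_matrix f \<xi> \<eta> *v \<eta> = 0"
    by (simp add: fund_matrix_def matrix_vector_mult_def vec_eq_iff)
  moreover have "\<eta> \<bullet> (fund_matrix f \<xi> \<eta> *v \<eta>) > 0"
    using fin c \<xi> \<eta> by (simp add: finsler_manifold_def f_def)
  ultimately show False by simp
qed

lemma finsler_metric_field:
  assumes "finsler_manifold A F" shows "metric_field A F"
proof -
  interpret atlas A using assms by unfold_locales (simp add: finsler_manifold_def)
  show ?thesis
  proof unfold_locales
    fix x y assume "y \<noteq> (0 :: real ^ 'b)"
    then have "F_loc A F (pref_chart A x) (snd (pref_chart A x) x) y > 0"
      using pref_chart[of x] by (intro finsler_F_loc_pos[OF assms]) auto
    then show "F x y > 0" using pref_chart[of x] by (simp add: F_loc_def tangent_of_pref)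
  qed (use assms in \<open>auto simp: finsler_manifold_def\<close>)
qed

context metric_field
begin

lemma symm_pos: "y \<noteq> 0 \<Longrightarrow> symm G x y > 0"
  using G_pos[of y x] by (simp add: symm_def add_pos_nonneg)

lemma symm_metric_field: "symmetric_metric_field A (symm G)"
proof unfold_locales
  fix x y and t :: real assume "t \<ge> 0"
  have "G x (- (t *\<^sub>R y)) = t * G x (- y)" using G_scale[OF \<open>t \<ge> 0\<close>, of x "- y"] by simp
  then have "((G x (t *\<^sub>R y))\<^sup>2 + (G x (- (t *\<^sub>R y)))\<^sup>2) / 2 = t\<^sup>2 * (((G x y)\<^sup>2 + (G x (- y))\<^sup>2) / 2)"
    using G_scale[OF \<open>t \<ge> 0\<close>, of x y] by (simp add: power_mult_distrib algebra_simps)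
  then show "symm G x (t *\<^sub>R y) = t * symm G x y"
    unfolding symm_def using \<open>t \<ge> 0\<close> by (simp only: real_sqrt_mult real_sqrt_abs abs_of_nonneg)
next
  fix c assume c: "c \<in> A"
  have F: "continuous_on (chart_range c \<times> UNIV) (\<lambda>p. G_loc c (fst p) (snd p))"
    using F_loc_cont[OF c] by (simp add: case_prod_beta)
  have "continuous_on (chart_range c \<times> UNIV) ((\<lambda>p. G_loc c (fst p) (snd p)) \<circ> (\<lambda>p. (fst p, - snd p)))"
    by (intro continuous_on_compose continuous_intros continuous_on_subset[OF F]) auto
  then have "continuous_on (chart_range c \<times> UNIV)
    (\<lambda>p. sqrt (((G_loc c (fst p) (snd p))\<^sup>2 + (G_loc c (fst p) (- snd p))\<^sup>2) / 2))"
    by (intro continuous_intros F) (auto simp: o_def)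
  then show "continuous_on (chart_range c \<times> UNIV) (\<lambda>(\<xi>, \<eta>). F_loc A (symm G) c \<xi> \<eta>)"
    by (rule continuous_on_eq)
      (use c in \<open>auto simp: F_loc_def Let_def symm_def linear_neg[OF linear_tangent_of[OF c]]\<close>)
qed (simp_all add: symm_pos, simp add: symm_def add.commute)

end

locale reversible_bound = metric_field A F
  for A :: "('m::{t2_space, second_countable_topology}, 'n::finite) chart set" and F +
  assumes reversibility_finite: "reversibility F < \<infinity>"
begin

definition r :: real where "r = real_of_ereal (reversibility F)"

lemma F_ratio_le: "y \<noteq> 0 \<Longrightarrow> ereal (F x y / F x (- y)) \<le> reversibility F"
  unfolding reversibility_def
proof -
  assume "y \<noteq> 0"
  then have "ereal (F x y / F x (- y)) \<le> (SUP y\<in>- {0}. ereal (F x y / F x (- y)))"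
    by (auto intro!: Sup_upper)
  also have "\<dots> \<le> (SUP x. SUP y\<in>- {0}. ereal (F x y / F x (- y)))" by (auto intro!: Sup_upper)
  finally show "ereal (F x y / F x (- y)) \<le> (SUP x. SUP y\<in>- {0}. ereal (F x y / F x (- y)))" .
qed

lemma nonzero_vec: obtains y :: "real ^ 'n" where "y \<noteq> 0"
  by (metis axis_eq_0_iff zero_neq_one)

text \<open>A real ratio lies below the supremum, which excludes minus infinity; the locale
  assumption excludes the other end.\<close>

lemma reversibility_eq: "reversibility F = ereal r"
proof -
  obtain y :: "real ^ 'n" where y: "y \<noteq> 0" using nonzero_vec .
  obtain q where "ereal q \<le> reversibility F" using F_ratio_le[OF y] by blast
  then show ?thesis using reversibility_finite by (cases "reversibility F") (auto simp: r_def)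
qed

lemma F_le_r: "F x y \<le> r * F x (- y)"
proof (cases "y = 0")
  case True then show ?thesis using G_scale[of 0 x 0] by simp
next
  case False
  then show ?thesis
    using F_ratio_le[OF False, of x, unfolded reversibility_eq ereal_less_eq(3)] G_pos[of "- y" x]
    by (simp add: pos_divide_le_eq)
qed

text \<open>The bounds for \<open>y\<close> and for \<open>- y\<close> add up to
  \<open>a + b \<le> r * (a + b)\<close> with \<open>a + b > 0\<close>.\<close>

lemma r_ge_1: "r \<ge> 1"
proof -
  obtain y :: "real ^ 'n" where y: "y \<noteq> 0" using nonzero_vec .
  fix x
  define a b where "a = F x y" and "b = F x (- y)"
  have "a > 0" "b > 0" using G_pos[OF y] G_pos[of "- y"] y by (simp_all add: a_def b_def)
  have "a \<le> r * b" "b \<le> r * a" using F_le_r[of x y] F_le_r[of x "- y"] by (simp_all add: a_def b_def)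
  then have "1 * (a + b) \<le> r * (a + b)" by (simp add: distrib_left)
  then show ?thesis using \<open>a > 0\<close> \<open>b > 0\<close> by (simp only: mult_le_cancel_right)
qed

definition k1 :: real where "k1 = sqrt ((1 + r\<^sup>2) / 2)"
definition k2 :: real where "k2 = inverse (sqrt ((1 + inverse (r\<^sup>2)) / 2))"

text \<open>Used, like the analogous bound for \<open>k2\<close>, to multiply the zeroth order term
  of the Sobolev norm by the same constant as the gradient term.\<close>

lemma k1_ge_1: "k1 \<ge> 1" using r_ge_1 by (simp add: k1_def)

lemma k2_ge_1: "k2 \<ge> 1"
proof -
  have "sqrt ((1 + inverse (r\<^sup>2)) / 2) \<le> 1" using r_ge_1 by (simp add: inverse_le_1_iff)
  moreover have "sqrt ((1 + inverse (r\<^sup>2)) / 2) > 0" by (simp add: add_pos_nonneg)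
  ultimately show ?thesis unfolding k2_def by (simp add: one_le_inverse)
qed

lemma F_nonneg: "F x y \<ge> 0"
  using G_pos[of y x] G_scale[of 0 x 0] by (cases "y = 0") (auto intro: less_imp_le)

lemma symm_le: "symm F x y \<le> k1 * F x y"
proof -
  have "F x (- y) \<le> r * F x y" using F_le_r[of x "- y"] by simp
  then have "(F x (- y))\<^sup>2 \<le> (r * F x y)\<^sup>2" using F_nonneg by (intro power_mono) auto
  then have "((F x y)\<^sup>2 + (F x (- y))\<^sup>2) / 2 \<le> (1 + r\<^sup>2) / 2 * (F x y)\<^sup>2"
    by (simp add: power_mult_distrib algebra_simps)
  then have "symm F x y \<le> sqrt ((1 + r\<^sup>2) / 2 * (F x y)\<^sup>2)" unfolding symm_def by (rule real_sqrt_le_mono)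
  then show ?thesis using F_nonneg[of x y] by (simp only: real_sqrt_mult k1_def real_sqrt_abs abs_of_nonneg)
qed

lemma le_symm: "F x y \<le> k2 * symm F x y"
proof -
  have "(F x y)\<^sup>2 \<le> (r * F x (- y))\<^sup>2" using F_nonneg F_le_r[of x y] by (intro power_mono) auto
  then have "inverse (r\<^sup>2) * (F x y)\<^sup>2 \<le> (F x (- y))\<^sup>2"
    using r_ge_1 by (simp add: power_mult_distrib field_simps)
  then have "(1 + inverse (r\<^sup>2)) / 2 * (F x y)\<^sup>2 \<le> ((F x y)\<^sup>2 + (F x (- y))\<^sup>2) / 2"
    by (simp add: algebra_simps)
  then have "sqrt ((1 + inverse (r\<^sup>2)) / 2 * (F x y)\<^sup>2) \<le> symm F x y"
    unfolding symm_def by (rule real_sqrt_le_mono)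
  then have "sqrt ((1 + inverse (r\<^sup>2)) / 2) * F x y \<le> symm F x y"
    using F_nonneg[of x y] by (simp only: real_sqrt_mult real_sqrt_abs abs_of_nonneg)
  moreover have "sqrt ((1 + inverse (r\<^sup>2)) / 2) > 0" by (simp add: add_pos_nonneg)
  ultimately show ?thesis unfolding k2_def by (simp add: field_simps)
qed

sublocale symm: symmetric_metric_field A "symm F" by (rule symm_metric_field)

text \<open>Polarity reverses inequalities: the upper bound \<open>symm_le\<close> on
  \<open>symm F\<close> becomes an upper bound on the polar of \<open>F\<close>.\<close>

lemma polar_F_le: "polar F x \<alpha> \<le> k1 * polar (symm F) x \<alpha>"
proof -
  obtain a b where "polar_gauge F x a b" using polar_gauge_G .
  then interpret F: polar_gauge F x a b .
  obtain a' b' where "polar_gauge (symm F) x a' b'" using symm.polar_gauge_G .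
  then interpret S: polar_gauge "symm F" x a' b' .
  show ?thesis
  proof (rule F.polar_le)
    fix y
    have "\<alpha> \<bullet> y \<le> polar (symm F) x \<alpha> * symm F x y" by (rule S.inner_le_polar)
    also have "\<dots> \<le> polar (symm F) x \<alpha> * (k1 * F x y)" by (intro mult_left_mono symm_le S.polar_nonneg)
    finally show "\<alpha> \<bullet> y \<le> k1 * polar (symm F) x \<alpha> * F x y" by (simp add: mult_ac)
  qed
qed

lemma polar_symm_le: "polar (symm F) x \<alpha> \<le> k2 * polar F x \<alpha>"
proof -
  obtain a b where "polar_gauge F x a b" using polar_gauge_G .
  then interpret F: polar_gauge F x a b .
  obtain a' b' where "polar_gauge (symm F) x a' b'" using symm.polar_gauge_G .
  then interpret S: polar_gauge "symm F" x a' b' .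
  show ?thesis
  proof (rule S.polar_le)
    fix y
    have "\<alpha> \<bullet> y \<le> polar F x \<alpha> * F x y" by (rule F.inner_le_polar)
    also have "\<dots> \<le> polar F x \<alpha> * (k2 * symm F x y)" by (intro mult_left_mono le_symm F.polar_nonneg)
    finally show "\<alpha> \<bullet> y \<le> k2 * polar F x \<alpha> * symm F x y" by (simp add: mult_ac)
  qed
qed

end

section \<open>The Busemann measure\<close>

locale busemann = metric_field A F
  for A :: "('m::{t2_space, second_countable_topology}, 'n::finite) chart set" and F +
  fixes m :: "'m measure"
  assumes busemann: "is_busemann_measure A F m"
begin

lemma sets_m [measurable_cong, simp]: "sets m = sets borel"
  using busemann by (simp add: is_busemann_measure_def)

lemma space_m [simp]: "space m = UNIV"
  using sets_eq_imp_space_eq[OF sets_m] by simp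

lemma emeasure_chart:
  "\<lbrakk>c \<in> A; B \<in> sets borel; B \<subseteq> fst c\<rbrakk> \<Longrightarrow>
    emeasure m B = (\<integral>\<^sup>+\<xi>\<in>snd c ` B. ennreal (busemann_density A F c \<xi>) \<partial>lborel)"
  using busemann by (simp add: is_busemann_measure_def)

lemma chart_inv_image:
  assumes "c \<in> A" "B \<subseteq> chart_range c"
  shows "chart_inv c ` B = fst c \<inter> snd c -` B" "snd c ` chart_inv c ` B = B"
proof -
  show "chart_inv c ` B = fst c \<inter> snd c -` B"
    using assms by (auto simp: subset_iff) (metis chart_inv_chart imageI)
  show "snd c ` chart_inv c ` B = B" using assms by (force simp: image_image subset_iff)
qed

lemma sets_chart_inv_image:
  assumes "c \<in> A" "B \<in> sets borel" "B \<subseteq> chart_range c"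
  shows "chart_inv c ` B \<in> sets borel"
proof -
  have "snd c \<in> borel_measurable (restrict_space borel (fst c))"
    using continuous_on_chart[OF assms(1)] by (rule borel_measurable_continuous_on_restrict)
  from measurable_sets[OF this assms(2)] have "snd c -` B \<inter> fst c \<in> sets (restrict_space borel (fst c))"
    by (simp add: space_restrict_space)
  then show ?thesis
    using open_domain[OF assms(1)] chart_inv_image(1)[OF assms(1,3)]
    by (subst (asm) sets_restrict_space_iff) (auto simp: Int_commute)
qed

text \<open>Over \<open>K\<close> every unit ball of the metric lies between the Euclidean balls of
  radii \<open>1 / b\<close> and \<open>1 / a\<close>, with one pair of constants by
  compactness.\<close>

lemma density_bounds:
  assumes c: "c \<in> A" and K: "compact K" "K \<subseteq> chart_range c"
  obtains p q where "p > 0" "q > 0" "\<And>\<xi>. \<xi> \<in> K \<Longrightarrow> p \<le> busemann_density A F c \<xi>"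
    "\<And>\<xi>. \<xi> \<in> K \<Longrightarrow> busemann_density A F c \<xi> \<le> q"
proof -
  obtain a b where ab: "a > 0" "b > 0" "\<And>\<xi>. \<xi> \<in> K \<Longrightarrow> polar_gauge (G_loc c) \<xi> a b"
    using compact_polar_gauge[OF c K] by blast
  let ?B = "\<lambda>s. ball (0 :: real ^ 'n) s"
  have cb: "measure lborel (?B s) > 0" if "s > 0" for s using content_ball_pos[OF that] .
  have \<omega>: "unit_ball_vol (real CARD('n)) > 0" by (rule unit_ball_vol_pos) simp
  have vol: "measure lborel (?B (1 / b)) \<le> measure lborel {\<eta>. G_loc c \<xi> \<eta> < 1}"
    "measure lborel {\<eta>. G_loc c \<xi> \<eta> < 1} \<le> measure lborel (?B (1 / a))" if "\<xi> \<in> K" for \<xi>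
  proof -
    interpret polar_gauge "G_loc c" \<xi> a b by (rule ab(3)[OF that])
    have "open {\<eta>. G_loc c \<xi> \<eta> < 1}"
      using that K(2) by (intro open_Collect_less continuous_intros continuous_on_G_loc[OF c]) auto
    then have s: "{\<eta>. G_loc c \<xi> \<eta> < 1} \<in> sets lborel" by simp
    have sub1: "?B (1 / b) \<subseteq> {\<eta>. G_loc c \<xi> \<eta> < 1}"
      using ab(2) by (auto simp: field_simps intro: order.strict_trans1[OF gauge_upper])
    have sub2: "{\<eta>. G_loc c \<xi> \<eta> < 1} \<subseteq> ?B (1 / a)"
      using ab(1) by (auto simp: field_simps intro: order.strict_trans1[OF gauge_lower])
    have fm: "?B t \<in> fmeasurable lborel" for t
      by (intro fmeasurableI) (use emeasure_lborel_ball_finite in auto)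
    have fs: "{\<eta>. G_loc c \<xi> \<eta> < 1} \<in> fmeasurable lborel"
      by (rule fmeasurableI2[OF fm sub2 s])
    show "measure lborel (?B (1 / b)) \<le> measure lborel {\<eta>. G_loc c \<xi> \<eta> < 1}"
      by (rule measure_mono_fmeasurable[OF sub1 _ fs]) simp
    show "measure lborel {\<eta>. G_loc c \<xi> \<eta> < 1} \<le> measure lborel (?B (1 / a))"
      by (rule measure_mono_fmeasurable[OF sub2 s fm])
  qed
  show ?thesis
  proof (rule that[of "unit_ball_vol (real CARD('n)) / measure lborel (?B (1 / a))"
        "unit_ball_vol (real CARD('n)) / measure lborel (?B (1 / b))"])
    fix \<xi> assume "\<xi> \<in> K"
    note v = vol[OF this]
    have p1: "0 < measure lborel {\<eta>. G_loc c \<xi> \<eta> < 1}"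
      by (rule less_le_trans[OF cb v(1)]) (use ab(2) in simp)
    have p2: "0 < measure lborel (?B (1 / a))" "0 < measure lborel (?B (1 / b))"
      using cb[of "1 / a"] cb[of "1 / b"] ab(1,2) by simp_all
    show "unit_ball_vol (real CARD('n)) / measure lborel (?B (1 / a)) \<le> busemann_density A F c \<xi>"
      "busemann_density A F c \<xi> \<le> unit_ball_vol (real CARD('n)) / measure lborel (?B (1 / b))"
      unfolding busemann_density_def
      by (rule divide_left_mono[OF v(2) less_imp_le[OF \<omega>] mult_pos_pos[OF p2(1) p1]],
          rule divide_left_mono[OF v(1) less_imp_le[OF \<omega>] mult_pos_pos[OF p1 p2(2)]])
  qed (use \<omega> cb[of "1 / a"] cb[of "1 / b"] ab(1,2) in auto)
qed

lemma lborel_le_emeasure: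
  assumes c: "c \<in> A" and K: "compact K" "K \<subseteq> chart_range c"
  obtains C :: real where "C > 0" "\<And>B. \<lbrakk>B \<in> sets borel; B \<subseteq> K\<rbrakk> \<Longrightarrow>
    emeasure lborel B \<le> ennreal C * emeasure m (chart_inv c ` B)"
    "\<And>B. \<lbrakk>B \<in> sets borel; B \<subseteq> K\<rbrakk> \<Longrightarrow> emeasure m (chart_inv c ` B) \<le> ennreal C * emeasure lborel B"
proof -
  obtain p q where pq: "p > 0" "q > 0" "\<And>\<xi>. \<xi> \<in> K \<Longrightarrow> p \<le> busemann_density A F c \<xi>"
    "\<And>\<xi>. \<xi> \<in> K \<Longrightarrow> busemann_density A F c \<xi> \<le> q" using density_bounds[OF c K] by blast
  \<comment> \<open>One constant for both directions: it satisfies \<open>1 \<le> C * p\<close> and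
    \<open>q \<le> C\<close>.\<close>
  define C where "C = max (1 / p) q"
  have C: "C > 0" "1 \<le> C * p" "q \<le> C" using pq(1,2) by (auto simp: C_def max_mult_distrib_right)
  have eq: "emeasure m (chart_inv c ` B) = (\<integral>\<^sup>+\<xi>\<in>B. ennreal (busemann_density A F c \<xi>) \<partial>lborel)"
    if "B \<in> sets borel" "B \<subseteq> K" for B
  proof -
    have B: "B \<subseteq> chart_range c" using that K by auto
    then have "chart_inv c ` B \<subseteq> fst c" using chart_inv_in[OF c] by blast
    then show ?thesis
      using emeasure_chart[OF c sets_chart_inv_image[OF c that(1) B]] chart_inv_image(2)[OF c B] by simp
  qed
  have low: "emeasure lborel B \<le> ennreal C * emeasure m (chart_inv c ` B)" if B: "B \<in> sets borel" "B \<subseteq> K" for B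
  proof -
    have "ennreal p * emeasure lborel B = (\<integral>\<^sup>+\<xi>. ennreal p * indicator B \<xi> \<partial>lborel)"
      using B(1) by (simp add: nn_integral_cmult_indicator)
    also have "\<dots> \<le> emeasure m (chart_inv c ` B)"
      unfolding eq[OF B] using pq(3) B(2) by (intro nn_integral_mono) (auto simp: indicator_def intro!: ennreal_leI)
    finally have le: "ennreal p * emeasure lborel B \<le> emeasure m (chart_inv c ` B)" .
    have "emeasure lborel B = 1 * emeasure lborel B" by simp
    also have "\<dots> \<le> ennreal (C * p) * emeasure lborel B"
      using ennreal_leI[OF C(2)] by (intro mult_right_mono) auto
    also have "\<dots> = ennreal C * (ennreal p * emeasure lborel B)"
      using C(1) pq(1) by (simp add: ennreal_mult mult.assoc)
    also have "\<dots> \<le> ennreal C * emeasure m (chart_inv c ` B)" by (intro mult_left_mono le) simp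
    finally show ?thesis .
  qed
  have up: "emeasure m (chart_inv c ` B) \<le> ennreal C * emeasure lborel B" if B: "B \<in> sets borel" "B \<subseteq> K" for B
  proof -
    have "emeasure m (chart_inv c ` B) \<le> (\<integral>\<^sup>+\<xi>. ennreal C * indicator B \<xi> \<partial>lborel)"
      unfolding eq[OF B] using order_trans[OF pq(4) C(3)] B(2)
      by (intro nn_integral_mono) (auto simp: indicator_def intro!: ennreal_leI)
    also have "\<dots> = ennreal C * emeasure lborel B"
      using B(1) by (simp add: nn_integral_cmult_indicator)
    finally show ?thesis .
  qed
  show ?thesis using that[OF C(1) low up] .
qed

text \<open>The image of Lebesgue measure on \<open>K\<close> under \<open>chart_inv\<close> is
  dominated, as a measure, by \<open>C\<close> times \<open>m\<close>; integrals of nonnegative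
  functions inherit this domination.\<close>

lemma nn_integral_chart_le:
  assumes c: "c \<in> A" and K: "compact K" "K \<subseteq> chart_range c"
  obtains C :: real where "C > 0" "\<And>h. h \<in> borel_measurable borel \<Longrightarrow>
    (\<integral>\<^sup>+\<xi>\<in>K. h (chart_inv c \<xi>) \<partial>lborel) \<le> ennreal C * (\<integral>\<^sup>+x. h x \<partial>m)"
proof -
  obtain C :: real where C: "C > 0" "\<And>B. \<lbrakk>B \<in> sets borel; B \<subseteq> K\<rbrakk> \<Longrightarrow>
    emeasure lborel B \<le> ennreal C * emeasure m (chart_inv c ` B)"
    using lborel_le_emeasure[OF c K] by metis
  have sK: "K \<in> sets borel" using K(1) by (simp add: compact_imp_closed)
  let ?R = "restrict_space lborel K"
  have mi: "chart_inv c \<in> measurable ?R borel"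
    using borel_measurable_continuous_on_restrict[OF continuous_on_subset[OF continuous_on_chart_inv[OF c] K(2)]]
    by (simp add: measurable_def space_restrict_space sets_restrict_space)
  let ?\<nu> = "distr ?R borel (chart_inv c)"
  have le: "?\<nu> \<le> scale_measure (ennreal C) m"
  proof (subst le_measure)
    show "sets ?\<nu> = sets (scale_measure (ennreal C) m)" by simp
    show "\<forall>E\<in>sets ?\<nu>. emeasure ?\<nu> E \<le> emeasure (scale_measure (ennreal C) m) E"
    proof
      fix E assume "E \<in> sets ?\<nu>"
      then have E: "E \<in> sets borel" by simp
      let ?B = "chart_inv c -` E \<inter> K"
      have "?B \<in> sets ?R" using measurable_sets[OF mi E] by (simp add: space_restrict_space)
      then have B: "?B \<in> sets borel" "?B \<subseteq> K"
        using sK by (auto simp: sets_restrict_space_iff)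
      have "emeasure ?\<nu> E = emeasure lborel ?B"
        using mi E sK by (simp add: emeasure_distr space_restrict_space emeasure_restrict_space)
      also have "\<dots> \<le> ennreal C * emeasure m (chart_inv c ` ?B)" by (rule C(2)[OF B])
      also have "\<dots> \<le> ennreal C * emeasure m E"
        by (intro mult_left_mono emeasure_mono) (use E in auto)
      finally show "emeasure ?\<nu> E \<le> emeasure (scale_measure (ennreal C) m) E" using E by simp
    qed
  qed
  show ?thesis
  proof (rule that[OF C(1)])
    fix h :: "'m \<Rightarrow> ennreal" assume h: "h \<in> borel_measurable borel"
    have "(\<integral>\<^sup>+\<xi>\<in>K. h (chart_inv c \<xi>) \<partial>lborel) = (\<integral>\<^sup>+\<xi>. h (chart_inv c \<xi>) \<partial>?R)"
      using sK by (simp add: nn_integral_restrict_space)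
    also have "\<dots> = (\<integral>\<^sup>+x. h x \<partial>?\<nu>)" by (rule nn_integral_distr[symmetric, OF mi]) (simp add: h)
    also have "\<dots> \<le> (\<integral>\<^sup>+x. h x \<partial>scale_measure (ennreal C) m)"
      by (rule nn_integral_mono_measure[OF _ le]) simp
    also have "\<dots> = ennreal C * (\<integral>\<^sup>+x. h x \<partial>m)"
      by (rule nn_integral_scale_measure) (use h in \<open>simp add: measurable_def\<close>)
    finally show "(\<integral>\<^sup>+\<xi>\<in>K. h (chart_inv c \<xi>) \<partial>lborel) \<le> ennreal C * (\<integral>\<^sup>+x. h x \<partial>m)" .
  qed
qed

text \<open>The previous estimate, applied to the indicator of a null set of \<open>m\<close>, shows
  that its coordinate image meets each compact set of the exhaustion in a Lebesgue null set.\<close>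

lemma AE_chart:
  assumes c: "c \<in> A" and P: "AE x in m. P x"
  shows "AE \<xi> in lborel. \<xi> \<in> chart_range c \<longrightarrow> P (chart_inv c \<xi>)"
proof -
  obtain N where N: "{x. \<not> P x} \<subseteq> N" "N \<in> sets borel" "emeasure m N = 0"
    using P by (auto elim!: AE_E)
  obtain \<K> where K: "countable \<K>" "\<forall>K\<in>\<K>. compact K \<and> K \<subseteq> chart_range c" "\<Union>\<K> = chart_range c"
    by (rule chart_range_exhaustion[OF c])
  have "AE \<xi> in lborel. \<xi> \<in> K \<longrightarrow> P (chart_inv c \<xi>)" if "K \<in> \<K>" for K
  proof -
    have Kc: "compact K" "K \<subseteq> chart_range c" using K(2) that by auto
    obtain C :: real where C: "\<And>h. h \<in> borel_measurable borel \<Longrightarrow>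
      (\<integral>\<^sup>+\<xi>\<in>K. h (chart_inv c \<xi>) \<partial>lborel) \<le> ennreal C * (\<integral>\<^sup>+x. h x \<partial>m)"
      using nn_integral_chart_le[OF c Kc] by metis
    have sK: "K \<in> sets borel" using Kc(1) by (simp add: compact_imp_closed)
    have "(\<integral>\<^sup>+\<xi>\<in>K. indicator N (chart_inv c \<xi>) \<partial>lborel) \<le> ennreal C * (\<integral>\<^sup>+x. indicator N x \<partial>m)"
      using N(2) by (intro C) auto
    also have "\<dots> = 0" using N by simp
    finally have z: "(\<integral>\<^sup>+\<xi>\<in>K. indicator N (chart_inv c \<xi>) \<partial>lborel) = 0" by simp
    have "(\<lambda>\<xi>. indicator N (chart_inv c \<xi>) :: ennreal) \<in> borel_measurable (restrict_space borel K)"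
      by (rule measurable_compose[OF borel_measurable_continuous_on_restrict[OF continuous_on_subset[OF continuous_on_chart_inv[OF c] Kc(2)]]])
        (use N(2) in auto)
    then have "(\<lambda>\<xi>. indicator N (chart_inv c \<xi>) * indicator K \<xi> :: ennreal) \<in> borel_measurable borel"
      using sK by (subst (asm) borel_measurable_restrict_space_iff_ennreal) auto
    then have "AE \<xi> in lborel. indicator N (chart_inv c \<xi>) * indicator K \<xi> = (0 :: ennreal)"
      using z by (subst (asm) nn_integral_0_iff_AE) auto
    then show ?thesis by (rule AE_mp) (use N(1) in \<open>auto simp: indicator_def split: if_splits\<close>)
  qed
  then have "AE \<xi> in lborel. \<forall>K\<in>\<K>. \<xi> \<in> K \<longrightarrow> P (chart_inv c \<xi>)"
    by (subst AE_ball_countable[OF K(1)]) auto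
  then show ?thesis by (rule eventually_mono) (use K(3) in blast)
qed

text \<open>In each chart \<open>m\<close> is given by a density, so Lebesgue null sets of
  coordinates become null sets of \<open>m\<close>; countably many charts cover the
  manifold.\<close>

lemma AE_if_charts:
  assumes P: "\<And>c. c \<in> A \<Longrightarrow> AE \<xi> in lborel. \<xi> \<in> chart_range c \<longrightarrow> P (chart_inv c \<xi>)"
  shows "AE x in m. P x"
proof -
  have "AE x in m. x \<in> fst (chart_seq i) \<longrightarrow> P x" for i
  proof -
    let ?c = "chart_seq i"
    have c: "?c \<in> A" by (rule chart_seq)
    obtain N where N: "{\<xi>. \<not> (\<xi> \<in> chart_range ?c \<longrightarrow> P (chart_inv ?c \<xi>))} \<subseteq> N" "N \<in> sets borel" "emeasure lborel N = 0"
      using P[OF c] by (auto elim!: AE_E)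
    let ?B = "N \<inter> chart_range ?c"
    have B: "?B \<in> sets borel" "?B \<subseteq> chart_range ?c" using N(2) open_chart_range[OF c] by auto
    have sub: "chart_inv ?c ` ?B \<subseteq> fst ?c" using c by auto
    have "AE \<xi> in lborel. \<xi> \<notin> ?B"
      using N(2,3) by (intro AE_I[of _ _ N]) auto
    then have "(\<integral>\<^sup>+\<xi>\<in>?B. ennreal (busemann_density A F ?c \<xi>) \<partial>lborel) = (\<integral>\<^sup>+\<xi>. 0 \<partial>(lborel :: (real ^ 'n) measure))"
      by (intro nn_integral_cong_AE) (auto simp: indicator_def)
    then have "emeasure m (chart_inv ?c ` ?B) = 0"
      using emeasure_chart[OF c sets_chart_inv_image[OF c B] sub] chart_inv_image(2)[OF c B(2)] by simp
    moreover have "{x \<in> space m. \<not> (x \<in> fst ?c \<longrightarrow> P x)} \<subseteq> chart_inv ?c ` ?B"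
    proof
      fix x assume "x \<in> {x \<in> space m. \<not> (x \<in> fst ?c \<longrightarrow> P x)}"
      then have "snd ?c x \<in> ?B" "chart_inv ?c (snd ?c x) = x" using N(1) c by auto
      then show "x \<in> chart_inv ?c ` ?B" by (metis imageI)
    qed
    ultimately show ?thesis using sets_chart_inv_image[OF c B] by (intro AE_I) auto
  qed
  then have "AE x in m. \<forall>i. x \<in> fst (chart_seq i) \<longrightarrow> P x" unfolding AE_all_countable by blast
  then show ?thesis by (rule eventually_mono) (use chart_seq(2) in blast)
qed

text \<open>Coordinate balls show local finiteness, and a compact set is covered by finitely many of
  them.\<close>

lemma emeasure_compact_finite:
  assumes "compact K" shows "emeasure m K < \<infinity>"
proof -
  have ex: "\<exists>U. open U \<and> x \<in> U \<and> emeasure m U < \<infinity>" for x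
  proof -
    let ?c = "pref_chart A x"
    have c: "?c \<in> A" "x \<in> fst ?c" by (rule pref_chart)+
    obtain e where e: "e > 0" "cball (snd ?c x) e \<subseteq> chart_range ?c"
      using open_chart_range[OF c(1)] open_contains_cball c by (metis chart_in)
    obtain C :: real where C: "\<And>B. \<lbrakk>B \<in> sets borel; B \<subseteq> cball (snd ?c x) e\<rbrakk> \<Longrightarrow> emeasure m (chart_inv ?c ` B) \<le> ennreal C * emeasure lborel B"
      using lborel_le_emeasure[OF c(1) compact_cball e(2)] by metis
    let ?U = "fst ?c \<inter> snd ?c -` ball (snd ?c x) e"
    have bsub: "ball (snd ?c x) e \<subseteq> chart_range ?c" using e(2) ball_subset_cball by blast
    have "emeasure m ?U \<le> ennreal C * emeasure lborel (ball (snd ?c x) e)"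
      using C[of "ball (snd ?c x) e"] ball_subset_cball chart_inv_image(1)[OF c(1) bsub] by auto
    also have "\<dots> < \<infinity>" using emeasure_lborel_ball_finite[of "snd ?c x" e] by (simp add: ennreal_mult_less_top)
    finally have "emeasure m ?U < \<infinity>" .
    moreover have "open ?U"
      by (rule continuous_open_preimage[OF continuous_on_chart[OF c(1)] open_domain[OF c(1)]]) simp
    ultimately show ?thesis using c(2) e(1) by (intro exI[of _ ?U]) auto
  qed
  then obtain U where U: "\<And>x. open (U x)" "\<And>x. x \<in> U x" "\<And>x. emeasure m (U x) < \<infinity>" by metis
  obtain T where T: "T \<subseteq> K" "finite T" "K \<subseteq> (\<Union>x\<in>T. U x)"
    using compactE_image[OF assms, of K U] U by blast
  have "emeasure m K \<le> emeasure m (\<Union>x\<in>T. U x)" using T(3) U(1)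
    by (intro emeasure_mono) (auto intro!: borel_open open_UN)
  also have "\<dots> \<le> (\<Sum>x\<in>T. emeasure m (U x))" using T(2) U(1) by (intro emeasure_subadditive_finite) auto
  also have "\<dots> < \<infinity>" using U(3) T(2) by (simp add: less_top)
  finally show ?thesis .
qed

end

section \<open>Weak differentials\<close>

lemma tendsto_0_ennrealI:
  fixes f :: "nat \<Rightarrow> ennreal"
  assumes "\<And>e::real. e > 0 \<Longrightarrow> \<forall>\<^sub>F k in sequentially. f k < ennreal e"
  shows "f \<longlonglongrightarrow> 0"
proof (rule order_tendstoI)
  fix a :: ennreal assume a: "0 < a"
  obtain e :: real where e: "e > 0" "ennreal e \<le> a"
  proof (cases a)
    case (real t) then show ?thesis using a that[of t] by auto
  next
    case top then show ?thesis using that[of 1] by auto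
  qed
  show "\<forall>\<^sub>F k in sequentially. f k < a"
    using assms[OF e(1)] by (rule eventually_mono) (rule less_le_trans[OF _ e(2)])
qed simp

lemma tendsto_0_if_le:
  fixes f g :: "nat \<Rightarrow> ennreal"
  assumes "\<And>k. f k \<le> g k" "g \<longlonglongrightarrow> 0"
  shows "f \<longlonglongrightarrow> 0"
proof (rule tendsto_sandwich[OF _ _ tendsto_const assms(2)])
  show "\<forall>\<^sub>F k in sequentially. 0 \<le> f k" by simp
  show "\<forall>\<^sub>F k in sequentially. f k \<le> g k" using assms(1) by (intro always_eventually allI)
qed

lemma tendsto_0_if_power2:
  fixes f :: "nat \<Rightarrow> ennreal"
  assumes "(\<lambda>k. (f k)\<^sup>2) \<longlonglongrightarrow> 0"
  shows "f \<longlonglongrightarrow> 0"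
proof (rule tendsto_0_ennrealI)
  fix e :: real assume e: "e > 0"
  have "\<forall>\<^sub>F k in sequentially. (f k)\<^sup>2 < (ennreal e)\<^sup>2"
    using order_tendstoD(2)[OF assms, of "(ennreal e)\<^sup>2"] e by (simp add: ennreal_power)
  then show "\<forall>\<^sub>F k in sequentially. f k < ennreal e"
  proof (rule eventually_mono)
    fix k assume l: "(f k)\<^sup>2 < (ennreal e)\<^sup>2"
    show "f k < ennreal e"
    proof (rule ccontr)
      assume "\<not> f k < ennreal e"
      then have "ennreal e * ennreal e \<le> f k * f k" by (intro mult_mono) auto
      with l show False by (simp add: power2_eq_square not_le[symmetric])
    qed
  qed
qed

text \<open>Cauchy-Schwarz against the indicator of \<open>K\<close>, which has finite volume.
  Measurability is asked of the cut-off functions because coordinate expressions have no meaning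
  outside the chart range.\<close>

lemma L1_tendsto_if_L2_tendsto:
  fixes g :: "nat \<Rightarrow> 'a::euclidean_space \<Rightarrow> real"
  assumes K: "compact K" and m: "\<And>k. (\<lambda>\<xi>. indicator K \<xi> *\<^sub>R g k \<xi>) \<in> borel_measurable borel"
    and lim: "(\<lambda>k. \<integral>\<^sup>+\<xi>\<in>K. ennreal ((g k \<xi>)\<^sup>2) \<partial>lborel) \<longlonglongrightarrow> 0"
  shows "(\<lambda>k. \<integral>\<^sup>+\<xi>\<in>K. ennreal \<bar>g k \<xi>\<bar> \<partial>lborel) \<longlonglongrightarrow> 0"
proof (rule tendsto_0_if_power2)
  have [measurable]: "K \<in> sets borel" using K by (simp add: compact_imp_closed)
  note [measurable] = m
  have fin: "emeasure lborel K < \<infinity>" using emeasure_compact_finite[OF K] .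
  have le: "(\<integral>\<^sup>+\<xi>\<in>K. ennreal \<bar>g k \<xi>\<bar> \<partial>lborel)\<^sup>2 \<le> (\<integral>\<^sup>+\<xi>\<in>K. ennreal ((g k \<xi>)\<^sup>2) \<partial>lborel) * emeasure lborel K" for k
  proof -
    have "(\<integral>\<^sup>+\<xi>. ennreal \<bar>indicator K \<xi> *\<^sub>R g k \<xi>\<bar> * indicator K \<xi> \<partial>lborel)\<^sup>2 \<le>
        (\<integral>\<^sup>+\<xi>. (ennreal \<bar>indicator K \<xi> *\<^sub>R g k \<xi>\<bar>)\<^sup>2 \<partial>lborel) * (\<integral>\<^sup>+\<xi>. (indicator K \<xi>)\<^sup>2 \<partial>lborel)"
      by (rule Cauchy_Schwarz_nn_integral) measurable
    moreover have "ennreal \<bar>indicator K \<xi> *\<^sub>R g k \<xi>\<bar> * indicator K \<xi> = ennreal \<bar>g k \<xi>\<bar> * indicator K \<xi>"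
      "(ennreal \<bar>indicator K \<xi> *\<^sub>R g k \<xi>\<bar>)\<^sup>2 = ennreal ((g k \<xi>)\<^sup>2) * indicator K \<xi>" 
      "(indicator K \<xi> :: ennreal)\<^sup>2 = indicator K \<xi>" for \<xi>
      by (auto simp: indicator_def ennreal_power)
    ultimately show ?thesis by simp
  qed
  have "(\<lambda>k. emeasure lborel K * (\<integral>\<^sup>+\<xi>\<in>K. ennreal ((g k \<xi>)\<^sup>2) \<partial>lborel)) \<longlonglongrightarrow> emeasure lborel K * 0"
    by (rule ennreal_tendsto_cmult[OF _ lim]) (use fin in simp)
  then show "(\<lambda>k. (\<integral>\<^sup>+\<xi>\<in>K. ennreal \<bar>g k \<xi>\<bar> \<partial>lborel)\<^sup>2) \<longlonglongrightarrow> 0"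
    by (intro tendsto_0_if_le[OF le]) (simp add: mult.commute)
qed

lemma bounded_test:
  fixes \<psi> :: "'a::euclidean_space \<Rightarrow> real"
  assumes \<psi>: "continuous_on UNIV \<psi>" and K: "compact K" "\<And>\<xi>. \<xi> \<notin> K \<Longrightarrow> \<psi> \<xi> = 0"
  obtains B where "B > 0" "\<And>\<xi>. \<bar>\<psi> \<xi>\<bar> \<le> B"
proof -
  have "compact (\<psi> ` K)" using compact_continuous_image continuous_on_subset[OF \<psi>] K(1) by blast
  then obtain B where B: "B > 0" "\<And>\<xi>. \<xi> \<in> K \<Longrightarrow> \<bar>\<psi> \<xi>\<bar> \<le> B"
    using compact_imp_bounded bounded_pos by (metis imageI real_norm_def)
  have "\<bar>\<psi> \<xi>\<bar> \<le> B" for \<xi> using B K(2)[of \<xi>] by (cases "\<xi> \<in> K") auto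
  then show ?thesis by (rule that[OF B(1)])
qed

lemma indicator_test:
  fixes h \<psi> :: "'a \<Rightarrow> real"
  assumes "K \<subseteq> S" "\<And>\<xi>. \<xi> \<notin> K \<Longrightarrow> \<psi> \<xi> = 0"
  shows "indicator S \<xi> *\<^sub>R (h \<xi> * \<psi> \<xi>) = indicator K \<xi> *\<^sub>R h \<xi> * \<psi> \<xi>"
  using assms by (auto simp: indicator_def)

lemma set_integrable_test:
  fixes h \<psi> :: "'a::euclidean_space \<Rightarrow> real"
  assumes h: "set_integrable lborel K h" and \<psi>: "continuous_on UNIV \<psi>"
    and K: "compact K" "K \<subseteq> S" "\<And>\<xi>. \<xi> \<notin> K \<Longrightarrow> \<psi> \<xi> = 0"
  shows "set_integrable lborel S (\<lambda>\<xi>. h \<xi> * \<psi> \<xi>)"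
proof -
  obtain B where B: "B > 0" "\<And>\<xi>. \<bar>\<psi> \<xi>\<bar> \<le> B" using bounded_test[OF \<psi> K(1,3)] by metis
  have [measurable]: "\<psi> \<in> borel_measurable borel" using \<psi> by (rule borel_measurable_continuous_onI)
  have i: "integrable lborel (\<lambda>\<xi>. indicator K \<xi> *\<^sub>R h \<xi>)" using h by (simp add: set_integrable_def)
  then have [measurable]: "(\<lambda>\<xi>. indicator K \<xi> *\<^sub>R h \<xi>) \<in> borel_measurable lborel" by auto
  have "integrable lborel (\<lambda>\<xi>. indicator K \<xi> *\<^sub>R h \<xi> * \<psi> \<xi>)"
  proof (rule Bochner_Integration.integrable_bound)
    show "integrable lborel (\<lambda>\<xi>. B * (indicator K \<xi> *\<^sub>R h \<xi>))" by (rule integrable_mult_right[OF i])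
    show "(\<lambda>\<xi>. indicator K \<xi> *\<^sub>R h \<xi> * \<psi> \<xi>) \<in> borel_measurable lborel" by measurable
    show "AE \<xi> in lborel. norm (indicator K \<xi> *\<^sub>R h \<xi> * \<psi> \<xi>) \<le> norm (B * (indicator K \<xi> *\<^sub>R h \<xi>))"
    proof (rule always_eventually, rule allI)
      fix \<xi>
      have "\<bar>indicator K \<xi> *\<^sub>R h \<xi>\<bar> * \<bar>\<psi> \<xi>\<bar> \<le> \<bar>indicator K \<xi> *\<^sub>R h \<xi>\<bar> * B"
        by (rule mult_left_mono[OF B(2)]) simp
      then show "norm (indicator K \<xi> *\<^sub>R h \<xi> * \<psi> \<xi>) \<le> norm (B * (indicator K \<xi> *\<^sub>R h \<xi>))"
        using B(1) by (simp add: abs_mult mult.commute)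
    qed
  qed
  moreover have "indicator S \<xi> *\<^sub>R (h \<xi> * \<psi> \<xi>) = indicator K \<xi> *\<^sub>R h \<xi> * \<psi> \<xi>" for \<xi>
    by (rule indicator_test[OF K(2)]) (rule K(3))
  ultimately show ?thesis unfolding set_integrable_def by (simp only:)
qed

text \<open>A test function is bounded and vanishes off \<open>K\<close>, so convergence in mean
  over \<open>K\<close> survives multiplication by it.\<close>

lemma test_integral_tendsto:
  fixes \<psi> :: "'a::euclidean_space \<Rightarrow> real"
  assumes h: "\<And>k. set_integrable lborel K (h k)" "set_integrable lborel K g" and \<psi>: "continuous_on UNIV \<psi>"
    and K: "compact K" "K \<subseteq> S" "\<And>\<xi>. \<xi> \<notin> K \<Longrightarrow> \<psi> \<xi> = 0"
    and lim: "(\<lambda>k. \<integral>\<^sup>+\<xi>\<in>K. ennreal \<bar>h k \<xi> - g \<xi>\<bar> \<partial>lborel) \<longlonglongrightarrow> 0"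
  shows "(\<lambda>k. LINT \<xi>:S|lborel. h k \<xi> * \<psi> \<xi>) \<longlonglongrightarrow> (LINT \<xi>:S|lborel. g \<xi> * \<psi> \<xi>)"
proof -
  obtain B where B: "B > 0" "\<And>\<xi>. \<bar>\<psi> \<xi>\<bar> \<le> B" using bounded_test[OF \<psi> K(1,3)] by metis
  have si: "set_integrable lborel S (\<lambda>\<xi>. f \<xi> * \<psi> \<xi>)" if "set_integrable lborel K f" for f
    by (rule set_integrable_test[OF that \<psi> K(1,2)]) (rule K(3))
  have eq: "indicator S \<xi> *\<^sub>R (f \<xi> * \<psi> \<xi>) = indicator K \<xi> *\<^sub>R f \<xi> * \<psi> \<xi>" for f :: "'a \<Rightarrow> real" and \<xi>
    by (rule indicator_test[OF K(2)]) (rule K(3))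
  have [measurable]: "(\<lambda>\<xi>. indicator K \<xi> *\<^sub>R (h k \<xi> - g \<xi>)) \<in> borel_measurable lborel" for k
    using set_integral_diff(1)[OF h(1) h(2)] by (auto simp: set_integrable_def)
  have le: "(\<integral>\<^sup>+\<xi>. norm (indicator S \<xi> *\<^sub>R (h k \<xi> * \<psi> \<xi>) - indicator S \<xi> *\<^sub>R (g \<xi> * \<psi> \<xi>)) \<partial>lborel) \<le>
     ennreal B * (\<integral>\<^sup>+\<xi>\<in>K. ennreal \<bar>h k \<xi> - g \<xi>\<bar> \<partial>lborel)" for k
  proof -
    have "(\<integral>\<^sup>+\<xi>. norm (indicator S \<xi> *\<^sub>R (h k \<xi> * \<psi> \<xi>) - indicator S \<xi> *\<^sub>R (g \<xi> * \<psi> \<xi>)) \<partial>lborel)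
      \<le> (\<integral>\<^sup>+\<xi>. ennreal B * ennreal \<bar>indicator K \<xi> *\<^sub>R (h k \<xi> - g \<xi>)\<bar> \<partial>lborel)"
    proof (rule nn_integral_mono)
      fix \<xi>
      have "norm (indicator S \<xi> *\<^sub>R (h k \<xi> * \<psi> \<xi>) - indicator S \<xi> *\<^sub>R (g \<xi> * \<psi> \<xi>))
        = \<bar>indicator K \<xi> *\<^sub>R (h k \<xi> - g \<xi>)\<bar> * \<bar>\<psi> \<xi>\<bar>"
        unfolding eq by (simp add: abs_mult[symmetric] algebra_simps)
      also have "\<dots> \<le> \<bar>indicator K \<xi> *\<^sub>R (h k \<xi> - g \<xi>)\<bar> * B" by (rule mult_left_mono[OF B(2)]) simp
      finally show "ennreal (norm (indicator S \<xi> *\<^sub>R (h k \<xi> * \<psi> \<xi>) - indicator S \<xi> *\<^sub>R (g \<xi> * \<psi> \<xi>)))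
         \<le> ennreal B * ennreal \<bar>indicator K \<xi> *\<^sub>R (h k \<xi> - g \<xi>)\<bar>"
        using B(1) by (simp add: ennreal_mult[symmetric] mult.commute ennreal_leI)
    qed
    also have "\<dots> = ennreal B * (\<integral>\<^sup>+\<xi>. ennreal \<bar>indicator K \<xi> *\<^sub>R (h k \<xi> - g \<xi>)\<bar> \<partial>lborel)"
      by (rule nn_integral_cmult) measurable
    also have "(\<integral>\<^sup>+\<xi>. ennreal \<bar>indicator K \<xi> *\<^sub>R (h k \<xi> - g \<xi>)\<bar> \<partial>lborel) = (\<integral>\<^sup>+\<xi>\<in>K. ennreal \<bar>h k \<xi> - g \<xi>\<bar> \<partial>lborel)"
      by (intro nn_integral_cong) (auto simp: indicator_def)
    finally show ?thesis .
  qed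
  have "(\<lambda>k. ennreal B * (\<integral>\<^sup>+\<xi>\<in>K. ennreal \<bar>h k \<xi> - g \<xi>\<bar> \<partial>lborel)) \<longlonglongrightarrow> ennreal B * 0"
    by (rule ennreal_tendsto_cmult[OF _ lim]) simp
  then have "(\<lambda>k. \<integral>\<^sup>+\<xi>. norm (indicator S \<xi> *\<^sub>R (h k \<xi> * \<psi> \<xi>) - indicator S \<xi> *\<^sub>R (g \<xi> * \<psi> \<xi>)) \<partial>lborel) \<longlonglongrightarrow> 0"
    by (intro tendsto_0_if_le[OF le]) simp
  then show ?thesis
    unfolding set_lebesgue_integral_def
    by (intro tendsto_L1_int) (use si[OF h(1)] si[OF h(2)] in \<open>auto simp: set_integrable_def\<close>)
qed

lemma set_integrable_component:
  fixes f :: "'a::euclidean_space \<Rightarrow> real ^ 'n::finite"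
  shows "set_integrable lborel K f \<Longrightarrow> set_integrable lborel K (\<lambda>\<xi>. f \<xi> $ i)"
  unfolding set_integrable_def
  using integrable_bounded_linear[OF bounded_linear_vec_nth, of lborel "\<lambda>\<xi>. indicator K \<xi> *\<^sub>R f \<xi>" i] by simp

text \<open>The elementary bound \<open>s \<le> 1 + s^2\<close> suffices, since constants are
  integrable over a compact set.\<close>

lemma set_integrable_if_square:
  fixes g :: "'a::euclidean_space \<Rightarrow> 'b::euclidean_space"
  assumes K: "compact K" and m: "(\<lambda>\<xi>. indicator K \<xi> *\<^sub>R g \<xi>) \<in> borel_measurable borel"
    and sq: "set_integrable lborel K (\<lambda>\<xi>. (norm (g \<xi>))\<^sup>2)"
  shows "set_integrable lborel K g"
  unfolding set_integrable_def
proof (rule Bochner_Integration.integrable_bound)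
  have "integrable lborel (\<lambda>\<xi>. indicator K \<xi> *\<^sub>R (1::real))"
    by (rule borel_integrable_compact[OF K]) simp
  then show "integrable lborel (\<lambda>\<xi>. indicator K \<xi> *\<^sub>R (1::real) + indicator K \<xi> *\<^sub>R (norm (g \<xi>))\<^sup>2)"
    using sq unfolding set_integrable_def by (rule Bochner_Integration.integrable_add)
  have "s \<le> 1 + s\<^sup>2" if "s \<ge> 0" for s :: real
    using zero_le_power2[of "s - 1"] that by (simp add: power2_eq_square algebra_simps)
  then show "AE \<xi> in lborel. norm (indicator K \<xi> *\<^sub>R g \<xi>) \<le> norm (indicator K \<xi> *\<^sub>R (1::real) + indicator K \<xi> *\<^sub>R (norm (g \<xi>))\<^sup>2)"
    by (intro always_eventually allI) (auto simp: indicator_def)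
qed (use m in simp)

section \<open>Weak differentials and local Sobolev functions in charts\<close>

context atlas
begin

definition test_function :: "('m, 'n) chart \<Rightarrow> (real ^ 'n \<Rightarrow> real) \<Rightarrow> (real ^ 'n) set \<Rightarrow> bool" where
  "test_function c \<psi> K \<longleftrightarrow> smooth_on UNIV \<psi> \<and> compact K \<and> K \<subseteq> chart_range c \<and> (\<forall>\<xi>. \<xi> \<notin> K \<longrightarrow> \<psi> \<xi> = 0)"

text \<open>The Bochner integral of a function that is not integrable is 0, so the integral identity
  in \<open>weak_differential\<close> is additive in \<open>u\<close> only when the integrals on its
  left-hand side exist.\<close>

definition locally_integrable :: "('m \<Rightarrow> real) \<Rightarrow> bool" where
  "locally_integrable u \<longleftrightarrow> u \<in> borel_measurable borel \<and>
    (\<forall>c\<in>A. \<forall>K. compact K \<and> K \<subseteq> chart_range c \<longrightarrow> set_integrable lborel K (\<lambda>\<xi>. u (chart_inv c \<xi>)))"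

lemma test_functionD:
  assumes "test_function c \<psi> K"
  shows "continuous_on UNIV \<psi>" "compact K" "K \<subseteq> chart_range c" "\<And>\<xi>. \<xi> \<notin> K \<Longrightarrow> \<psi> \<xi> = 0"
    "continuous_on UNIV (\<lambda>\<xi>. frechet_derivative \<psi> (at \<xi>) v)" "\<And>\<xi>. \<xi> \<notin> K \<Longrightarrow> frechet_derivative \<psi> (at \<xi>) v = 0"
    "Ck_on 1 UNIV \<psi>"
proof -
  have Ck: "Ck_on k UNIV \<psi>" for k using assms by (simp add: test_function_def smooth_on_def)
  show "Ck_on 1 UNIV \<psi>" by (rule Ck)
  show "continuous_on UNIV \<psi>" using Ck[of 0] by simp
  show "continuous_on UNIV (\<lambda>\<xi>. frechet_derivative \<psi> (at \<xi>) v)" using Ck[of 1] by simp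
  show K: "compact K" "K \<subseteq> chart_range c" "\<And>\<xi>. \<xi> \<notin> K \<Longrightarrow> \<psi> \<xi> = 0" using assms by (auto simp: test_function_def)
  show "\<And>\<xi>. \<xi> \<notin> K \<Longrightarrow> frechet_derivative \<psi> (at \<xi>) v = 0"
    by (rule frechet_derivative_eq_0_outside[OF K(1,3)])
qed

lemma weak_differential_iff:
  "weak_differential A u w \<longleftrightarrow> (\<forall>c\<in>A.
     (\<forall>K. compact K \<and> K \<subseteq> chart_range c \<longrightarrow> set_integrable lborel K (cov_comp A c w)) \<and>
     (\<forall>\<psi> K i. test_function c \<psi> K \<longrightarrow>
        (LINT \<xi>:chart_range c|lborel. u (chart_inv c \<xi>) * frechet_derivative \<psi> (at \<xi>) (axis i 1)) =
        - (LINT \<xi>:chart_range c|lborel. cov_comp A c w \<xi> $ i * \<psi> \<xi>)))"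
  unfolding weak_differential_def test_function_def by blast

lemma weak_differentialD:
  assumes "weak_differential A u w" "c \<in> A"
  shows "\<lbrakk>compact K; K \<subseteq> chart_range c\<rbrakk> \<Longrightarrow> set_integrable lborel K (cov_comp A c w)"
    "test_function c \<psi> K \<Longrightarrow>
        (LINT \<xi>:chart_range c|lborel. u (chart_inv c \<xi>) * frechet_derivative \<psi> (at \<xi>) (axis i 1)) =
        - (LINT \<xi>:chart_range c|lborel. cov_comp A c w \<xi> $ i * \<psi> \<xi>)"
  using assms unfolding weak_differential_iff by blast+

lemma test_set_integrable:
  assumes "set_integrable lborel K h" "test_function c \<psi> K"
  shows "set_integrable lborel (chart_range c) (\<lambda>\<xi>. h \<xi> * \<psi> \<xi>)"
    "set_integrable lborel (chart_range c) (\<lambda>\<xi>. h \<xi> * frechet_derivative \<psi> (at \<xi>) v)"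
  by (rule set_integrable_test[OF assms(1) test_functionD(1,2,3)[OF assms(2)] test_functionD(4)[OF assms(2)]], assumption)
    (rule set_integrable_test[OF assms(1) test_functionD(5,2,3)[OF assms(2)] test_functionD(6)[OF assms(2)]], assumption)

text \<open>Integrability of the components over compact sets contains their measurability there; a
  countable compact exhaustion pastes these pieces together.\<close>

lemma weak_differential_measurable:
  assumes "weak_differential A u w" shows "measurable_section w"
  unfolding measurable_section_def
proof
  fix c assume c: "c \<in> A"
  let ?M = "restrict_space borel (chart_range c)"
  obtain \<K> where K: "countable \<K>" "\<forall>K\<in>\<K>. compact K \<and> K \<subseteq> chart_range c" "\<Union>\<K> = chart_range c"
    by (rule chart_range_exhaustion[OF c])
  show "cov_comp A c w \<in> borel_measurable ?M"
  proof (rule measurable_piecewise_restrict[OF K(1)])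
    fix L assume L: "L \<in> \<K>"
    then have L': "compact L" "L \<subseteq> chart_range c" using K(2) by auto
    then have b: "L \<in> sets borel" by (simp add: compact_imp_closed)
    show "L \<inter> space ?M \<in> sets ?M"
      using L'(2) b open_chart_range[OF c] by (auto simp: sets_restrict_space_iff space_restrict_space)
    have "cov_comp A c w \<in> borel_measurable (restrict_space borel L)"
      using weak_differentialD(1)[OF assms c L'] b
      by (subst borel_measurable_restrict_space_iff) (auto simp: set_integrable_def)
    moreover have "restrict_space ?M L = restrict_space borel L"
      using L'(2) b open_chart_range[OF c] by (subst restrict_restrict_space) (auto simp: Int_absorb1)
    ultimately show "cov_comp A c w \<in> borel_measurable (restrict_space ?M L)" by simp
  qed (simp add: K(3) space_restrict_space)
qed

lemma indicator_measurable:
  fixes g :: "real ^ 'n \<Rightarrow> 'b::euclidean_space"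
  assumes "c \<in> A" "g \<in> borel_measurable (restrict_space borel (chart_range c))" "compact K" "K \<subseteq> chart_range c"
  shows "(\<lambda>\<xi>. indicator K \<xi> *\<^sub>R g \<xi>) \<in> borel_measurable borel"
proof -
  have b: "K \<in> sets borel" using assms(3) by (simp add: compact_imp_closed)
  have "g \<in> borel_measurable (restrict_space borel K)"
    using assms(2,4) by (rule measurable_restrict_mono)
  then show ?thesis using b by (subst (asm) borel_measurable_restrict_space_iff) auto
qed

lemma measurable_chart_comp:
  assumes "u \<in> borel_measurable borel" "c \<in> A"
  shows "(\<lambda>\<xi>. u (chart_inv c \<xi>)) \<in> borel_measurable (restrict_space borel (chart_range c))"
  using measurable_compose[OF measurable_chart_inv[OF assms(2)] assms(1)] .

lemma weak_differential_add:
  assumes "weak_differential A u w" "weak_differential A v z" "locally_integrable u" "locally_integrable v"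
  shows "weak_differential A (\<lambda>x. u x + v x) (\<lambda>x. w x + z x)"
  unfolding weak_differential_iff
proof (intro ballI conjI allI impI)
  fix c K assume c: "c \<in> A" and "compact K \<and> K \<subseteq> chart_range c"
  then show "set_integrable lborel K (cov_comp A c (\<lambda>x. w x + z x))"
    using weak_differentialD(1)[OF assms(1) c] weak_differentialD(1)[OF assms(2) c]
    by (simp add: cov_comp_add[abs_def])
next
  fix c \<psi> K i assume c: "c \<in> A" and t: "test_function c \<psi> K"
  note K = test_functionD(2,3)[OF t]
  let ?D = "\<lambda>\<xi>. frechet_derivative \<psi> (at \<xi>) (axis i 1)"
  note iu = test_set_integrable(2)[OF _ t, of "\<lambda>\<xi>. u (chart_inv c \<xi>)" "axis i 1"]
    test_set_integrable(2)[OF _ t, of "\<lambda>\<xi>. v (chart_inv c \<xi>)" "axis i 1"]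
  note iw = test_set_integrable(1)[OF set_integrable_component[OF weak_differentialD(1)[OF assms(1) c K]] t]
     test_set_integrable(1)[OF set_integrable_component[OF weak_differentialD(1)[OF assms(2) c K]] t]
  have "(LINT \<xi>:chart_range c|lborel. (u (chart_inv c \<xi>) + v (chart_inv c \<xi>)) * ?D \<xi>) =
    (LINT \<xi>:chart_range c|lborel. u (chart_inv c \<xi>) * ?D \<xi>) + (LINT \<xi>:chart_range c|lborel. v (chart_inv c \<xi>) * ?D \<xi>)"
    unfolding distrib_right
    by (rule set_integral_add(2)[OF iu]) (use assms(3,4) c K in \<open>auto simp: locally_integrable_def\<close>)
  moreover have "(LINT \<xi>:chart_range c|lborel. (cov_comp A c w \<xi> $ i + cov_comp A c z \<xi> $ i) * \<psi> \<xi>) =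
    (LINT \<xi>:chart_range c|lborel. cov_comp A c w \<xi> $ i * \<psi> \<xi>) + (LINT \<xi>:chart_range c|lborel. cov_comp A c z \<xi> $ i * \<psi> \<xi>)"
    unfolding distrib_right by (rule set_integral_add(2)[OF iw])
  ultimately show "(LINT \<xi>:chart_range c|lborel. (u (chart_inv c \<xi>) + v (chart_inv c \<xi>)) * ?D \<xi>) =
    - (LINT \<xi>:chart_range c|lborel. cov_comp A c (\<lambda>x. w x + z x) \<xi> $ i * \<psi> \<xi>)"
    by (simp add: cov_comp_add weak_differentialD(2)[OF assms(1) c t] weak_differentialD(2)[OF assms(2) c t])
qed

lemma weak_differential_scale:
  assumes "weak_differential A u w"
  shows "weak_differential A (\<lambda>x. a * u x) (\<lambda>x. a *\<^sub>R w x)"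
  using assms unfolding weak_differential_iff
  by (auto simp: cov_comp_scale[abs_def] mult.assoc)

definition locally_L2 :: "('m \<Rightarrow> real) \<Rightarrow> bool" where
  "locally_L2 u \<longleftrightarrow> u \<in> borel_measurable borel \<and>
    (\<forall>c\<in>A. \<forall>K. compact K \<and> K \<subseteq> chart_range c \<longrightarrow>
      set_integrable lborel K (\<lambda>\<xi>. (u (chart_inv c \<xi>))\<^sup>2))"

definition locally_L2_section :: "('m \<Rightarrow> real ^ 'n) \<Rightarrow> bool" where
  "locally_L2_section w \<longleftrightarrow> (\<forall>c\<in>A. \<forall>K. compact K \<and> K \<subseteq> chart_range c \<longrightarrow>
    set_integrable lborel K (\<lambda>\<xi>. (norm (cov_comp A c w \<xi>))\<^sup>2))"

lemma W12_loc_iff: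
  "u \<in> W12_loc A \<longleftrightarrow> locally_L2 u \<and> (\<exists>w. weak_differential A u w \<and> locally_L2_section w)"
  by (simp add: W12_loc_def locally_L2_def locally_L2_section_def)

lemma locally_L2_locally_integrable: assumes "locally_L2 u" shows "locally_integrable u"
  unfolding locally_integrable_def
proof (intro conjI ballI allI impI)
  show b: "u \<in> borel_measurable borel" using assms by (simp add: locally_L2_def)
  fix c K assume c: "c \<in> A" and K: "compact K \<and> K \<subseteq> chart_range c"
  show "set_integrable lborel K (\<lambda>\<xi>. u (chart_inv c \<xi>))"
    by (rule set_integrable_if_square)
      (use assms c K indicator_measurable[OF c measurable_chart_comp[OF b c]] in \<open>auto simp: locally_L2_def\<close>)
qed

lemma W12_loc_L2: "u \<in> W12_loc A \<Longrightarrow> locally_L2 u" by (simp add: W12_loc_iff)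

lemma W12_loc_borel: "u \<in> W12_loc A \<Longrightarrow> u \<in> borel_measurable borel"
  by (simp add: W12_loc_iff locally_L2_def)

lemma W12_loc_locally_integrable: "u \<in> W12_loc A \<Longrightarrow> locally_integrable u"
  by (intro locally_L2_locally_integrable W12_loc_L2)

lemma Dweak: assumes "u \<in> W12_loc A" shows "weak_differential A u (Dweak A u)"
proof -
  have "\<exists>w. weak_differential A u w"
    using assms unfolding W12_loc_iff by (elim conjE exE) (rule exI)
  then show ?thesis unfolding Dweak_def by (rule someI_ex)
qed

lemma measurable_Dweak: "u \<in> W12_loc A \<Longrightarrow> measurable_section (Dweak A u)"
  by (rule weak_differential_measurable[OF Dweak])

lemma set_integrable_square_add:
  fixes f g :: "real ^ 'n \<Rightarrow> 'b::euclidean_space"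
  assumes "c \<in> A" "compact K" "K \<subseteq> chart_range c"
    and "f \<in> borel_measurable (restrict_space borel (chart_range c))" "g \<in> borel_measurable (restrict_space borel (chart_range c))"
    and "set_integrable lborel K (\<lambda>\<xi>. (norm (f \<xi>))\<^sup>2)" "set_integrable lborel K (\<lambda>\<xi>. (norm (g \<xi>))\<^sup>2)"
  shows "set_integrable lborel K (\<lambda>\<xi>. (norm (f \<xi> + g \<xi>))\<^sup>2)"
  unfolding set_integrable_def
proof (rule Bochner_Integration.integrable_bound)
  show "integrable lborel (\<lambda>\<xi>. 2 * (indicator K \<xi> *\<^sub>R (norm (f \<xi>))\<^sup>2 + indicator K \<xi> *\<^sub>R (norm (g \<xi>))\<^sup>2))"
    using assms(6,7) unfolding set_integrable_def by (intro integrable_mult_right Bochner_Integration.integrable_add)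
  have "(\<lambda>\<xi>. (norm (f \<xi> + g \<xi>))\<^sup>2) \<in> borel_measurable (restrict_space borel (chart_range c))"
    using assms(4,5) by measurable
  from indicator_measurable[OF assms(1) this assms(2,3)]
  show "(\<lambda>\<xi>. indicator K \<xi> *\<^sub>R (norm (f \<xi> + g \<xi>))\<^sup>2) \<in> borel_measurable lborel" by simp
  have "(norm (x + y))\<^sup>2 \<le> 2 * ((norm x)\<^sup>2 + (norm y)\<^sup>2)" for x y :: 'b
  proof -
    have "(norm (x + y))\<^sup>2 \<le> (norm x + norm y)\<^sup>2" by (intro power_mono norm_triangle_ineq) simp
    also have "\<dots> \<le> 2 * ((norm x)\<^sup>2 + (norm y)\<^sup>2)"
      using zero_le_power2[of "norm x - norm y"] by (simp add: power2_eq_square algebra_simps)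
    finally show ?thesis .
  qed
  then show "AE \<xi> in lborel. norm (indicator K \<xi> *\<^sub>R (norm (f \<xi> + g \<xi>))\<^sup>2) \<le>
      norm (2 * (indicator K \<xi> *\<^sub>R (norm (f \<xi>))\<^sup>2 + indicator K \<xi> *\<^sub>R (norm (g \<xi>))\<^sup>2))"
    by (intro always_eventually allI) (auto simp: indicator_def)
qed

lemma locally_L2_add:
  assumes "locally_L2 u" "locally_L2 v" shows "locally_L2 (\<lambda>x. u x + v x)"
  unfolding locally_L2_def
proof (intro conjI ballI allI impI)
  have b: "u \<in> borel_measurable borel" "v \<in> borel_measurable borel"
    using assms by (simp_all add: locally_L2_def)
  then show "(\<lambda>x. u x + v x) \<in> borel_measurable borel" by simp
  fix c K assume c: "c \<in> A" and K: "compact K \<and> K \<subseteq> chart_range c"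
  have "set_integrable lborel K (\<lambda>\<xi>. (norm (u (chart_inv c \<xi>) + v (chart_inv c \<xi>)))\<^sup>2)"
    by (rule set_integrable_square_add[OF c _ _ measurable_chart_comp[OF b(1) c] measurable_chart_comp[OF b(2) c]])
      (use K assms c in \<open>simp_all add: locally_L2_def\<close>)
  then show "set_integrable lborel K (\<lambda>\<xi>. (u (chart_inv c \<xi>) + v (chart_inv c \<xi>))\<^sup>2)" by simp
qed

lemma locally_L2_section_add:
  assumes "locally_L2_section w" "locally_L2_section z" "measurable_section w" "measurable_section z"
  shows "locally_L2_section (\<lambda>x. w x + z x)"
  unfolding locally_L2_section_def
proof (intro ballI allI impI)
  fix c K assume c: "c \<in> A" and K: "compact K \<and> K \<subseteq> chart_range c"
  show "set_integrable lborel K (\<lambda>\<xi>. (norm (cov_comp A c (\<lambda>x. w x + z x) \<xi>))\<^sup>2)"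
    unfolding cov_comp_add
    by (rule set_integrable_square_add[OF c _ _ measurable_sectionD[OF assms(3) c] measurable_sectionD[OF assms(4) c]])
      (use K assms c in \<open>simp_all add: locally_L2_section_def\<close>)
qed

lemma W12_loc_add:
  assumes "u \<in> W12_loc A" "v \<in> W12_loc A" shows "(\<lambda>x. u x + v x) \<in> W12_loc A"
proof -
  obtain w z where w: "weak_differential A u w" "locally_L2_section w"
    and z: "weak_differential A v z" "locally_L2_section z"
    using assms unfolding W12_loc_iff by blast
  have "weak_differential A (\<lambda>x. u x + v x) (\<lambda>x. w x + z x)"
    by (rule weak_differential_add[OF w(1) z(1) assms[THEN W12_loc_locally_integrable]])
  moreover have "locally_L2_section (\<lambda>x. w x + z x)"
    by (rule locally_L2_section_add[OF w(2) z(2) weak_differential_measurable[OF w(1)] weak_differential_measurable[OF z(1)]])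
  ultimately show ?thesis
    using locally_L2_add[OF assms[THEN W12_loc_L2]] unfolding W12_loc_iff by blast
qed

lemma W12_loc_scale:
  assumes "u \<in> W12_loc A" shows "(\<lambda>x. a * u x) \<in> W12_loc A"
proof -
  obtain w where w: "weak_differential A u w" "locally_L2_section w"
    using assms unfolding W12_loc_iff by blast
  have "locally_L2_section (\<lambda>x. a *\<^sub>R w x)"
    using w(2) by (simp add: locally_L2_section_def cov_comp_scale power_mult_distrib)
  moreover have "locally_L2 (\<lambda>x. a * u x)"
    using W12_loc_L2[OF assms] by (auto simp: locally_L2_def power_mult_distrib intro!: borel_measurable_times)
  ultimately show ?thesis
    using weak_differential_scale[OF w(1), of a] unfolding W12_loc_iff by blast
qed

lemma W12_loc_diff:
  "\<lbrakk>u \<in> W12_loc A; v \<in> W12_loc A\<rbrakk> \<Longrightarrow> (\<lambda>x. u x - v x) \<in> W12_loc A"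
  using W12_loc_add[OF _ W12_loc_scale[of v "-1"], of u] by simp

text \<open>Convergence in mean over the support of a test function passes both sides of the
  defining identity to the limit.\<close>

lemma weak_differential_limit:
  assumes wd: "\<And>k. weak_differential A (X k) (W k)" "\<And>k. locally_integrable (X k)"
    and u: "locally_integrable u"
    and w: "\<And>c K. \<lbrakk>c \<in> A; compact K; K \<subseteq> chart_range c\<rbrakk> \<Longrightarrow> set_integrable lborel K (cov_comp A c w)"
    and limu: "\<And>c K. \<lbrakk>c \<in> A; compact K; K \<subseteq> chart_range c\<rbrakk> \<Longrightarrow>
      (\<lambda>k. \<integral>\<^sup>+\<xi>\<in>K. ennreal \<bar>X k (chart_inv c \<xi>) - u (chart_inv c \<xi>)\<bar> \<partial>lborel) \<longlonglongrightarrow> 0"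
    and limw: "\<And>c K i. \<lbrakk>c \<in> A; compact K; K \<subseteq> chart_range c\<rbrakk> \<Longrightarrow>
      (\<lambda>k. \<integral>\<^sup>+\<xi>\<in>K. ennreal \<bar>cov_comp A c (W k) \<xi> $ i - cov_comp A c w \<xi> $ i\<bar> \<partial>lborel) \<longlonglongrightarrow> 0"
  shows "weak_differential A u w"
  unfolding weak_differential_iff
proof (intro ballI conjI allI impI)
  fix c \<psi> K i assume c: "c \<in> A" and t: "test_function c \<psi> K"
  note K = test_functionD(2,3)[OF t]
  let ?D = "\<lambda>\<xi>. frechet_derivative \<psi> (at \<xi>) (axis i 1)"
  have 1: "(\<lambda>k. LINT \<xi>:chart_range c|lborel. X k (chart_inv c \<xi>) * ?D \<xi>) \<longlonglongrightarrow> (LINT \<xi>:chart_range c|lborel. u (chart_inv c \<xi>) * ?D \<xi>)"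
    by (rule test_integral_tendsto[where K=K])
      (use wd(2) u c K limu[OF c K] test_functionD(5,6)[OF t] in \<open>auto simp: locally_integrable_def\<close>)
  have 2: "(\<lambda>k. LINT \<xi>:chart_range c|lborel. cov_comp A c (W k) \<xi> $ i * \<psi> \<xi>) \<longlonglongrightarrow> (LINT \<xi>:chart_range c|lborel. cov_comp A c w \<xi> $ i * \<psi> \<xi>)"
    by (rule test_integral_tendsto[where K=K])
      (use c K limw[OF c K] test_functionD(1,4)[OF t] in \<open>auto intro!: set_integrable_component weak_differentialD(1)[OF wd(1)] w\<close>)
  show "(LINT \<xi>:chart_range c|lborel. u (chart_inv c \<xi>) * ?D \<xi>) = - (LINT \<xi>:chart_range c|lborel. cov_comp A c w \<xi> $ i * \<psi> \<xi>)"
    using LIMSEQ_unique[OF 1] tendsto_minus[OF 2] by (simp add: weak_differentialD(2)[OF wd(1) c t])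
qed (use w in auto)

end

section \<open>Uniqueness of weak differentials and invariance under null sets\<close>

context busemann
begin

text \<open>In every chart the difference of the components is orthogonal to all test functions,
  hence zero almost everywhere. Equal components mean equal covectors because
  \<open>tangent_of\<close> is onto.\<close>

lemma weak_differential_unique:
  assumes "weak_differential A u w" "weak_differential A u z"
  shows "AE x in m. w x = z x"
proof (rule AE_if_charts)
  fix c assume c: "c \<in> A"
  have "AE \<xi> in lborel. \<xi> \<in> chart_range c \<longrightarrow> cov_comp A c w \<xi> $ i - cov_comp A c z \<xi> $ i = 0" for i
  proof (rule AE_eq_0_on_open_if_test[OF open_chart_range[OF c]])
    fix K assume K: "compact K" "K \<subseteq> chart_range c"
    note 1 = set_integrable_component[OF weak_differentialD(1)[OF assms(1) c K]]
      set_integrable_component[OF weak_differentialD(1)[OF assms(2) c K]]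
    show "set_integrable lborel K (\<lambda>\<xi>. cov_comp A c w \<xi> $ i - cov_comp A c z \<xi> $ i)"
      by (rule set_integral_diff(1)[OF 1])
    fix \<psi> assume "smooth_on UNIV \<psi>" "\<And>\<xi>. \<xi> \<notin> K \<Longrightarrow> \<psi> \<xi> = (0::real)"
    with K have t: "test_function c \<psi> K" by (simp add: test_function_def)
    show "(LINT \<xi>:chart_range c|lborel. (cov_comp A c w \<xi> $ i - cov_comp A c z \<xi> $ i) * \<psi> \<xi>) = 0"
      unfolding left_diff_distrib
      by (subst set_integral_diff(2)[OF test_set_integrable(1)[OF 1(1) t] test_set_integrable(1)[OF 1(2) t]])
        (use weak_differentialD(2)[OF assms(1) c t, of i] weak_differentialD(2)[OF assms(2) c t, of i] in linarith)
  qed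
  then have "AE \<xi> in lborel. \<forall>i\<in>UNIV. \<xi> \<in> chart_range c \<longrightarrow> cov_comp A c w \<xi> $ i - cov_comp A c z \<xi> $ i = 0"
    by (subst AE_finite_all) auto
  then show "AE \<xi> in lborel. \<xi> \<in> chart_range c \<longrightarrow> w (chart_inv c \<xi>) = z (chart_inv c \<xi>)"
  proof (rule eventually_mono, intro impI)
    fix \<xi> assume "\<forall>i\<in>UNIV. \<xi> \<in> chart_range c \<longrightarrow> cov_comp A c w \<xi> $ i - cov_comp A c z \<xi> $ i = 0"
      and \<xi>: "\<xi> \<in> chart_range c"
    then have "cov_comp A c w \<xi> = cov_comp A c z \<xi>" by (simp add: vec_eq_iff)
    then show "w (chart_inv c \<xi>) = z (chart_inv c \<xi>)" using cov_comp_eq_iff[OF c \<xi>] by blast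
  qed
qed

lemma weak_differential_ae:
  assumes u: "u \<in> borel_measurable borel" and v: "v \<in> borel_measurable borel"
    and eq: "AE x in m. u x = v x" and wd: "weak_differential A u w"
  shows "weak_differential A v w"
  unfolding weak_differential_iff
proof (intro ballI conjI allI impI)
  fix c \<psi> K i assume c: "c \<in> A" and t: "test_function c \<psi> K"
  let ?D = "\<lambda>\<xi>. frechet_derivative \<psi> (at \<xi>) (axis i 1)"
  have [measurable]: "?D \<in> borel_measurable borel"
    by (rule borel_measurable_continuous_onI[OF test_functionD(5)[OF t]])
  have meas: "(\<lambda>\<xi>. indicator (chart_range c) \<xi> *\<^sub>R (f (chart_inv c \<xi>) * ?D \<xi>)) \<in> borel_measurable lborel"
    if "f \<in> borel_measurable borel" for f :: "'m \<Rightarrow> real"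
  proof -
    have [measurable]: "(\<lambda>\<xi>. f (chart_inv c \<xi>)) \<in> borel_measurable (restrict_space borel (chart_range c))"
      by (rule measurable_chart_comp[OF that c])
    have [measurable]: "?D \<in> borel_measurable (restrict_space borel (chart_range c))"
      by (rule measurable_restrict_space1) measurable
    have "(\<lambda>\<xi>. f (chart_inv c \<xi>) * ?D \<xi>) \<in> borel_measurable (restrict_space borel (chart_range c))"
      by measurable
    then show ?thesis
      using open_chart_range[OF c] by (subst (asm) borel_measurable_restrict_space_iff) auto
  qed
  have "AE \<xi> in lborel. indicator (chart_range c) \<xi> *\<^sub>R (v (chart_inv c \<xi>) * ?D \<xi>) =
      indicator (chart_range c) \<xi> *\<^sub>R (u (chart_inv c \<xi>) * ?D \<xi>)"
    using AE_chart[OF c eq] by (rule eventually_mono) (auto simp: indicator_def)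
  then have "(LINT \<xi>:chart_range c|lborel. v (chart_inv c \<xi>) * ?D \<xi>) = (LINT \<xi>:chart_range c|lborel. u (chart_inv c \<xi>) * ?D \<xi>)"
    unfolding set_lebesgue_integral_def by (intro integral_cong_AE meas u v)
  then show "(LINT \<xi>:chart_range c|lborel. v (chart_inv c \<xi>) * ?D \<xi>) = - (LINT \<xi>:chart_range c|lborel. cov_comp A c w \<xi> $ i * \<psi> \<xi>)"
    using weak_differentialD(2)[OF wd c t] by simp
qed (use weak_differentialD(1)[OF wd] in auto)

text \<open>Equality of functions, not just almost everywhere: both arguments have the same set of
  weak differentials, so the \<open>SOME\<close> operator makes the same choice.\<close>

lemma Dweak_ae:
  assumes u: "u \<in> borel_measurable borel" and v: "v \<in> borel_measurable borel"
    and eq: "AE x in m. u x = v x"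
  shows "Dweak A u = Dweak A v"
proof -
  have eq': "AE x in m. v x = u x" using eq by (auto elim!: eventually_mono)
  have "weak_differential A u w \<longleftrightarrow> weak_differential A v w" for w
    using weak_differential_ae[OF u v eq] weak_differential_ae[OF v u eq'] by blast
  then show ?thesis by (simp add: Dweak_def)
qed

lemma W12_loc_ae:
  assumes u: "u \<in> W12_loc A" and v: "v \<in> borel_measurable borel" and eq: "AE x in m. v x = u x"
  shows "v \<in> W12_loc A"
proof -
  have eq': "AE x in m. u x = v x" using eq by (auto elim!: eventually_mono)
  obtain w where w: "weak_differential A u w" "locally_L2_section w"
    using u unfolding W12_loc_iff by blast
  have "locally_L2 v"
    unfolding locally_L2_def
  proof (intro conjI v ballI allI impI)
    fix c K assume c: "c \<in> A" and K: "compact K \<and> K \<subseteq> chart_range c"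
    have i: "integrable lborel (\<lambda>\<xi>. indicator K \<xi> *\<^sub>R (u (chart_inv c \<xi>))\<^sup>2)"
      using W12_loc_L2[OF u] c K by (simp add: locally_L2_def set_integrable_def)
    have [measurable]: "(\<lambda>\<xi>. v (chart_inv c \<xi>)) \<in> borel_measurable (restrict_space borel (chart_range c))"
      by (rule measurable_chart_comp[OF v c])
    have vm: "(\<lambda>\<xi>. indicator K \<xi> *\<^sub>R (v (chart_inv c \<xi>))\<^sup>2) \<in> borel_measurable borel"
      by (rule indicator_measurable[OF c]) (use K in auto)
    have "AE \<xi> in lborel. indicator K \<xi> *\<^sub>R (u (chart_inv c \<xi>))\<^sup>2 = indicator K \<xi> *\<^sub>R (v (chart_inv c \<xi>))\<^sup>2"
      using AE_chart[OF c eq]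
    proof (rule eventually_mono)
      fix \<xi> assume "\<xi> \<in> chart_range c \<longrightarrow> v (chart_inv c \<xi>) = u (chart_inv c \<xi>)"
      then show "indicator K \<xi> *\<^sub>R (u (chart_inv c \<xi>))\<^sup>2 = indicator K \<xi> *\<^sub>R (v (chart_inv c \<xi>))\<^sup>2"
        using K by (cases "\<xi> \<in> K") auto
    qed
    then show "set_integrable lborel K (\<lambda>\<xi>. (v (chart_inv c \<xi>))\<^sup>2)"
      unfolding set_integrable_def by (rule integrable_cong_AE_imp[OF i, rotated]) (use vm in simp)
  qed
  moreover have "weak_differential A v w"
    by (rule weak_differential_ae[OF W12_loc_borel[OF u] v eq' w(1)])
  ultimately show ?thesis using w(2) unfolding W12_loc_iff by blast
qed

text \<open>Choices made by \<open>SOME\<close> for different functions are unrelated. Every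
  algebraic rule for \<open>Dweak\<close> is therefore obtained almost everywhere, by exhibiting one
  weak differential of the right form.\<close>

lemma Dweak_eqI: "\<lbrakk>u \<in> W12_loc A; weak_differential A u w\<rbrakk> \<Longrightarrow> AE x in m. Dweak A u x = w x"
  by (rule weak_differential_unique[OF Dweak])

lemma Dweak_add:
  assumes "u \<in> W12_loc A" "v \<in> W12_loc A"
  shows "AE x in m. Dweak A (\<lambda>x. u x + v x) x = Dweak A u x + Dweak A v x"
  by (rule Dweak_eqI[OF W12_loc_add[OF assms]])
    (rule weak_differential_add[OF assms[THEN Dweak] assms[THEN W12_loc_locally_integrable]])

lemma Dweak_scale:
  assumes "u \<in> W12_loc A"
  shows "AE x in m. Dweak A (\<lambda>x. a * u x) x = a *\<^sub>R Dweak A u x"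
  by (rule Dweak_eqI[OF W12_loc_scale[OF assms] weak_differential_scale[OF Dweak[OF assms]]])

lemma Dweak_diff:
  assumes "u \<in> W12_loc A" "v \<in> W12_loc A"
  shows "AE x in m. Dweak A (\<lambda>x. u x - v x) x = Dweak A u x - Dweak A v x"
  using Dweak_add[OF assms(1) W12_loc_scale[OF assms(2), of "-1"]] Dweak_scale[OF assms(2), of "-1"]
  by (auto elim!: eventually_elim2)

end

section \<open>Smooth functions with compact support\<close>

context atlas
begin

lemma C0_infinityD:
  assumes "u \<in> C0_infinity A"
  shows "c \<in> A \<Longrightarrow> Ck_on k (chart_range c) (u \<circ> chart_inv c)"
    "\<exists>K. compact K \<and> (\<forall>x. x \<notin> K \<longrightarrow> u x = 0)"
  using assms by (auto simp: C0_infinity_def smooth_on_def)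

lemma C0_infinity_continuous: assumes "u \<in> C0_infinity A" shows "continuous_on UNIV u"
proof -
  have "continuous_on (fst c) u" if c: "c \<in> A" for c
  proof -
    have "continuous_on (chart_range c) (u \<circ> chart_inv c)" using C0_infinityD(1)[OF assms c, of 0] by simp
    then have "continuous_on (fst c) ((u \<circ> chart_inv c) \<circ> snd c)"
      by (intro continuous_on_compose[OF continuous_on_chart[OF c]]) (simp add: chart_range_def)
    then show ?thesis by (rule continuous_on_eq) (use c in auto)
  qed
  then have "continuous_on (\<Union>c\<in>A. fst c) u" by (intro continuous_on_open_UN open_domain)
  then show ?thesis by (simp add: charts_cover)
qed

lemma C0_infinity_borel: "u \<in> C0_infinity A \<Longrightarrow> u \<in> borel_measurable borel"
  by (intro borel_measurable_continuous_onI C0_infinity_continuous)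

lemma C0_infinity_zero: "(\<lambda>x. 0) \<in> C0_infinity A"
  using open_chart_range
  by (auto simp: C0_infinity_def smooth_on_def o_def intro!: Ck_on_const exI[of _ "{}"])

lemma C0_infinity_add:
  assumes "u \<in> C0_infinity A" "v \<in> C0_infinity A"
  shows "(\<lambda>x. u x + v x) \<in> C0_infinity A"
proof -
  obtain K L where "compact K" "\<And>x. x \<notin> K \<Longrightarrow> u x = 0" "compact L" "\<And>x. x \<notin> L \<Longrightarrow> v x = 0"
    using C0_infinityD(2)[OF assms(1)] C0_infinityD(2)[OF assms(2)] by blast
  then have "\<exists>K. compact K \<and> (\<forall>x. x \<notin> K \<longrightarrow> u x + v x = 0)" by (intro exI[of _ "K \<union> L"]) auto
  moreover have "Ck_on k (chart_range c) ((\<lambda>x. u x + v x) \<circ> chart_inv c)" if "c \<in> A" for k c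
    using Ck_on_add[OF open_chart_range[OF that] C0_infinityD(1)[OF assms(1) that] C0_infinityD(1)[OF assms(2) that]]
    by (simp add: o_def)
  ultimately show ?thesis by (auto simp: C0_infinity_def smooth_on_def)
qed

lemma C0_infinity_scale:
  assumes "u \<in> C0_infinity A" shows "(\<lambda>x. a * u x) \<in> C0_infinity A"
proof -
  have "\<exists>K. compact K \<and> (\<forall>x. x \<notin> K \<longrightarrow> a * u x = 0)" using C0_infinityD(2)[OF assms] by auto
  moreover have "Ck_on k (chart_range c) ((\<lambda>x. a * u x) \<circ> chart_inv c)" if "c \<in> A" for k c
    using Ck_on_scaleR[OF open_chart_range[OF that] C0_infinityD(1)[OF assms that], where a=a]
    by (simp add: o_def)
  ultimately show ?thesis by (auto simp: C0_infinity_def smooth_on_def)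
qed

lemma C0_infinity_bounded:
  assumes "u \<in> C0_infinity A"
  obtains K B where "compact K" "\<And>x. x \<notin> K \<Longrightarrow> u x = 0" "\<And>x. \<bar>u x\<bar> \<le> B"
proof -
  obtain K where K: "compact K" "\<And>x. x \<notin> K \<Longrightarrow> u x = 0" using C0_infinityD(2)[OF assms] by blast
  have "compact (u ` K)"
    using compact_continuous_image[OF continuous_on_subset[OF C0_infinity_continuous[OF assms]] K(1)] by simp
  then obtain B where B: "B > 0" "\<And>x. x \<in> K \<Longrightarrow> \<bar>u x\<bar> \<le> B"
    using compact_imp_bounded bounded_pos by (metis imageI real_norm_def)
  have "\<bar>u x\<bar> \<le> B" for x using B K(2)[of x] by (cases "x \<in> K") auto
  with K show ?thesis using that by blast
qed

text \<open>The classical differential, written in the preferred chart because covectors are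
  labelled by their components there.\<close>

definition differential :: "('m \<Rightarrow> real) \<Rightarrow> 'm \<Rightarrow> real ^ 'n" where
  "differential u x = (let p = pref_chart A x in
     (\<chi> i. frechet_derivative (u \<circ> chart_inv p) (at (snd p x)) (axis i 1)))"

text \<open>The chain rule through the overlap of \<open>c\<close> with the preferred chart. It
  replaces a chart that varies with the point by the fixed chart \<open>c\<close>, which yields
  continuity of the components.\<close>

lemma cov_comp_differential:
  assumes u: "u \<in> C0_infinity A" and c: "c \<in> A" and \<xi>: "\<xi> \<in> chart_range c"
  shows "cov_comp A c (differential u) \<xi> $ i = frechet_derivative (u \<circ> chart_inv c) (at \<xi>) (axis i 1)"
proof -
  define x where "x = chart_inv c \<xi>"
  define p where "p = pref_chart A x"
  have x: "x \<in> fst c" "snd c x = \<xi>" using c \<xi> by (auto simp: x_def)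
  have p: "p \<in> A" "x \<in> fst p" using pref_chart by (auto simp: p_def)
  let ?L = "frechet_derivative (u \<circ> chart_inv p) (at (snd p x))"
  have dL: "((u \<circ> chart_inv p) has_derivative ?L) (at (snd p x))"
    using C0_infinityD(1)[OF u p(1), of 1] p by (simp add: frechet_derivative_works)
  have "((u \<circ> chart_inv p) \<circ> (snd p \<circ> chart_inv c) has_derivative ?L \<circ> chart_transition c p \<xi>) (at \<xi>)"
    using has_derivative_chart_transition[OF c p(1) x(1) p(2)] dL x
    by (intro diff_chain_at) (simp_all add: x_def)
  moreover have "open (snd c ` (fst c \<inter> fst p))" using open_chart_image[OF c open_domain[OF p(1)]] .
  moreover have "\<xi> \<in> snd c ` (fst c \<inter> fst p)" using x p(2) by (metis IntI imageI)
  ultimately have "(u \<circ> chart_inv c has_derivative ?L \<circ> chart_transition c p \<xi>) (at \<xi>)"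
    by (rule has_derivative_transform_within_open) (use c p(1) in auto)
  from frechet_derivative_at[OF this]
  have 1: "frechet_derivative (u \<circ> chart_inv c) (at \<xi>) (axis i 1) = ?L (chart_transition c p \<xi> (axis i 1))"
    by (metis comp_apply)
  have linL: "linear ?L" using dL by (rule has_derivative_linear)
  have "(\<chi> j. ?L (axis j 1)) \<bullet> v = ?L v" for v
  proof -
    have "v = (\<Sum>j\<in>UNIV. v $ j *\<^sub>R axis j 1)"
      using basis_expansion[of v] by (simp add: scalar_mult_eq_scaleR)
    then have "?L v = ?L (\<Sum>j\<in>UNIV. v $ j *\<^sub>R axis j 1)" by simp
    also have "\<dots> = (\<Sum>j\<in>UNIV. v $ j * ?L (axis j 1))"
      using linL by (simp add: linear_sum linear_cmul)
    finally show ?thesis by (simp add: inner_vec_def mult.commute)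
  qed
  moreover have "differential u x = (\<chi> j. ?L (axis j 1))" by (simp add: differential_def p_def Let_def)
  ultimately have "differential u x \<bullet> chart_transition c p \<xi> (axis i 1) = ?L (chart_transition c p \<xi> (axis i 1))" by simp
  moreover have "tangent_of A c x = chart_transition c p \<xi>" by (simp add: tangent_of_eq p_def x)
  ultimately show ?thesis by (simp only: cov_comp_def Let_def vec_lambda_beta x_def[symmetric] 1)
qed

lemma continuous_cov_comp_differential:
  assumes "u \<in> C0_infinity A" "c \<in> A"
  shows "continuous_on (chart_range c) (cov_comp A c (differential u))"
proof -
  have "continuous_on (chart_range c) (\<lambda>\<xi>. \<chi> i. frechet_derivative (u \<circ> chart_inv c) (at \<xi>) (axis i 1))"
    using C0_infinityD(1)[OF assms, of 1] by (intro continuous_on_vec_lambda) simp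
  then show ?thesis
    by (rule continuous_on_eq) (simp add: vec_eq_iff cov_comp_differential[OF assms])
qed

lemma C0_infinity_weak_differential:
  assumes u: "u \<in> C0_infinity A" shows "weak_differential A u (differential u)"
  unfolding weak_differential_iff
proof (intro ballI conjI allI impI)
  fix c K assume c: "c \<in> A" and K: "compact K \<and> K \<subseteq> chart_range c"
  then show "set_integrable lborel K (cov_comp A c (differential u))"
    using continuous_on_subset[OF continuous_cov_comp_differential[OF u c]]
    by (auto simp: set_integrable_def intro!: borel_integrable_compact)
next
  fix c \<psi> K i assume c: "c \<in> A" and t: "test_function c \<psi> K"
  have "(LINT \<xi>:chart_range c|lborel. (u \<circ> chart_inv c) \<xi> * frechet_derivative \<psi> (at \<xi>) (axis i 1)) =
    - (LINT \<xi>:chart_range c|lborel. frechet_derivative (u \<circ> chart_inv c) (at \<xi>) (axis i 1) * \<psi> \<xi>)"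
    by (rule integration_by_parts_test[OF open_chart_range[OF c] C0_infinityD(1)[OF u c] test_functionD(7,2,3)[OF t]])
      (rule test_functionD(4)[OF t])
  moreover have "(LINT \<xi>:chart_range c|lborel. frechet_derivative (u \<circ> chart_inv c) (at \<xi>) (axis i 1) * \<psi> \<xi>) =
    (LINT \<xi>:chart_range c|lborel. cov_comp A c (differential u) \<xi> $ i * \<psi> \<xi>)"
    unfolding set_lebesgue_integral_def
    by (rule Bochner_Integration.integral_cong) (auto simp: indicator_def cov_comp_differential[OF u c])
  ultimately show "(LINT \<xi>:chart_range c|lborel. u (chart_inv c \<xi>) * frechet_derivative \<psi> (at \<xi>) (axis i 1)) =
    - (LINT \<xi>:chart_range c|lborel. cov_comp A c (differential u) \<xi> $ i * \<psi> \<xi>)" by simp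
qed

lemma C0_infinity_W12_loc: assumes u: "u \<in> C0_infinity A" shows "u \<in> W12_loc A"
proof -
  have "locally_L2 u"
    unfolding locally_L2_def
  proof (intro conjI C0_infinity_borel u ballI allI impI)
    fix c K assume c: "c \<in> A" and K: "compact K \<and> K \<subseteq> chart_range c"
    have "continuous_on K (\<lambda>\<xi>. u (chart_inv c \<xi>))"
      using continuous_on_subset[of "chart_range c" "u \<circ> chart_inv c" K] C0_infinityD(1)[OF u c, of 0] K by (simp add: o_def)
    then have "continuous_on K (\<lambda>\<xi>. (u (chart_inv c \<xi>))\<^sup>2)" by (intro continuous_intros)
    then show "set_integrable lborel K (\<lambda>\<xi>. (u (chart_inv c \<xi>))\<^sup>2)"
      using K unfolding set_integrable_def by (intro borel_integrable_compact) auto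
  qed
  moreover have "locally_L2_section (differential u)"
    unfolding locally_L2_section_def
  proof (intro ballI allI impI)
    fix c K assume c: "c \<in> A" and K: "compact K \<and> K \<subseteq> chart_range c"
    have "continuous_on K (\<lambda>\<xi>. (norm (cov_comp A c (differential u) \<xi>))\<^sup>2)"
      using continuous_on_subset[OF continuous_cov_comp_differential[OF u c]] K by (intro continuous_intros) auto
    then show "set_integrable lborel K (\<lambda>\<xi>. (norm (cov_comp A c (differential u) \<xi>))\<^sup>2)"
      using K unfolding set_integrable_def by (intro borel_integrable_compact) auto
  qed
  ultimately show ?thesis
    using C0_infinity_weak_differential[OF u] unfolding W12_loc_iff by blast
qed

end

context busemann
begin

text \<open>A bounded function that vanishes off a compact set, whose measure is finite by
  \<open>emeasure_compact_finite\<close>.\<close>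

lemma C0_infinity_L2: assumes "u \<in> C0_infinity A" shows "(\<integral>\<^sup>+x. ennreal ((u x)\<^sup>2) \<partial>m) < \<infinity>"
proof -
  obtain K B where K: "compact K" "\<And>x. x \<notin> K \<Longrightarrow> u x = 0" "\<And>x. \<bar>u x\<bar> \<le> B"
    using C0_infinity_bounded[OF assms] by blast
  have K_sets: "K \<in> sets m" using K(1) by (simp add: compact_imp_closed)
  have sq: "(u x)\<^sup>2 \<le> B\<^sup>2" for x using power_mono[OF K(3)[of x], of 2] by simp
  have "(\<integral>\<^sup>+x. ennreal ((u x)\<^sup>2) \<partial>m) \<le> (\<integral>\<^sup>+x. ennreal (B\<^sup>2) * indicator K x \<partial>m)"
    using K(2) sq by (intro nn_integral_mono) (auto simp: indicator_def intro!: ennreal_leI)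
  also have "\<dots> = ennreal (B\<^sup>2) * emeasure m K" using K_sets by (rule nn_integral_cmult_indicator)
  also have "\<dots> < \<infinity>" using emeasure_compact_finite[OF K(1)] by (simp add: ennreal_mult_less_top)
  finally show ?thesis .
qed

end

section \<open>The Sobolev norm\<close>

lemma ennreal_sqrt_ennreal: "t \<ge> 0 \<Longrightarrow> ennreal_sqrt (ennreal t) = ennreal (sqrt t)"
  by (simp add: ennreal_sqrt_def)

lemma ennreal_sqrt_power2: "(ennreal_sqrt a)\<^sup>2 = a"
  by (cases a) (simp_all add: ennreal_sqrt_def ennreal_power power2_eq_square ennreal_top_mult ennreal_mult[symmetric])

lemma power2_ennreal_sqrt: "ennreal_sqrt (b\<^sup>2) = b"
  by (cases b) (simp_all add: ennreal_sqrt_def ennreal_power power2_eq_square ennreal_top_mult ennreal_mult[symmetric])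

lemma ennreal_sqrt_mono: "a \<le> b \<Longrightarrow> ennreal_sqrt a \<le> ennreal_sqrt b"
  by (cases a; cases b) (simp_all add: ennreal_sqrt_def top_unique)

lemma ennreal_power2_mono: "a \<le> b \<Longrightarrow> a\<^sup>2 \<le> (b\<^sup>2 :: ennreal)"
  unfolding power2_eq_square by (intro mult_mono) auto

lemma ennreal_sqrt_le_iff: "ennreal_sqrt a \<le> b \<longleftrightarrow> a \<le> b\<^sup>2"
  using ennreal_sqrt_mono[of a "b\<^sup>2"] ennreal_power2_mono[of "ennreal_sqrt a" b]
  by (auto simp: power2_ennreal_sqrt ennreal_sqrt_power2)

lemma ennreal_sqrt_mult: "ennreal_sqrt (a * b) = ennreal_sqrt a * ennreal_sqrt b"
proof -
  have "(ennreal_sqrt a * ennreal_sqrt b)\<^sup>2 = a * b"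
    by (simp add: power_mult_distrib ennreal_sqrt_power2)
  then show ?thesis by (metis power2_ennreal_sqrt)
qed

lemma ennreal_sqrt_less_top_iff: "ennreal_sqrt a < top \<longleftrightarrow> a < top"
  by (auto simp: ennreal_sqrt_def less_top)

lemma ennreal_sqrt_eq_0_iff: "ennreal_sqrt a = 0 \<longleftrightarrow> a = 0"
  by (metis ennreal_sqrt_power2 power2_ennreal_sqrt power_zero_numeral)

text \<open>The square of the sum is expanded and Cauchy-Schwarz bounds the cross term. Working in
  \<open>ennreal\<close> admits infinite norms, and \<open>h\<close> enters through a pointwise
  bound alone, which suits the subadditive but nonlinear energy density.\<close>

lemma nn_integral_minkowski:
  fixes f g h :: "'a \<Rightarrow> real"
  assumes [measurable]: "f \<in> borel_measurable M" "g \<in> borel_measurable M"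
    and le: "AE x in M. \<bar>h x\<bar> \<le> \<bar>f x\<bar> + \<bar>g x\<bar>"
  shows "ennreal_sqrt (\<integral>\<^sup>+x. ennreal ((h x)\<^sup>2) \<partial>M) \<le>
    ennreal_sqrt (\<integral>\<^sup>+x. ennreal ((f x)\<^sup>2) \<partial>M) + ennreal_sqrt (\<integral>\<^sup>+x. ennreal ((g x)\<^sup>2) \<partial>M)"
proof -
  define a b where "a = (\<integral>\<^sup>+x. ennreal ((f x)\<^sup>2) \<partial>M)" and "b = (\<integral>\<^sup>+x. ennreal ((g x)\<^sup>2) \<partial>M)"
  define c where "c = (\<integral>\<^sup>+x. ennreal \<bar>f x\<bar> * ennreal \<bar>g x\<bar> \<partial>M)"
  have "c\<^sup>2 \<le> (\<integral>\<^sup>+x. (ennreal \<bar>f x\<bar>)\<^sup>2 \<partial>M) * (\<integral>\<^sup>+x. (ennreal \<bar>g x\<bar>)\<^sup>2 \<partial>M)"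
    unfolding c_def by (rule Cauchy_Schwarz_nn_integral) measurable
  also have "\<dots> = a * b" by (simp add: a_def b_def ennreal_power)
  finally have c: "c \<le> ennreal_sqrt a * ennreal_sqrt b"
    using ennreal_sqrt_mono[of "c\<^sup>2" "a * b"] by (simp add: power2_ennreal_sqrt ennreal_sqrt_mult)
  have "(\<integral>\<^sup>+x. ennreal ((h x)\<^sup>2) \<partial>M) \<le>
      (\<integral>\<^sup>+x. ennreal ((f x)\<^sup>2) + (2 * (ennreal \<bar>f x\<bar> * ennreal \<bar>g x\<bar>) + ennreal ((g x)\<^sup>2)) \<partial>M)"
  proof (rule nn_integral_mono_AE)
    show "AE x in M. ennreal ((h x)\<^sup>2) \<le> ennreal ((f x)\<^sup>2) + (2 * (ennreal \<bar>f x\<bar> * ennreal \<bar>g x\<bar>) + ennreal ((g x)\<^sup>2))"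
      using le
    proof eventually_elim
      case (elim x)
      have "(h x)\<^sup>2 \<le> (\<bar>f x\<bar> + \<bar>g x\<bar>)\<^sup>2" using power_mono[OF elim, of 2] by simp
      also have "\<dots> = (f x)\<^sup>2 + (2 * (\<bar>f x\<bar> * \<bar>g x\<bar>) + (g x)\<^sup>2)" by (simp add: power2_sum)
      finally have "ennreal ((h x)\<^sup>2) \<le> ennreal ((f x)\<^sup>2 + (2 * (\<bar>f x\<bar> * \<bar>g x\<bar>) + (g x)\<^sup>2))" by (rule ennreal_leI)
      also have "\<dots> = ennreal ((f x)\<^sup>2) + (2 * (ennreal \<bar>f x\<bar> * ennreal \<bar>g x\<bar>) + ennreal ((g x)\<^sup>2))"
        by (simp add: ennreal_plus[symmetric] ennreal_mult[symmetric] ennreal_numeral[symmetric] del: ennreal_plus ennreal_numeral)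
      finally show ?case .
    qed
  qed
  also have "\<dots> = a + (2 * c + b)"
    unfolding a_def b_def c_def by (simp add: nn_integral_add nn_integral_cmult)
  also have "\<dots> \<le> a + (2 * (ennreal_sqrt a * ennreal_sqrt b) + b)"
    using c by (intro add_mono mult_left_mono) auto
  also have "\<dots> = (ennreal_sqrt a + ennreal_sqrt b)\<^sup>2"
    by (simp add: power2_sum ennreal_sqrt_power2 ac_simps)
  finally show ?thesis unfolding ennreal_sqrt_le_iff a_def[symmetric] b_def[symmetric] .
qed

lemma borel_measurable_lim_or_0:
  fixes f :: "nat \<Rightarrow> 'a \<Rightarrow> 'b::{banach, second_countable_topology}"
  assumes [measurable]: "\<And>k. f k \<in> borel_measurable M"
  shows "(\<lambda>x. if convergent (\<lambda>k. f k x) then lim (\<lambda>k. f k x) else 0) \<in> borel_measurable M"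
proof -
  have "{x \<in> space M. Cauchy (\<lambda>k. f k x)} \<in> sets M" by (rule sets_Collect_Cauchy) measurable
  then have [measurable]: "Measurable.pred M (\<lambda>x. convergent (\<lambda>k. f k x))"
    unfolding pred_def Cauchy_convergent_iff .
  show ?thesis by measurable
qed

lemma convergent_if_geometric:
  fixes z :: "nat \<Rightarrow> 'b::banach"
  assumes "\<And>k. norm (z (Suc k) - z k) \<le> C * (1 / 2) ^ k"
  shows "convergent z"
proof -
  have "summable (\<lambda>k. C * (1 / 2) ^ k :: real)" by (intro summable_mult summable_geometric) simp
  then have "summable (\<lambda>k. z (Suc k) - z k)"
    by (rule summable_comparison_test'[where N=0]) (use assms in auto)
  then have "(\<lambda>n. z 0 + (\<Sum>k<n. z (Suc k) - z k)) \<longlonglongrightarrow> z 0 + (\<Sum>k. z (Suc k) - z k)"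
    by (intro tendsto_intros summable_LIMSEQ)
  then show ?thesis unfolding sum_lessThan_telescope by (auto simp: convergent_def)
qed

context atlas
begin

text \<open>At each point \<open>tangent_of\<close> is a linear bijection, so the raw covectors
  converge exactly when their components in \<open>c\<close> do. The default 0 is thus taken on the
  same set in both descriptions.\<close>

lemma measurable_section_lim:
  assumes W: "\<And>k::nat. measurable_section (W k)"
  shows "measurable_section (\<lambda>x. if convergent (\<lambda>k. W k x) then lim (\<lambda>k. W k x) else 0)"
    (is "measurable_section ?w")
  unfolding measurable_section_def
proof
  fix c assume c: "c \<in> A"
  let ?M = "restrict_space borel (chart_range c)"
  have [measurable]: "cov_comp A c (W k) \<in> borel_measurable ?M" for k by (rule measurable_sectionD[OF W c])
  have "(\<lambda>\<xi>. if convergent (\<lambda>k. cov_comp A c (W k) \<xi>) then lim (\<lambda>k. cov_comp A c (W k) \<xi>) else 0)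
      \<in> borel_measurable ?M" by (rule borel_measurable_lim_or_0) measurable
  then show "cov_comp A c ?w \<in> borel_measurable ?M"
  proof (rule measurable_cong[THEN iffD1, rotated])
    fix \<xi> assume "\<xi> \<in> space ?M"
    then have \<xi>: "\<xi> \<in> chart_range c" by (simp add: space_restrict_space)
    let ?x = "chart_inv c \<xi>"
    show "(if convergent (\<lambda>k. cov_comp A c (W k) \<xi>) then lim (\<lambda>k. cov_comp A c (W k) \<xi>) else 0) = cov_comp A c ?w \<xi>"
    proof (cases "convergent (\<lambda>k. W k ?x)")
      case True
      then have "(\<lambda>k. W k ?x) \<longlonglongrightarrow> ?w ?x" by (simp add: convergent_LIMSEQ_iff)
      then have "(\<lambda>k. cov_comp A c (W k) \<xi>) \<longlonglongrightarrow> cov_comp A c ?w \<xi>" by (rule cov_comp_tendsto)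
      then show ?thesis by (auto simp: convergent_def limI)
    next
      case False
      have "\<not> convergent (\<lambda>k. cov_comp A c (W k) \<xi>)"
      proof
        assume "convergent (\<lambda>k. cov_comp A c (W k) \<xi>)"
        then obtain \<beta> where \<beta>: "(\<lambda>k. cov_comp A c (W k) \<xi>) \<longlonglongrightarrow> \<beta>" by (auto simp: convergent_def)
        have "\<exists>\<eta>. tangent_of A c ?x \<eta> = axis i 1" for i
          using bij_tangent_of[of c ?x] c \<xi> by (metis bij_pointE chart_inv_in)
        then obtain \<eta> where \<eta>: "\<And>i. tangent_of A c ?x (\<eta> i) = axis i 1" by metis
        have "W k ?x $ i = cov_comp A c (W k) \<xi> \<bullet> \<eta> i" for k i
          by (simp add: cov_comp_inner'[OF c \<xi>] \<eta> inner_axis)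
        moreover have "(\<lambda>k. cov_comp A c (W k) \<xi> \<bullet> \<eta> i) \<longlonglongrightarrow> \<beta> \<bullet> \<eta> i" for i
          by (intro tendsto_intros \<beta>)
        ultimately have "(\<lambda>k. W k ?x) \<longlonglongrightarrow> (\<chi> i. \<beta> \<bullet> \<eta> i)" by (intro vec_tendstoI) simp
        with False show False by (auto simp: convergent_def)
      qed
      then show ?thesis using False by (simp add: cov_comp_def vec_eq_iff)
    qed
  qed
qed

end

context busemann
begin

text \<open>\<open>W12_loc\<close> grants square integrability to some weak differential, not to the
  one chosen by \<open>Dweak\<close>; uniqueness almost everywhere transfers it.\<close>

lemma locally_L2_section_Dweak:
  assumes "u \<in> W12_loc A" shows "locally_L2_section (Dweak A u)"
  unfolding locally_L2_section_def
proof (intro ballI allI impI)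
  fix c K assume c: "c \<in> A" and K: "compact K \<and> K \<subseteq> chart_range c"
  obtain w where w: "weak_differential A u w" "locally_L2_section w"
    using assms unfolding W12_loc_iff by blast
  have i: "integrable lborel (\<lambda>\<xi>. indicator K \<xi> *\<^sub>R (norm (cov_comp A c w \<xi>))\<^sup>2)"
    using w(2) c K by (simp add: locally_L2_section_def set_integrable_def)
  have [measurable]: "cov_comp A c (Dweak A u) \<in> borel_measurable (restrict_space borel (chart_range c))"
    by (rule measurable_sectionD[OF measurable_Dweak[OF assms] c])
  have vm: "(\<lambda>\<xi>. indicator K \<xi> *\<^sub>R (norm (cov_comp A c (Dweak A u) \<xi>))\<^sup>2) \<in> borel_measurable borel"
    by (rule indicator_measurable[OF c]) (use K in auto)
  have "AE \<xi> in lborel. indicator K \<xi> *\<^sub>R (norm (cov_comp A c w \<xi>))\<^sup>2 = indicator K \<xi> *\<^sub>R (norm (cov_comp A c (Dweak A u) \<xi>))\<^sup>2"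
    using AE_chart[OF c Dweak_eqI[OF assms w(1)]]
  proof (rule eventually_mono)
    fix \<xi> assume eq: "\<xi> \<in> chart_range c \<longrightarrow> Dweak A u (chart_inv c \<xi>) = w (chart_inv c \<xi>)"
    show "indicator K \<xi> *\<^sub>R (norm (cov_comp A c w \<xi>))\<^sup>2 = indicator K \<xi> *\<^sub>R (norm (cov_comp A c (Dweak A u) \<xi>))\<^sup>2"
    proof (cases "\<xi> \<in> K")
      case True
      then have "cov_comp A c w \<xi> = cov_comp A c (Dweak A u) \<xi>"
        using eq K cov_comp_eq_iff[OF c] by (metis subsetD)
      then show ?thesis by simp
    qed simp
  qed
  then show "set_integrable lborel K (\<lambda>\<xi>. (norm (cov_comp A c (Dweak A u) \<xi>))\<^sup>2)"
    unfolding set_integrable_def by (rule integrable_cong_AE_imp[OF i, rotated]) (use vm in simp)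
qed

end

text \<open>Two metrics are kept apart: \<open>F\<close> determines the measure and \<open>G\<close>
  the norm of differentials. The application takes \<open>G = symm F\<close> while retaining the
  measure of \<open>F\<close>.\<close>

locale sobolev = busemann A F m + S: symmetric_metric_field A G
  for A :: "('m::{t2_space, second_countable_topology}, 'n::finite) chart set" and F m G
begin

definition energy_density :: "('m \<Rightarrow> real) \<Rightarrow> ('m \<Rightarrow> real ^ 'n) \<Rightarrow> 'm \<Rightarrow> real" where
  "energy_density u w x = sqrt ((polar G x (w x))\<^sup>2 + (u x)\<^sup>2)"

text \<open>The covector field is independent of \<open>u\<close>, so that a limit pair can be
  measured before it is known that its second entry is the weak differential of the first.\<close>

definition energy :: "('m \<Rightarrow> real) \<Rightarrow> ('m \<Rightarrow> real ^ 'n) \<Rightarrow> ennreal" where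
  "energy u w = (\<integral>\<^sup>+x. ennreal ((energy_density u w x)\<^sup>2) \<partial>m)"

abbreviation "N \<equiv> sobolev_norm A m G"

lemma energy_density_power2: "(energy_density u w x)\<^sup>2 = (polar G x (w x))\<^sup>2 + (u x)\<^sup>2"
  by (simp add: energy_density_def)

lemma energy_density_nonneg: "energy_density u w x \<ge> 0" by (simp add: energy_density_def)

lemma measurable_energy_density [measurable (raw)]:
  "\<lbrakk>u \<in> borel_measurable borel; measurable_section w\<rbrakk> \<Longrightarrow> energy_density u w \<in> borel_measurable borel"
  unfolding energy_density_def[abs_def] using S.measurable_polar_section[of w] by measurable

text \<open>The triangle inequality of the Euclidean plane for the pairs formed by the polar value
  and \<open>u x\<close>, after subadditivity of the polar.\<close>

lemma energy_density_add: "energy_density (\<lambda>x. u x + v x) (\<lambda>x. w x + z x) x \<le> energy_density u w x + energy_density v z x"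
proof -
  have "(polar G x (w x + z x))\<^sup>2 \<le> (polar G x (w x) + polar G x (z x))\<^sup>2"
    by (intro power_mono S.polar_G_add S.polar_G_nonneg)
  then have "energy_density (\<lambda>x. u x + v x) (\<lambda>x. w x + z x) x \<le>
    sqrt ((polar G x (w x) + polar G x (z x))\<^sup>2 + (u x + v x)\<^sup>2)"
    unfolding energy_density_def by (intro real_sqrt_le_mono add_right_mono)
  also have "\<dots> \<le> energy_density u w x + energy_density v z x"
    unfolding energy_density_def by (rule real_sqrt_sum_squares_triangle_ineq)
  finally show ?thesis .
qed

lemma energy_density_scale: "(energy_density (\<lambda>x. a * u x) (\<lambda>x. a *\<^sub>R w x) x)\<^sup>2 = a\<^sup>2 * (energy_density u w x)\<^sup>2"
  unfolding energy_density_power2 by (simp add: S.polar_G_scale_abs power_mult_distrib distrib_left)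

lemma sobolev_norm_eq:
  assumes "u \<in> W12_loc A" shows "N u = ennreal_sqrt (energy u (Dweak A u))"
proof -
  have [measurable]: "u \<in> borel_measurable m" "(\<lambda>x. polar G x (Dweak A u x)) \<in> borel_measurable m"
    using W12_loc_borel[OF assms] S.measurable_polar_section[OF measurable_Dweak[OF assms]] by simp_all
  have "energy u (Dweak A u) = (\<integral>\<^sup>+x. ennreal ((polar G x (Dweak A u x))\<^sup>2) + ennreal ((u x)\<^sup>2) \<partial>m)"
    unfolding energy_def energy_density_power2 by simp
  then show ?thesis unfolding sobolev_norm_def by (simp add: nn_integral_add)
qed

lemma energy_cong_AE:
  assumes "AE x in m. u x = v x" "AE x in m. w x = z x" shows "energy u w = energy v z"
  unfolding energy_def
  by (rule nn_integral_cong_AE) (use assms in \<open>eventually_elim, simp add: energy_density_def\<close>)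

lemma N_power2: "u \<in> W12_loc A \<Longrightarrow> (N u)\<^sup>2 = energy u (Dweak A u)"
  by (simp add: sobolev_norm_eq ennreal_sqrt_power2)

lemma N_diff_power2:
  assumes "u \<in> W12_loc A" "v \<in> W12_loc A"
  shows "(N (\<lambda>x. u x - v x))\<^sup>2 = energy (\<lambda>x. u x - v x) (\<lambda>x. Dweak A u x - Dweak A v x)"
  unfolding N_power2[OF W12_loc_diff[OF assms]] by (rule energy_cong_AE) (use Dweak_diff[OF assms] in auto)

lemma N_add:
  assumes "u \<in> W12_loc A" "v \<in> W12_loc A" shows "N (\<lambda>x. u x + v x) \<le> N u + N v"
  unfolding sobolev_norm_eq[OF assms(1)] sobolev_norm_eq[OF assms(2)] sobolev_norm_eq[OF W12_loc_add[OF assms]] energy_def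
proof (rule nn_integral_minkowski)
  have "energy_density u (Dweak A u) \<in> borel_measurable borel" "energy_density v (Dweak A v) \<in> borel_measurable borel"
    by (rule measurable_energy_density[OF W12_loc_borel measurable_Dweak]; rule assms)+
  then show "energy_density u (Dweak A u) \<in> borel_measurable m" "energy_density v (Dweak A v) \<in> borel_measurable m" by simp_all
  show "AE x in m. \<bar>energy_density (\<lambda>x. u x + v x) (Dweak A (\<lambda>x. u x + v x)) x\<bar>
      \<le> \<bar>energy_density u (Dweak A u) x\<bar> + \<bar>energy_density v (Dweak A v) x\<bar>"
    using Dweak_add[OF assms]
  proof eventually_elim
    case (elim x)
    have "energy_density (\<lambda>x. u x + v x) (Dweak A (\<lambda>x. u x + v x)) x =
        energy_density (\<lambda>x. u x + v x) (\<lambda>x. Dweak A u x + Dweak A v x) x" using elim by (simp add: energy_density_def)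
    then show ?case using energy_density_add[of u v "Dweak A u" "Dweak A v" x] energy_density_nonneg by simp
  qed
qed

lemma N_scale:
  assumes "u \<in> W12_loc A" shows "N (\<lambda>x. a * u x) = ennreal \<bar>a\<bar> * N u"
proof -
  have [measurable]: "energy_density u (Dweak A u) \<in> borel_measurable m"
    using measurable_energy_density[OF W12_loc_borel[OF assms] measurable_Dweak[OF assms]] by simp
  have "energy (\<lambda>x. a * u x) (Dweak A (\<lambda>x. a * u x)) = energy (\<lambda>x. a * u x) (\<lambda>x. a *\<^sub>R Dweak A u x)"
    by (rule energy_cong_AE) (use Dweak_scale[OF assms] in auto)
  also have "\<dots> = ennreal (a\<^sup>2) * energy u (Dweak A u)"
    unfolding energy_def energy_density_scale by (simp add: ennreal_mult nn_integral_cmult)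
  finally show ?thesis
    unfolding sobolev_norm_eq[OF assms] sobolev_norm_eq[OF W12_loc_scale[OF assms]]
    by (simp add: ennreal_sqrt_mult ennreal_sqrt_ennreal)
qed

lemma N_ae:
  assumes u: "u \<in> borel_measurable borel" and v: "v \<in> borel_measurable borel"
    and eq: "AE x in m. u x = v x"
  shows "N u = N v"
proof -
  have "(\<integral>\<^sup>+x. ennreal ((u x)\<^sup>2) \<partial>m) = (\<integral>\<^sup>+x. ennreal ((v x)\<^sup>2) \<partial>m)"
    by (rule nn_integral_cong_AE) (use eq in \<open>auto elim!: eventually_mono\<close>)
  then show ?thesis by (simp add: sobolev_norm_def Dweak_ae[OF u v eq])
qed

lemma N_zero:
  assumes "u \<in> W12_loc A" "N u = 0" shows "AE x in m. u x = 0"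
proof -
  have [measurable]: "energy_density u (Dweak A u) \<in> borel_measurable m"
    using measurable_energy_density[OF W12_loc_borel[OF assms(1)] measurable_Dweak[OF assms(1)]] by simp
  have "energy u (Dweak A u) = 0"
    using assms by (simp add: sobolev_norm_eq ennreal_sqrt_eq_0_iff)
  then have "AE x in m. ennreal ((energy_density u (Dweak A u) x)\<^sup>2) = 0"
    unfolding energy_def by (subst (asm) nn_integral_0_iff_AE) auto
  then show ?thesis
  proof eventually_elim
    case (elim x)
    then have "(polar G x (Dweak A u x))\<^sup>2 + (u x)\<^sup>2 = 0" by (simp add: energy_density_power2)
    then show ?case by (simp add: add_nonneg_eq_0_iff)
  qed
qed

lemma N_minus: "u \<in> W12_loc A \<Longrightarrow> N (\<lambda>x. - u x) = N u"
  using N_scale[of u "-1"] by simp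

definition local_estimate ::
  "('m, 'n) chart \<Rightarrow> (real ^ 'n) set \<Rightarrow> real \<Rightarrow> ('m \<Rightarrow> real) \<Rightarrow> ('m \<Rightarrow> real ^ 'n) \<Rightarrow> bool" where
  "local_estimate c K C u w \<longleftrightarrow>
    (\<integral>\<^sup>+\<xi>\<in>K. ennreal ((u (chart_inv c \<xi>))\<^sup>2) \<partial>lborel) \<le> ennreal C * energy u w \<and>
    (\<integral>\<^sup>+\<xi>\<in>K. ennreal ((norm (cov_comp A c w \<xi>))\<^sup>2) \<partial>lborel) \<le> ennreal C * energy u w"

text \<open>Over \<open>K\<close> the Euclidean norm of the components is controlled by the polar
  with one constant, and Lebesgue measure by \<open>m\<close>. The resulting constant is the same
  for all pairs.\<close>

lemma local_estimate:
  assumes c: "c \<in> A" and K: "compact K" "K \<subseteq> chart_range c"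
  shows "\<exists>C. \<forall>u w. u \<in> borel_measurable borel \<longrightarrow> measurable_section w \<longrightarrow> local_estimate c K C u w"
proof -
  obtain C0 :: real where C0: "C0 > 0" "\<And>h. h \<in> borel_measurable borel \<Longrightarrow>
    (\<integral>\<^sup>+\<xi>\<in>K. h (chart_inv c \<xi>) \<partial>lborel) \<le> ennreal C0 * (\<integral>\<^sup>+x. h x \<partial>m)"
    using nn_integral_chart_le[OF c K] by metis
  obtain a b where ab: "b > 0" "\<And>\<xi>. \<xi> \<in> K \<Longrightarrow> polar_gauge (F_loc A G c) \<xi> a b"
    using S.compact_polar_gauge[OF c K] by metis
  \<comment> \<open>At least 1, so that the same factor also dominates the coefficient of
    \<open>u^2\<close> in the energy density.\<close>
  define b' where "b' = max 1 b"
  have nle: "norm (cov_comp A c w \<xi>) \<le> b' * polar G (chart_inv c \<xi>) (w (chart_inv c \<xi>))" if "\<xi> \<in> K" for w \<xi>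
  proof -
    have \<xi>: "\<xi> \<in> chart_range c" using that K(2) by blast
    have "norm (cov_comp A c w \<xi>) \<le> b * polar (F_loc A G c) \<xi> (cov_comp A c w \<xi>)"
      using polar_gauge.polar_lower[OF ab(2)[OF that], of "cov_comp A c w \<xi>"] ab(1) by (simp add: field_simps)
    also have "\<dots> = b * polar G (chart_inv c \<xi>) (w (chart_inv c \<xi>))" by (simp only: S.polar_loc[OF c \<xi>])
    also have "\<dots> \<le> b' * polar G (chart_inv c \<xi>) (w (chart_inv c \<xi>))"
      by (rule mult_right_mono[OF _ S.polar_G_nonneg]) (simp add: b'_def)
    finally show ?thesis .
  qed
  have b': "b' \<ge> 1" by (simp add: b'_def)
  then have b'2: "b'\<^sup>2 \<ge> 1" using power_mono[of 1 b' 2] by simp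
  have main: "(\<integral>\<^sup>+\<xi>\<in>K. ennreal (b'\<^sup>2 * (energy_density u w (chart_inv c \<xi>))\<^sup>2) \<partial>lborel) \<le> ennreal (C0 * b'\<^sup>2) * energy u w"
    if [measurable]: "u \<in> borel_measurable borel" and w: "measurable_section w" for u w
  proof -
    have [measurable]: "energy_density u w \<in> borel_measurable borel" using that by (rule measurable_energy_density)
    have "(\<lambda>x. ennreal (b'\<^sup>2 * (energy_density u w x)\<^sup>2)) \<in> borel_measurable borel" by measurable
    from C0(2)[OF this] have "(\<integral>\<^sup>+\<xi>\<in>K. ennreal (b'\<^sup>2 * (energy_density u w (chart_inv c \<xi>))\<^sup>2) \<partial>lborel)
      \<le> ennreal C0 * (\<integral>\<^sup>+x. ennreal (b'\<^sup>2 * (energy_density u w x)\<^sup>2) \<partial>m)" .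
    also have "(\<integral>\<^sup>+x. ennreal (b'\<^sup>2 * (energy_density u w x)\<^sup>2) \<partial>m) = ennreal (b'\<^sup>2) * energy u w"
      unfolding energy_def by (simp add: ennreal_mult nn_integral_cmult)
    finally show ?thesis using C0(1) by (simp add: ennreal_mult mult.assoc)
  qed
  show ?thesis
  proof (intro exI[of _ "C0 * b'\<^sup>2"] allI impI)
    fix u :: "'m \<Rightarrow> real" and w assume uw: "u \<in> borel_measurable borel" "measurable_section w"
    have "(u x)\<^sup>2 \<le> b'\<^sup>2 * (energy_density u w x)\<^sup>2" for x
    proof -
      have "1 * (u x)\<^sup>2 \<le> b'\<^sup>2 * (energy_density u w x)\<^sup>2"
        by (intro mult_mono b'2) (auto simp: energy_density_power2)
      then show ?thesis by simp
    qed
    then have "(\<integral>\<^sup>+\<xi>\<in>K. ennreal ((u (chart_inv c \<xi>))\<^sup>2) \<partial>lborel) \<le> (\<integral>\<^sup>+\<xi>\<in>K. ennreal (b'\<^sup>2 * (energy_density u w (chart_inv c \<xi>))\<^sup>2) \<partial>lborel)"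
      by (intro nn_integral_mono mult_right_mono ennreal_leI) auto
    also note main[OF uw]
    finally have est_u: "(\<integral>\<^sup>+\<xi>\<in>K. ennreal ((u (chart_inv c \<xi>))\<^sup>2) \<partial>lborel) \<le> ennreal (C0 * b'\<^sup>2) * energy u w" .
    have "(norm (cov_comp A c w \<xi>))\<^sup>2 \<le> b'\<^sup>2 * (energy_density u w (chart_inv c \<xi>))\<^sup>2" if "\<xi> \<in> K" for \<xi>
    proof -
      have "(norm (cov_comp A c w \<xi>))\<^sup>2 \<le> (b' * polar G (chart_inv c \<xi>) (w (chart_inv c \<xi>)))\<^sup>2"
        by (intro power_mono nle that) simp
      also have "\<dots> \<le> b'\<^sup>2 * (energy_density u w (chart_inv c \<xi>))\<^sup>2"
        by (simp add: power_mult_distrib energy_density_power2 mult_left_mono)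
      finally show ?thesis .
    qed
    then have "(\<integral>\<^sup>+\<xi>\<in>K. ennreal ((norm (cov_comp A c w \<xi>))\<^sup>2) \<partial>lborel) \<le> (\<integral>\<^sup>+\<xi>\<in>K. ennreal (b'\<^sup>2 * (energy_density u w (chart_inv c \<xi>))\<^sup>2) \<partial>lborel)"
      by (intro nn_integral_mono) (auto simp: indicator_def intro!: ennreal_leI)
    also note main[OF uw]
    finally show "local_estimate c K (C0 * b'\<^sup>2) u w" using est_u by (simp add: local_estimate_def)
  qed
qed

end

section \<open>Completeness\<close>

context sobolev
begin

lemma measurable_energy_density_diff:
  assumes "u \<in> W12_loc A" "v \<in> W12_loc A"
  shows "energy_density (\<lambda>x. u x - v x) (\<lambda>x. Dweak A u x - Dweak A v x) \<in> borel_measurable borel"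
  by (intro measurable_energy_density borel_measurable_diff measurable_section_diff W12_loc_borel measurable_Dweak assms)

text \<open>The Riesz-Fischer argument: a subsequence with increments of norm less than \<open>4\<^sup>-\<^sup>k\<close> converges
  almost everywhere together with its differentials, and Fatou's lemma turns the pointwise limit
  into a limit in the norm.\<close>

lemma N_Cauchy_pointwise:
  assumes X: "\<And>k::nat. X k \<in> W12_loc A"
    and cauchy: "\<forall>e::real>0. \<exists>M. \<forall>i\<ge>M. \<forall>j\<ge>M. N (\<lambda>x. X i x - X j x) < ennreal e"
  obtains s u w where "\<And>k::nat. s k \<ge> k" "u \<in> borel_measurable borel" "measurable_section w"
    "AE x in m. (\<lambda>k. X (s k) x) \<longlonglongrightarrow> u x \<and> (\<lambda>k. Dweak A (X (s k)) x) \<longlonglongrightarrow> w x"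
proof -
  have "\<forall>k. \<exists>M. \<forall>i\<ge>M. \<forall>j\<ge>M. N (\<lambda>x. X i x - X j x) < ennreal ((1 / 4) ^ k)" using cauchy by simp
  then obtain M where M: "\<And>k i j. \<lbrakk>i \<ge> M k; j \<ge> M k\<rbrakk> \<Longrightarrow> N (\<lambda>x. X i x - X j x) < ennreal ((1 / 4) ^ k)"
    by metis
  \<comment> \<open>The summand \<open>k\<close> sends the subsequence to infinity. Summing all
    earlier thresholds, rather than taking \<open>M k\<close> alone, gives
    \<open>s (Suc k) \<ge> M k\<close> too, so consecutive members can be compared.\<close>
  define s where "s k = k + (\<Sum>i\<le>k. M i)" for k
  have s: "s k \<ge> k" "s k \<ge> M k" "s (Suc k) \<ge> M k" for k
    using member_le_sum[of k "{..k}" M] by (auto simp: s_def)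
  define Y where "Y k = X (s k)" for k
  have Y: "Y k \<in> W12_loc A" for k using X by (simp add: Y_def)
  define d where "d k = energy_density (\<lambda>x. Y (Suc k) x - Y k x) (\<lambda>x. Dweak A (Y (Suc k)) x - Dweak A (Y k) x)" for k
  have [measurable]: "d k \<in> borel_measurable m" for k
    using measurable_energy_density_diff[OF Y Y] by (simp add: d_def)
  \<comment> \<open>Squared increments have integral at most \<open>16^(-k)\<close>. The weight
    \<open>4^k\<close> leaves a summable series, and its finiteness at almost every point yields
    pointwise increments of order \<open>2^(-k)\<close>.\<close>
  have small: "(\<integral>\<^sup>+x. ennreal (4 ^ k * (d k x)\<^sup>2) \<partial>m) \<le> ennreal ((1 / 4) ^ k)" for k
  proof -
    have "(\<integral>\<^sup>+x. ennreal ((d k x)\<^sup>2) \<partial>m) = (N (\<lambda>x. Y (Suc k) x - Y k x))\<^sup>2"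
      using N_diff_power2[OF Y Y, of "Suc k" k] by (simp add: energy_def d_def)
    also have "\<dots> \<le> (ennreal ((1 / 4) ^ k))\<^sup>2"
      unfolding Y_def by (intro ennreal_power2_mono less_imp_le M s)
    also have "\<dots> = ennreal ((1 / 4) ^ k * (1 / 4) ^ k)" by (simp add: power2_eq_square ennreal_mult)
    finally have le: "(\<integral>\<^sup>+x. ennreal ((d k x)\<^sup>2) \<partial>m) \<le> ennreal ((1 / 4) ^ k * (1 / 4) ^ k)" .
    have "(\<integral>\<^sup>+x. ennreal (4 ^ k * (d k x)\<^sup>2) \<partial>m) = ennreal (4 ^ k) * (\<integral>\<^sup>+x. ennreal ((d k x)\<^sup>2) \<partial>m)"
      by (simp add: ennreal_mult nn_integral_cmult)
    also have "\<dots> \<le> ennreal (4 ^ k) * ennreal ((1 / 4) ^ k * (1 / 4) ^ k)" by (intro mult_left_mono le) simp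
    also have "\<dots> = ennreal (4 ^ k * ((1 / 4) ^ k * (1 / 4) ^ k))" by (rule ennreal_mult[symmetric]) auto
    also have "4 ^ k * ((1 / 4) ^ k * (1 / 4) ^ k) = (1 / 4 :: real) ^ k" by (simp add: power_one_over)
    finally show ?thesis .
  qed
  have "(\<integral>\<^sup>+x. (\<Sum>k. ennreal (4 ^ k * (d k x)\<^sup>2)) \<partial>m) = (\<Sum>k. \<integral>\<^sup>+x. ennreal (4 ^ k * (d k x)\<^sup>2) \<partial>m)"
    by (rule nn_integral_suminf) measurable
  also have "\<dots> \<le> (\<Sum>k. ennreal ((1 / 4) ^ k))" by (intro suminf_le small summableI)
  also have "\<dots> < \<infinity>"
  proof -
    have "summable (\<lambda>k. (1 / 4 :: real) ^ k)" by (rule summable_geometric) simp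
    then have "(\<Sum>k. ennreal ((1 / 4) ^ k)) \<noteq> top" by (rule ennreal_suminf_neq_top) simp
    then show ?thesis by (simp only: infinity_ennreal_def less_top)
  qed
  finally have "(\<integral>\<^sup>+x. (\<Sum>k. ennreal (4 ^ k * (d k x)\<^sup>2)) \<partial>m) \<noteq> \<infinity>" by (rule less_imp_neq)
  then have "AE x in m. (\<Sum>k. ennreal (4 ^ k * (d k x)\<^sup>2)) \<noteq> \<infinity>"
    by (intro nn_integral_PInf_AE) measurable
  then have conv: "AE x in m. convergent (\<lambda>k. Y k x) \<and> convergent (\<lambda>k. Dweak A (Y k) x)"
  proof eventually_elim
    case (elim x)
    define T where "T = (\<Sum>k. ennreal (4 ^ k * (d k x)\<^sup>2))"
    have "T \<noteq> top" using elim unfolding T_def infinity_ennreal_def .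
    then obtain C where C: "C \<ge> 0" "T = ennreal C" by (cases T) auto
    have d: "d k x \<le> sqrt C * (1 / 2) ^ k" for k
    proof -
      have "f k \<le> suminf f" for f :: "nat \<Rightarrow> ennreal"
        using sum_le_suminf[OF summableI, of "{k}" f] by simp
      from this[of "\<lambda>k. ennreal (4 ^ k * (d k x)\<^sup>2)"]
      have "ennreal (4 ^ k * (d k x)\<^sup>2) \<le> ennreal C" unfolding C(2)[symmetric] T_def .
      then have "4 ^ k * (d k x)\<^sup>2 \<le> C" by (rule ennreal_le_iff[OF C(1), THEN iffD1])
      then have "(d k x)\<^sup>2 \<le> C / 4 ^ k" by (simp add: pos_le_divide_eq mult.commute)
      also have "C / 4 ^ k = (sqrt C)\<^sup>2 * ((1 / 2) ^ k)\<^sup>2"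
      proof -
        have "((1 / 2 :: real) ^ k)\<^sup>2 = ((1 / 2)\<^sup>2) ^ k" by (simp only: power_mult[symmetric] mult.commute)
        also have "\<dots> = 1 / 4 ^ k" by (simp add: power2_eq_square power_one_over)
        finally show ?thesis using C(1) by simp
      qed
      also have "\<dots> = (sqrt C * (1 / 2) ^ k)\<^sup>2" by (rule power_mult_distrib[symmetric])
      finally show ?thesis by (rule power2_le_imp_le) (use C(1) in simp)
    qed
    \<comment> \<open>This constant may depend on \<open>x\<close>: convergence of the differentials
      is claimed pointwise.\<close>
    obtain \<kappa> where \<kappa>: "\<kappa> > 0" "\<And>\<alpha>. \<kappa> * norm \<alpha> \<le> polar G x \<alpha>" using S.polar_G_lower[of x] by metis
    have "\<bar>Y (Suc k) x - Y k x\<bar> \<le> d k x" for k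
      unfolding d_def energy_density_def by (rule real_le_rsqrt) simp
    then have "norm (Y (Suc k) x - Y k x) \<le> sqrt C * (1 / 2) ^ k" for k
      using d[of k] by (metis order_trans real_norm_def)
    then have "convergent (\<lambda>k. Y k x)" by (rule convergent_if_geometric)
    moreover have "norm (Dweak A (Y (Suc k)) x - Dweak A (Y k) x) \<le> (sqrt C / \<kappa>) * (1 / 2) ^ k" for k
    proof -
      have "\<kappa> * norm (Dweak A (Y (Suc k)) x - Dweak A (Y k) x) \<le> polar G x (Dweak A (Y (Suc k)) x - Dweak A (Y k) x)"
        by (rule \<kappa>(2))
      also have "\<dots> \<le> d k x" unfolding d_def energy_density_def by (rule real_le_rsqrt) simp
      also have "\<dots> \<le> sqrt C * (1 / 2) ^ k" by (rule d)
      finally show ?thesis using \<kappa>(1) by (simp add: field_simps)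
    qed
    then have "convergent (\<lambda>k. Dweak A (Y k) x)" by (rule convergent_if_geometric)
    ultimately show ?case by blast
  qed
  define u where "u x = (if convergent (\<lambda>k. Y k x) then lim (\<lambda>k. Y k x) else 0)" for x
  define w where "w x = (if convergent (\<lambda>k. Dweak A (Y k) x) then lim (\<lambda>k. Dweak A (Y k) x) else 0)" for x
  have "u \<in> borel_measurable borel"
    unfolding u_def by (rule borel_measurable_lim_or_0) (rule W12_loc_borel[OF Y])
  moreover have "measurable_section w"
    unfolding w_def by (rule measurable_section_lim) (rule measurable_Dweak[OF Y])
  moreover have "AE x in m. (\<lambda>k. X (s k) x) \<longlonglongrightarrow> u x \<and> (\<lambda>k. Dweak A (X (s k)) x) \<longlonglongrightarrow> w x"
    using conv by eventually_elim (simp add: u_def w_def convergent_LIMSEQ_iff[symmetric] flip: Y_def)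
  ultimately show ?thesis using that[of s u w] s(1) by blast
qed

text \<open>For fixed \<open>i\<close>, continuity of the polar makes the integrand of the limit
  pair the pointwise limit of those for \<open>X i - X (s k)\<close>. Fatou bounds its energy by the
  liminf over \<open>k\<close>, which the Cauchy condition controls since
  \<open>s k \<ge> k\<close>.\<close>

lemma energy_limit:
  assumes X: "\<And>k::nat. X k \<in> W12_loc A"
    and cauchy: "\<forall>e::real>0. \<exists>M. \<forall>i\<ge>M. \<forall>j\<ge>M. N (\<lambda>x. X i x - X j x) < ennreal e"
    and s: "\<And>k::nat. s k \<ge> k"
    and lim: "AE x in m. (\<lambda>k. X (s k) x) \<longlonglongrightarrow> u x \<and> (\<lambda>k. Dweak A (X (s k)) x) \<longlonglongrightarrow> w x"
  shows "(\<lambda>i. energy (\<lambda>x. X i x - u x) (\<lambda>x. Dweak A (X i) x - w x)) \<longlonglongrightarrow> 0"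
proof (rule tendsto_0_ennrealI)
  fix e :: real assume e: "e > 0"
  \<comment> \<open>Fatou yields a weak inequality, so \<open>\<epsilon>^2\<close> is kept strictly
    below \<open>e\<close>.\<close>
  define \<epsilon> where "\<epsilon> = sqrt (e / 2)"
  have \<epsilon>: "\<epsilon> > 0" "\<epsilon>\<^sup>2 < e" using e by (auto simp: \<epsilon>_def)
  obtain M where M: "\<And>i j. \<lbrakk>i \<ge> M; j \<ge> M\<rbrakk> \<Longrightarrow> N (\<lambda>x. X i x - X j x) < ennreal \<epsilon>"
    using cauchy[rule_format, OF \<epsilon>(1)] by blast
  have "energy (\<lambda>x. X i x - u x) (\<lambda>x. Dweak A (X i) x - w x) < ennreal e" if i: "i \<ge> M" for i
  proof -
    define f where "f k = energy_density (\<lambda>x. X i x - X (s k) x) (\<lambda>x. Dweak A (X i) x - Dweak A (X (s k)) x)" for k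
    have [measurable]: "f k \<in> borel_measurable m" for k
      using measurable_energy_density_diff[OF X X] by (simp add: f_def)
    have "AE x in m. ennreal ((energy_density (\<lambda>x. X i x - u x) (\<lambda>x. Dweak A (X i) x - w x) x)\<^sup>2) =
        liminf (\<lambda>k. ennreal ((f k x)\<^sup>2))"
      using lim
    proof eventually_elim
      case (elim x)
      have "(\<lambda>k. polar G x (Dweak A (X i) x - Dweak A (X (s k)) x)) \<longlonglongrightarrow> polar G x (Dweak A (X i) x - w x)"
        by (rule continuous_on_tendsto_compose[OF S.continuous_on_polar_G[of UNIV]])
          (use elim in \<open>auto intro!: tendsto_intros\<close>)
      then have "(\<lambda>k. f k x) \<longlonglongrightarrow> energy_density (\<lambda>x. X i x - u x) (\<lambda>x. Dweak A (X i) x - w x) x"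
        unfolding f_def energy_density_def using elim by (intro tendsto_intros) auto
      then have "(\<lambda>k. ennreal ((f k x)\<^sup>2)) \<longlonglongrightarrow> ennreal ((energy_density (\<lambda>x. X i x - u x) (\<lambda>x. Dweak A (X i) x - w x) x)\<^sup>2)"
        by (intro tendsto_ennrealI tendsto_power)
      from lim_imp_Liminf[OF _ this] show ?case by simp
    qed
    then have "energy (\<lambda>x. X i x - u x) (\<lambda>x. Dweak A (X i) x - w x) = (\<integral>\<^sup>+x. liminf (\<lambda>k. ennreal ((f k x)\<^sup>2)) \<partial>m)"
      unfolding energy_def by (rule nn_integral_cong_AE)
    also have "\<dots> \<le> liminf (\<lambda>k. \<integral>\<^sup>+x. ennreal ((f k x)\<^sup>2) \<partial>m)" by (rule nn_integral_liminf) measurable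
    also have "\<dots> \<le> limsup (\<lambda>k. \<integral>\<^sup>+x. ennreal ((f k x)\<^sup>2) \<partial>m)" by (rule Liminf_le_Limsup) simp
    also have "\<dots> \<le> ennreal (\<epsilon>\<^sup>2)"
    proof (rule Limsup_bounded)
      have "(\<integral>\<^sup>+x. ennreal ((f k x)\<^sup>2) \<partial>m) \<le> ennreal (\<epsilon>\<^sup>2)" if k: "k \<ge> M" for k
      proof -
        have "(\<integral>\<^sup>+x. ennreal ((f k x)\<^sup>2) \<partial>m) = (N (\<lambda>x. X i x - X (s k) x))\<^sup>2"
          using N_diff_power2[OF X X, of i "s k"] by (simp add: energy_def f_def)
        also have "\<dots> \<le> (ennreal \<epsilon>)\<^sup>2"
          by (intro ennreal_power2_mono less_imp_le M i order_trans[OF k s])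
        finally show ?thesis using \<epsilon>(1) by (simp add: ennreal_power)
      qed
      then show "\<forall>\<^sub>F k in sequentially. (\<integral>\<^sup>+x. ennreal ((f k x)\<^sup>2) \<partial>m) \<le> ennreal (\<epsilon>\<^sup>2)"
        unfolding eventually_sequentially by blast
    qed
    also have "\<dots> < ennreal e" using \<epsilon> e by (intro ennreal_lessI)
    finally show ?thesis .
  qed
  then show "\<forall>\<^sub>F i in sequentially. energy (\<lambda>x. X i x - u x) (\<lambda>x. Dweak A (X i) x - w x) < ennreal e"
    unfolding eventually_sequentially by blast
qed

lemma locally_L2_if_energy:
  assumes [measurable]: "u \<in> borel_measurable borel" and w: "measurable_section w" and fin: "energy u w < \<infinity>"
  shows "locally_L2 u" "locally_L2_section w"
proof -
  show "locally_L2 u"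
    unfolding locally_L2_def
  proof (intro conjI ballI allI impI)
    fix c K assume c: "c \<in> A" and K: "compact K \<and> K \<subseteq> chart_range c"
    obtain C :: real where C: "\<forall>u w. u \<in> borel_measurable borel \<longrightarrow> measurable_section w \<longrightarrow>
      local_estimate c K C u w" using local_estimate[OF c] K by blast
    have [measurable]: "(\<lambda>\<xi>. u (chart_inv c \<xi>)) \<in> borel_measurable (restrict_space borel (chart_range c))"
      by (rule measurable_chart_comp[OF _ c]) simp
    have "(\<integral>\<^sup>+\<xi>. ennreal (norm (indicator K \<xi> *\<^sub>R (u (chart_inv c \<xi>))\<^sup>2)) \<partial>lborel) =
        (\<integral>\<^sup>+\<xi>\<in>K. ennreal ((u (chart_inv c \<xi>))\<^sup>2) \<partial>lborel)"
      by (intro nn_integral_cong) (simp add: indicator_def)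
    also have "\<dots> \<le> ennreal C * energy u w" using C w assms(1) unfolding local_estimate_def by blast
    also have "\<dots> < \<infinity>" using fin by (simp add: ennreal_mult_less_top)
    finally have "(\<integral>\<^sup>+\<xi>. ennreal (norm (indicator K \<xi> *\<^sub>R (u (chart_inv c \<xi>))\<^sup>2)) \<partial>lborel) < \<infinity>" .
    moreover have "(\<lambda>\<xi>. indicator K \<xi> *\<^sub>R (u (chart_inv c \<xi>))\<^sup>2) \<in> borel_measurable borel"
      by (rule indicator_measurable[OF c]) (use K in auto)
    ultimately show "set_integrable lborel K (\<lambda>\<xi>. (u (chart_inv c \<xi>))\<^sup>2)"
      unfolding set_integrable_def by (intro integrableI_bounded) simp_all
  qed measurable
  show "locally_L2_section w"
    unfolding locally_L2_section_def
  proof (intro ballI allI impI)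
    fix c K assume c: "c \<in> A" and K: "compact K \<and> K \<subseteq> chart_range c"
    obtain C :: real where C: "\<forall>u w. u \<in> borel_measurable borel \<longrightarrow> measurable_section w \<longrightarrow>
      local_estimate c K C u w" using local_estimate[OF c] K by blast
    have [measurable]: "cov_comp A c w \<in> borel_measurable (restrict_space borel (chart_range c))"
      by (rule measurable_sectionD[OF w c])
    have "(\<integral>\<^sup>+\<xi>. ennreal (norm (indicator K \<xi> *\<^sub>R (norm (cov_comp A c w \<xi>))\<^sup>2)) \<partial>lborel) =
        (\<integral>\<^sup>+\<xi>\<in>K. ennreal ((norm (cov_comp A c w \<xi>))\<^sup>2) \<partial>lborel)"
      by (intro nn_integral_cong) (simp add: indicator_def)
    also have "\<dots> \<le> ennreal C * energy u w" using C w assms(1) unfolding local_estimate_def by blast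
    also have "\<dots> < \<infinity>" using fin by (simp add: ennreal_mult_less_top)
    finally have "(\<integral>\<^sup>+\<xi>. ennreal (norm (indicator K \<xi> *\<^sub>R (norm (cov_comp A c w \<xi>))\<^sup>2)) \<partial>lborel) < \<infinity>" .
    moreover have "(\<lambda>\<xi>. indicator K \<xi> *\<^sub>R (norm (cov_comp A c w \<xi>))\<^sup>2) \<in> borel_measurable borel"
      by (rule indicator_measurable[OF c]) (use K in auto)
    ultimately show "set_integrable lborel K (\<lambda>\<xi>. (norm (cov_comp A c w \<xi>))\<^sup>2)"
      unfolding set_integrable_def by (intro integrableI_bounded) simp_all
  qed
qed

lemma measurable_section_integrable:
  assumes "measurable_section w" "locally_L2_section w" "c \<in> A" "compact K" "K \<subseteq> chart_range c"
  shows "set_integrable lborel K (cov_comp A c w)"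
  by (rule set_integrable_if_square[OF assms(4) indicator_measurable[OF assms(3) measurable_sectionD[OF assms(1,3)] assms(4,5)]])
    (use assms in \<open>auto simp: locally_L2_section_def\<close>)

text \<open>One member of the sequence at finite energy distance makes the limit pair locally square
  integrable. Then \<open>local_estimate\<close> turns convergence of energies into convergence in
  mean over compact sets of every chart, and \<open>weak_differential_limit\<close> applies.\<close>

lemma energy_limit_weak_differential:
  assumes X: "\<And>k::nat. X k \<in> W12_loc A"
    and u: "u \<in> borel_measurable borel" and w: "measurable_section w"
    and lim: "(\<lambda>i. energy (\<lambda>x. X i x - u x) (\<lambda>x. Dweak A (X i) x - w x)) \<longlonglongrightarrow> 0"
  shows "u \<in> W12_loc A" "weak_differential A u w"
proof -
  have mu: "(\<lambda>x. X i x - u x) \<in> borel_measurable borel" and mw: "measurable_section (\<lambda>x. Dweak A (X i) x - w x)" for i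
    by (intro borel_measurable_diff W12_loc_borel X u measurable_section_diff measurable_Dweak w)+
  have "\<forall>\<^sub>F i in sequentially. energy (\<lambda>x. X i x - u x) (\<lambda>x. Dweak A (X i) x - w x) < \<infinity>"
    by (rule order_tendstoD(2)[OF lim]) simp
  then obtain i where fin: "energy (\<lambda>x. X i x - u x) (\<lambda>x. Dweak A (X i) x - w x) < \<infinity>"
    by (auto simp: eventually_sequentially)
  have swap: "energy (\<lambda>x. u x - X i x) (\<lambda>x. w x - Dweak A (X i) x) = energy (\<lambda>x. X i x - u x) (\<lambda>x. Dweak A (X i) x - w x)"
    using energy_density_scale[of "-1" "\<lambda>x. X i x - u x" "\<lambda>x. Dweak A (X i) x - w x"]
    unfolding energy_def by simp
  have mu': "(\<lambda>x. u x - X i x) \<in> borel_measurable borel" and mw': "measurable_section (\<lambda>x. w x - Dweak A (X i) x)"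
    by (intro borel_measurable_diff W12_loc_borel X u measurable_section_diff measurable_Dweak w)+
  note L2 = locally_L2_if_energy[OF mu' mw', unfolded swap, OF fin]
  have Lu: "locally_L2 u" using locally_L2_add[OF W12_loc_L2[OF X[of i]] L2(1)] by simp
  have Lw: "locally_L2_section w"
    using locally_L2_section_add[OF locally_L2_section_Dweak[OF X[of i]] L2(2) measurable_Dweak[OF X] mw'] by simp
  show "weak_differential A u w"
  proof (rule weak_differential_limit[where X=X and W="\<lambda>k. Dweak A (X k)"])
    fix c K assume c: "c \<in> A" and K: "compact K" "K \<subseteq> chart_range c"
    show "set_integrable lborel K (cov_comp A c w)" by (rule measurable_section_integrable[OF w Lw c K])
    obtain C :: real where C: "\<forall>u w. u \<in> borel_measurable borel \<longrightarrow> measurable_section w \<longrightarrow>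
      local_estimate c K C u w" using local_estimate[OF c K] by blast
    have lim0: "(\<lambda>i. ennreal C * energy (\<lambda>x. X i x - u x) (\<lambda>x. Dweak A (X i) x - w x)) \<longlonglongrightarrow> 0"
      using ennreal_tendsto_cmult[OF _ lim, of "ennreal C"] by simp
    show "(\<lambda>k. \<integral>\<^sup>+\<xi>\<in>K. ennreal \<bar>X k (chart_inv c \<xi>) - u (chart_inv c \<xi>)\<bar> \<partial>lborel) \<longlonglongrightarrow> 0"
    proof (rule L1_tendsto_if_L2_tendsto[OF K(1)])
      show "(\<lambda>k. \<integral>\<^sup>+\<xi>\<in>K. ennreal ((X k (chart_inv c \<xi>) - u (chart_inv c \<xi>))\<^sup>2) \<partial>lborel) \<longlonglongrightarrow> 0"
        by (rule tendsto_0_if_le[OF _ lim0]) (use C mu mw in \<open>unfold local_estimate_def, blast\<close>)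
      show "(\<lambda>\<xi>. indicator K \<xi> *\<^sub>R (X k (chart_inv c \<xi>) - u (chart_inv c \<xi>))) \<in> borel_measurable borel" for k
        by (rule indicator_measurable[OF c measurable_chart_comp[OF mu c] K])
    qed
    fix j
    show "(\<lambda>k. \<integral>\<^sup>+\<xi>\<in>K. ennreal \<bar>cov_comp A c (Dweak A (X k)) \<xi> $ j - cov_comp A c w \<xi> $ j\<bar> \<partial>lborel) \<longlonglongrightarrow> 0"
    proof (rule L1_tendsto_if_L2_tendsto[OF K(1)])
      have "(\<integral>\<^sup>+\<xi>\<in>K. ennreal ((cov_comp A c (Dweak A (X k)) \<xi> $ j - cov_comp A c w \<xi> $ j)\<^sup>2) \<partial>lborel) \<le>
         (\<integral>\<^sup>+\<xi>\<in>K. ennreal ((norm (cov_comp A c (\<lambda>x. Dweak A (X k) x - w x) \<xi>))\<^sup>2) \<partial>lborel)" for k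
      proof (intro nn_integral_mono mult_right_mono ennreal_leI)
        fix \<xi>
        have "\<bar>cov_comp A c (\<lambda>x. Dweak A (X k) x - w x) \<xi> $ j\<bar> \<le> norm (cov_comp A c (\<lambda>x. Dweak A (X k) x - w x) \<xi>)"
          by (rule component_le_norm_cart)
        from power_mono[OF this, of 2]
        show "(cov_comp A c (Dweak A (X k)) \<xi> $ j - cov_comp A c w \<xi> $ j)\<^sup>2 \<le> (norm (cov_comp A c (\<lambda>x. Dweak A (X k) x - w x) \<xi>))\<^sup>2"
          by (simp add: cov_comp_diff)
      qed simp
      moreover have "(\<integral>\<^sup>+\<xi>\<in>K. ennreal ((norm (cov_comp A c (\<lambda>x. Dweak A (X k) x - w x) \<xi>))\<^sup>2) \<partial>lborel)
          \<le> ennreal C * energy (\<lambda>x. X k x - u x) (\<lambda>x. Dweak A (X k) x - w x)" for k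
        using C mu mw unfolding local_estimate_def by blast
      ultimately show "(\<lambda>k. \<integral>\<^sup>+\<xi>\<in>K. ennreal ((cov_comp A c (Dweak A (X k)) \<xi> $ j - cov_comp A c w \<xi> $ j)\<^sup>2) \<partial>lborel) \<longlonglongrightarrow> 0"
        by (intro tendsto_0_if_le[OF order_trans lim0])
      have "(\<lambda>v :: real ^ 'n. v $ j) \<in> borel_measurable borel"
        by (intro borel_measurable_continuous_onI continuous_intros)
      from measurable_compose[OF measurable_sectionD[OF mw c] this]
      have "(\<lambda>\<xi>. cov_comp A c (\<lambda>x. Dweak A (X k) x - w x) \<xi> $ j) \<in> borel_measurable (restrict_space borel (chart_range c))" for k .
      from indicator_measurable[OF c this K]
      show "(\<lambda>\<xi>. indicator K \<xi> *\<^sub>R (cov_comp A c (Dweak A (X k)) \<xi> $ j - cov_comp A c w \<xi> $ j)) \<in> borel_measurable borel" for k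
        by (simp add: cov_comp_diff)
    qed
  qed (use Dweak[OF X] W12_loc_locally_integrable[OF X] locally_L2_locally_integrable[OF Lu] in auto)
  with Lu Lw show "u \<in> W12_loc A" unfolding W12_loc_iff by blast
qed

lemma N_complete:
  assumes X: "\<And>k::nat. X k \<in> W12_loc A"
    and cauchy: "\<forall>e::real>0. \<exists>M. \<forall>i\<ge>M. \<forall>j\<ge>M. N (\<lambda>x. X i x - X j x) < ennreal e"
  obtains u where "u \<in> W12_loc A" "(\<lambda>k. N (\<lambda>x. X k x - u x)) \<longlonglongrightarrow> 0"
proof (rule N_Cauchy_pointwise[OF X cauchy])
  fix s :: "nat \<Rightarrow> nat" and u w
  assume s: "\<And>k. s k \<ge> k" and u: "u \<in> borel_measurable borel" and w: "measurable_section w"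
    and ae: "AE x in m. (\<lambda>k. X (s k) x) \<longlonglongrightarrow> u x \<and> (\<lambda>k. Dweak A (X (s k)) x) \<longlonglongrightarrow> w x"
  note lim = energy_limit[OF X cauchy s ae]
  have uW: "u \<in> W12_loc A" and wd: "weak_differential A u w"
    by (rule energy_limit_weak_differential[OF X u w lim])+
  have eq: "(N (\<lambda>x. X k x - u x))\<^sup>2 = energy (\<lambda>x. X k x - u x) (\<lambda>x. Dweak A (X k) x - w x)" for k
    unfolding N_diff_power2[OF X uW]
    by (rule energy_cong_AE) (use Dweak_eqI[OF uW wd] in auto)
  have "(\<lambda>k. (N (\<lambda>x. X k x - u x))\<^sup>2) \<longlonglongrightarrow> 0" unfolding eq by (rule lim)
  then have "(\<lambda>k. N (\<lambda>x. X k x - u x)) \<longlonglongrightarrow> 0" by (rule tendsto_0_if_power2)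
  with uW show ?thesis by (rule that)
qed

end

section \<open>The closure of the smooth functions\<close>

context sobolev
begin

text \<open>The square of the polar need not come from a bilinear form, so the averaged form
  \<open>S.form\<close> takes its place.\<close>

definition ip_density :: "('m \<Rightarrow> real) \<Rightarrow> ('m \<Rightarrow> real) \<Rightarrow> 'm \<Rightarrow> real" where
  "ip_density u v x = u x * v x + S.form x (Dweak A u x) (Dweak A v x)"

definition ip :: "('m \<Rightarrow> real) \<Rightarrow> ('m \<Rightarrow> real) \<Rightarrow> real" where
  "ip u v = (\<integral>x. ip_density u v x \<partial>m)"

text \<open>Nonnegativity of the form at \<open>\<alpha> + \<beta>\<close> and
  \<open>\<alpha> - \<beta>\<close> bounds the mixed term by the diagonal ones. It provides an
  integrable majorant for the inner product density.\<close>

lemma form_bound: "2 * \<bar>S.form x \<alpha> \<beta>\<bar> \<le> (polar G x \<alpha>)\<^sup>2 + (polar G x \<beta>)\<^sup>2"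
proof -
  have nonneg: "S.form x \<gamma> \<gamma> \<ge> 0" for \<gamma>
    using S.form_lower[of x \<gamma>] S.form_const_pos(1)
    by (meson less_imp_le mult_nonneg_nonneg order_trans zero_le_power2)
  have add2: "S.form x \<gamma> (\<alpha> + \<beta>) = S.form x \<gamma> \<alpha> + S.form x \<gamma> \<beta>" for \<gamma> \<alpha> \<beta>
    by (simp only: S.form_commute[of x \<gamma>] S.form_add)
  have scale2: "S.form x \<gamma> (t *\<^sub>R \<alpha>) = t * S.form x \<gamma> \<alpha>" for \<gamma> \<alpha> t
    by (simp only: S.form_commute[of x \<gamma>] S.form_scale)
  have "0 \<le> S.form x \<alpha> \<alpha> + 2 * t * S.form x \<alpha> \<beta> + t * t * S.form x \<beta> \<beta>" for t
    using nonneg[of "\<alpha> + t *\<^sub>R \<beta>"] S.form_commute[of x \<beta> \<alpha>]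
    by (simp add: S.form_add S.form_scale add2 scale2 algebra_simps)
  from this[of 1] this[of "-1"] S.form_upper[of x \<alpha>] S.form_upper[of x \<beta>] show ?thesis by simp
qed

lemma ip_density_bound:
  "2 * \<bar>ip_density u v x\<bar> \<le> (energy_density u (Dweak A u) x)\<^sup>2 + (energy_density v (Dweak A v) x)\<^sup>2"
proof -
  have "2 * \<bar>u x * v x\<bar> \<le> (u x)\<^sup>2 + (v x)\<^sup>2"
    using zero_le_power2[of "\<bar>u x\<bar> - \<bar>v x\<bar>"] by (simp add: power2_diff abs_mult)
  from add_mono[OF form_bound[of x "Dweak A u x" "Dweak A v x"] this]
  have "2 * (\<bar>u x * v x\<bar> + \<bar>S.form x (Dweak A u x) (Dweak A v x)\<bar>) \<le>
      (energy_density u (Dweak A u) x)\<^sup>2 + (energy_density v (Dweak A v) x)\<^sup>2"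
    unfolding energy_density_power2 distrib_left by (simp only: add_ac)
  moreover have "2 * \<bar>ip_density u v x\<bar> \<le> 2 * (\<bar>u x * v x\<bar> + \<bar>S.form x (Dweak A u x) (Dweak A v x)\<bar>)"
    unfolding ip_density_def by (intro mult_left_mono abs_triangle_ineq) simp
  ultimately show ?thesis by (rule order_trans[rotated])
qed

lemma measurable_ip_density:
  assumes "u \<in> W12_loc A" "v \<in> W12_loc A" shows "ip_density u v \<in> borel_measurable m"
proof -
  have [measurable]: "u \<in> borel_measurable m" "v \<in> borel_measurable m"
    "(\<lambda>x. S.form x (Dweak A u x) (Dweak A v x)) \<in> borel_measurable m"
    using assms[THEN W12_loc_borel] S.measurable_form_section[OF assms[THEN measurable_Dweak]] by simp_all
  show ?thesis unfolding ip_density_def[abs_def] by measurable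
qed

lemma integrable_energy_density_power2:
  assumes "u \<in> W12_loc A" "N u < top"
  shows "integrable m (\<lambda>x. (energy_density u (Dweak A u) x)\<^sup>2)"
    "(\<integral>x. (energy_density u (Dweak A u) x)\<^sup>2 \<partial>m) = (enn2real (N u))\<^sup>2"
proof -
  have [measurable]: "energy_density u (Dweak A u) \<in> borel_measurable m"
    using measurable_energy_density[OF W12_loc_borel[OF assms(1)] measurable_Dweak[OF assms(1)]] by simp
  have e: "(\<integral>\<^sup>+x. ennreal ((energy_density u (Dweak A u) x)\<^sup>2) \<partial>m) = (N u)\<^sup>2"
    unfolding N_power2[OF assms(1)] energy_def ..
  have "(N u)\<^sup>2 < top" using assms(2) by (simp add: power2_eq_square ennreal_mult_less_top)
  then show "integrable m (\<lambda>x. (energy_density u (Dweak A u) x)\<^sup>2)"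
    using e by (intro integrableI_nonneg) auto
  have "(\<integral>x. (energy_density u (Dweak A u) x)\<^sup>2 \<partial>m) = enn2real ((N u)\<^sup>2)"
    unfolding e[symmetric] by (intro integral_eq_nn_integral) auto
  then show "(\<integral>x. (energy_density u (Dweak A u) x)\<^sup>2 \<partial>m) = (enn2real (N u))\<^sup>2"
    by (simp add: power2_eq_square enn2real_mult)
qed

lemma integrable_ip_density:
  assumes "u \<in> W12_loc A" "v \<in> W12_loc A" "N u < top" "N v < top"
  shows "integrable m (ip_density u v)"
proof (rule Bochner_Integration.integrable_bound)
  show "integrable m (\<lambda>x. (energy_density u (Dweak A u) x)\<^sup>2 + (energy_density v (Dweak A v) x)\<^sup>2)"
    by (intro Bochner_Integration.integrable_add integrable_energy_density_power2 assms)
  show "AE x in m. norm (ip_density u v x) \<le> norm ((energy_density u (Dweak A u) x)\<^sup>2 + (energy_density v (Dweak A v) x)\<^sup>2)"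
  proof (rule always_eventually, rule allI)
    fix x
    show "norm (ip_density u v x) \<le> norm ((energy_density u (Dweak A u) x)\<^sup>2 + (energy_density v (Dweak A v) x)\<^sup>2)"
      using ip_density_bound[of u v x] by simp
  qed
qed (rule measurable_ip_density[OF assms(1,2)])

lemma ip_commute: "ip u v = ip v u"
  unfolding ip_def ip_density_def by (simp add: mult.commute S.form_commute)

lemma ip_add:
  assumes "u \<in> W12_loc A" "v \<in> W12_loc A" "w \<in> W12_loc A" "N u < top" "N v < top" "N w < top"
  shows "ip (\<lambda>x. u x + v x) w = ip u w + ip v w"
proof -
  have "ip (\<lambda>x. u x + v x) w = (\<integral>x. ip_density u w x + ip_density v w x \<partial>m)"
    unfolding ip_def
  proof (rule integral_cong_AE)
    show "AE x in m. ip_density (\<lambda>x. u x + v x) w x = ip_density u w x + ip_density v w x"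
      using Dweak_add[OF assms(1,2)]
      by eventually_elim (simp add: ip_density_def S.form_add algebra_simps)
  qed (intro borel_measurable_add measurable_ip_density W12_loc_add assms)+
  also have "\<dots> = ip u w + ip v w"
    unfolding ip_def by (intro Bochner_Integration.integral_add integrable_ip_density assms)
  finally show ?thesis .
qed

lemma ip_scale:
  assumes "u \<in> W12_loc A" "v \<in> W12_loc A"
  shows "ip (\<lambda>x. a * u x) v = a * ip u v"
proof -
  have "ip (\<lambda>x. a * u x) v = (\<integral>x. a * ip_density u v x \<partial>m)"
    unfolding ip_def
  proof (rule integral_cong_AE)
    show "AE x in m. ip_density (\<lambda>x. a * u x) v x = a * ip_density u v x"
      using Dweak_scale[OF assms(1), of a]
      by eventually_elim (simp add: ip_density_def S.form_scale algebra_simps)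
  qed (intro borel_measurable_times borel_measurable_const measurable_ip_density W12_loc_scale assms)+
  then show ?thesis by (simp add: ip_def)
qed

lemma ip_ae:
  assumes "u \<in> W12_loc A" "u' \<in> W12_loc A" "v \<in> W12_loc A" "v' \<in> W12_loc A"
    and eq: "AE x in m. u' x = u x" "AE x in m. v' x = v x"
  shows "ip u' v' = ip u v"
  unfolding ip_def
proof (rule integral_cong_AE)
  have D: "Dweak A u' = Dweak A u" "Dweak A v' = Dweak A v"
    by (rule Dweak_ae; intro W12_loc_borel assms eq)+
  show "AE x in m. ip_density u' v' x = ip_density u v x"
    using eq by eventually_elim (simp add: ip_density_def D)
qed (intro measurable_ip_density assms)+

lemma ip_bounds:
  assumes "u \<in> W12_loc A" "N u < top"
  shows "S.form_const * (enn2real (N u))\<^sup>2 \<le> ip u u" "ip u u \<le> 1 * (enn2real (N u))\<^sup>2"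
proof -
  note i = integrable_energy_density_power2(1)[OF assms] integrable_ip_density[OF assms(1,1,2,2)]
  have "S.form_const * (enn2real (N u))\<^sup>2 = (\<integral>x. S.form_const * (energy_density u (Dweak A u) x)\<^sup>2 \<partial>m)"
    using integrable_energy_density_power2(2)[OF assms] by simp
  also have "\<dots> \<le> ip u u"
    unfolding ip_def
  proof (intro integral_mono integrable_mult_right i)
    fix x
    have "S.form_const * (u x)\<^sup>2 \<le> (u x)\<^sup>2"
      using S.form_const_pos mult_right_mono[of S.form_const 1 "(u x)\<^sup>2"] by simp
    then show "S.form_const * (energy_density u (Dweak A u) x)\<^sup>2 \<le> ip_density u u x"
      using S.form_lower[of x "Dweak A u x"]
      unfolding ip_density_def energy_density_power2 distrib_left power2_eq_square[of "u x", symmetric]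
      by (subst add.commute) (rule add_mono)
  qed
  finally show "S.form_const * (enn2real (N u))\<^sup>2 \<le> ip u u" .
  have "ip u u \<le> (\<integral>x. (energy_density u (Dweak A u) x)\<^sup>2 \<partial>m)"
    unfolding ip_def
  proof (intro integral_mono i)
    fix x show "ip_density u u x \<le> (energy_density u (Dweak A u) x)\<^sup>2"
      using S.form_upper[of x "Dweak A u x"]
      unfolding ip_density_def energy_density_power2 power2_eq_square[of "u x", symmetric] by simp
  qed
  then show "ip u u \<le> 1 * (enn2real (N u))\<^sup>2" using integrable_energy_density_power2(2)[OF assms] by simp
qed

text \<open>The closure formed with the norm of \<open>G\<close> alone, with finiteness of that norm
  built in; for \<open>G = symm F\<close> it is identified with \<open>W12_0\<close> in
  \<open>W12_0_eq\<close>.\<close>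

definition W0 :: "('m \<Rightarrow> real) set" where
  "W0 = {u \<in> W12_loc A. N u < top \<and> (\<exists>\<phi>. (\<forall>k::nat. \<phi> k \<in> C0_infinity A) \<and>
     (\<lambda>k. N (\<lambda>x. u x - \<phi> k x)) \<longlonglongrightarrow> 0)}"

lemma W0D: "u \<in> W0 \<Longrightarrow> u \<in> W12_loc A" "u \<in> W0 \<Longrightarrow> N u < top"
  by (simp_all add: W0_def)

lemma W0_approx:
  assumes "u \<in> W0" "e > 0" shows "\<exists>\<phi>\<in>C0_infinity A. N (\<lambda>x. u x - \<phi> x) < ennreal e"
proof -
  obtain \<phi> where \<phi>: "\<And>k::nat. \<phi> k \<in> C0_infinity A" "(\<lambda>k. N (\<lambda>x. u x - \<phi> k x)) \<longlonglongrightarrow> 0"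
    using assms(1) by (auto simp: W0_def)
  have "\<forall>\<^sub>F k in sequentially. N (\<lambda>x. u x - \<phi> k x) < ennreal e"
    by (rule order_tendstoD(2)[OF \<phi>(2)]) (use assms(2) in simp)
  then obtain k where "N (\<lambda>x. u x - \<phi> k x) < ennreal e" by (auto simp: eventually_sequentially)
  with \<phi>(1) show ?thesis by blast
qed

text \<open>Approximation within every \<open>e\<close> replaces the sequence in the definition and
  avoids diagonal arguments when limits are taken.\<close>

lemma W0I:
  assumes "u \<in> W12_loc A" "N u < top"
    and "\<And>e::real. e > 0 \<Longrightarrow> \<exists>\<phi>\<in>C0_infinity A. N (\<lambda>x. u x - \<phi> x) < ennreal e"
  shows "u \<in> W0"
proof -
  have "\<forall>k. \<exists>\<phi>\<in>C0_infinity A. N (\<lambda>x. u x - \<phi> x) < ennreal (inverse (real (Suc k)))"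
    using assms(3) by simp
  then obtain \<phi> where \<phi>: "\<And>k. \<phi> k \<in> C0_infinity A"
    "\<And>k. N (\<lambda>x. u x - \<phi> k x) < ennreal (inverse (real (Suc k)))" by metis
  have "(\<lambda>k. ennreal (inverse (real (Suc k)))) \<longlonglongrightarrow> ennreal 0"
    by (rule tendsto_ennrealI[OF LIMSEQ_inverse_real_of_nat])
  then have "(\<lambda>k. N (\<lambda>x. u x - \<phi> k x)) \<longlonglongrightarrow> 0"
    by (intro tendsto_0_if_le[OF less_imp_le[OF \<phi>(2)]]) simp
  with assms(1,2) \<phi>(1) show ?thesis unfolding W0_def by blast
qed

lemma N_triangle_lt:
  assumes "u \<in> W12_loc A" "v \<in> W12_loc A" "N u < ennreal (e / 2)" "N v < ennreal (e / 2)"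
  shows "N (\<lambda>x. u x + v x) < ennreal e"
proof -
  have "e / 2 > 0" using assms(3) by (metis ennreal_eq_0_iff not_less not_less_zero)
  have "N (\<lambda>x. u x + v x) \<le> N u + N v" by (rule N_add[OF assms(1,2)])
  also have "\<dots> < ennreal (e / 2) + ennreal (e / 2)" by (rule add_strict_mono[OF assms(3,4)])
  also have "\<dots> = ennreal e" using \<open>e / 2 > 0\<close> by (simp add: ennreal_plus[symmetric] del: ennreal_plus)
  finally show ?thesis .
qed

lemma W0_add:
  assumes "u \<in> W0" "v \<in> W0" shows "(\<lambda>x. u x + v x) \<in> W0"
proof (rule W0I)
  note W = assms[THEN W0D(1)]
  show "(\<lambda>x. u x + v x) \<in> W12_loc A" by (rule W12_loc_add[OF W])
  have "N (\<lambda>x. u x + v x) \<le> N u + N v" by (rule N_add[OF W])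
  also have "\<dots> < top" using assms[THEN W0D(2)] by simp
  finally show "N (\<lambda>x. u x + v x) < top" .
  fix e :: real assume "e > 0"
  then have e2: "e / 2 > 0" by simp
  obtain \<phi> \<psi> where \<phi>: "\<phi> \<in> C0_infinity A" "N (\<lambda>x. u x - \<phi> x) < ennreal (e / 2)"
    and \<psi>: "\<psi> \<in> C0_infinity A" "N (\<lambda>x. v x - \<psi> x) < ennreal (e / 2)"
    using W0_approx[OF assms(1) e2] W0_approx[OF assms(2) e2] by blast
  have "(\<lambda>x. (u x - \<phi> x) + (v x - \<psi> x)) = (\<lambda>x. (u x + v x) - (\<phi> x + \<psi> x))" by (simp add: fun_eq_iff)
  with N_triangle_lt[OF W12_loc_diff[OF W(1) C0_infinity_W12_loc[OF \<phi>(1)]] W12_loc_diff[OF W(2) C0_infinity_W12_loc[OF \<psi>(1)]] \<phi>(2) \<psi>(2)]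
  have "N (\<lambda>x. (u x + v x) - (\<phi> x + \<psi> x)) < ennreal e" by simp
  then show "\<exists>\<phi>\<in>C0_infinity A. N (\<lambda>x. (u x + v x) - \<phi> x) < ennreal e"
    using C0_infinity_add[OF \<phi>(1) \<psi>(1)] by (rule bexI)
qed

lemma W0_scale: assumes "u \<in> W0" shows "(\<lambda>x. a * u x) \<in> W0"
proof -
  note W = assms[THEN W0D(1)]
  obtain \<phi> where \<phi>: "\<And>k::nat. \<phi> k \<in> C0_infinity A" "(\<lambda>k. N (\<lambda>x. u x - \<phi> k x)) \<longlonglongrightarrow> 0"
    using assms by (auto simp: W0_def)
  have eq: "N (\<lambda>x. a * u x - a * \<phi> k x) = ennreal \<bar>a\<bar> * N (\<lambda>x. u x - \<phi> k x)" for k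
    using N_scale[OF W12_loc_diff[OF W C0_infinity_W12_loc[OF \<phi>(1)]], of a k] by (simp add: right_diff_distrib)
  have "(\<lambda>k. N (\<lambda>x. a * u x - a * \<phi> k x)) \<longlonglongrightarrow> 0"
    unfolding eq using ennreal_tendsto_cmult[OF _ \<phi>(2), of "ennreal \<bar>a\<bar>"] by simp
  moreover have "N (\<lambda>x. a * u x) < top"
    using W0D(2)[OF assms] by (simp add: N_scale[OF W] ennreal_mult_less_top)
  moreover have "\<forall>k. (\<lambda>x. a * \<phi> k x) \<in> C0_infinity A" using C0_infinity_scale[OF \<phi>(1)] by blast
  ultimately show ?thesis
    unfolding W0_def using W12_loc_scale[OF W] by (intro CollectI conjI exI[of _ "\<lambda>k x. a * \<phi> k x"])
qed

lemma W0_zero: "(\<lambda>x. 0) \<in> W0"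
proof (rule W0I)
  show Z: "(\<lambda>x. 0) \<in> W12_loc A" by (rule C0_infinity_W12_loc[OF C0_infinity_zero])
  have N0: "N (\<lambda>x. 0) = 0" using N_scale[OF Z, of 0] by simp
  then show "N (\<lambda>x. 0) < top" by simp
  show "\<exists>\<phi>\<in>C0_infinity A. N (\<lambda>x. 0 - \<phi> x) < ennreal e" if "e > 0" for e
    by (rule bexI[OF _ C0_infinity_zero]) (simp add: N0 that)
qed

lemma W0_ae:
  assumes u: "u \<in> W0" and v: "v \<in> borel_measurable borel" and eq: "AE x in m. v x = u x"
  shows "v \<in> W0"
proof (rule W0I)
  note W = u[THEN W0D(1)]
  note ub = W12_loc_borel[OF W]
  show "v \<in> W12_loc A" by (rule W12_loc_ae[OF W v eq])
  show "N v < top" using N_ae[OF v ub eq] W0D(2)[OF u] by simp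
  fix e :: real assume "e > 0"
  then obtain \<phi> where \<phi>: "\<phi> \<in> C0_infinity A" "N (\<lambda>x. u x - \<phi> x) < ennreal e" using W0_approx[OF u] by blast
  note pb = C0_infinity_borel[OF \<phi>(1)]
  have "N (\<lambda>x. v x - \<phi> x) = N (\<lambda>x. u x - \<phi> x)"
    by (rule N_ae) (use eq in \<open>auto intro!: borel_measurable_diff ub v pb elim!: eventually_mono\<close>)
  then show "\<exists>\<phi>\<in>C0_infinity A. N (\<lambda>x. v x - \<phi> x) < ennreal e"
    using \<phi> by (intro bexI[of _ \<phi>]) simp_all
qed

text \<open>The limit exists among the local Sobolev functions by \<open>N_complete\<close>; a
  member of the sequence near it, and a smooth function near that member, place it in the
  closure.\<close>

lemma W0_complete:
  assumes X: "\<And>k::nat. X k \<in> W0"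
    and cauchy: "\<forall>e::real>0. \<exists>M. \<forall>i\<ge>M. \<forall>j\<ge>M. N (\<lambda>x. X i x - X j x) < ennreal e"
  shows "\<exists>u\<in>W0. (\<lambda>k. N (\<lambda>x. X k x - u x)) \<longlonglongrightarrow> 0"
proof (rule N_complete[OF W0D(1)[OF X] cauchy])
  fix u assume u: "u \<in> W12_loc A" and lim: "(\<lambda>k. N (\<lambda>x. X k x - u x)) \<longlonglongrightarrow> 0"
  have XW: "X k \<in> W12_loc A" for k by (rule W0D(1)[OF X])
  have close: "\<exists>k. N (\<lambda>x. u x - X k x) < ennreal e" if "e > 0" for e
  proof -
    have "\<forall>\<^sub>F k in sequentially. N (\<lambda>x. X k x - u x) < ennreal e"
      by (rule order_tendstoD(2)[OF lim]) (use that in simp)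
    then obtain k where k: "N (\<lambda>x. X k x - u x) < ennreal e" by (auto simp: eventually_sequentially)
    have "N (\<lambda>x. u x - X k x) = N (\<lambda>x. X k x - u x)"
      using N_minus[OF W12_loc_diff[OF XW u], of k] by simp
    with k show ?thesis by (intro exI[of _ k]) simp
  qed
  have "u \<in> W0"
  proof (rule W0I[OF u])
    obtain k where k: "N (\<lambda>x. u x - X k x) < ennreal 1" using close[of 1] by auto
    have "N u \<le> N (\<lambda>x. u x - X k x) + N (X k)"
      using N_add[OF W12_loc_diff[OF u XW] XW, of k k] by simp
    also have "\<dots> < top" using less_trans[OF k] W0D(2)[OF X[of k]] by simp
    finally show "N u < top" .
    fix e :: real assume "e > 0"
    then have e2: "e / 2 > 0" by simp
    obtain k where k: "N (\<lambda>x. u x - X k x) < ennreal (e / 2)" using close[OF e2] by blast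
    obtain \<phi> where \<phi>: "\<phi> \<in> C0_infinity A" "N (\<lambda>x. X k x - \<phi> x) < ennreal (e / 2)"
      using W0_approx[OF X e2] by blast
    from N_triangle_lt[OF W12_loc_diff[OF u XW] W12_loc_diff[OF XW C0_infinity_W12_loc[OF \<phi>(1)]] k \<phi>(2)]
    show "\<exists>\<phi>\<in>C0_infinity A. N (\<lambda>x. u x - \<phi> x) < ennreal e" using \<phi>(1) by auto
  qed
  with lim show ?thesis by blast
qed

lemma reflexive_banach_W0: "reflexive_banach_mod_ae m W0 N"
proof -
  interpret I: ae_inner_space m W0 N ip S.form_const 1
  proof (unfold_locales, goal_cases)
    case (1 u) then show ?case by (intro W12_loc_borel W0D)
  next
    case 2 show ?case by (rule W0_zero)
  next
    case (3 u v) then show ?case by (rule W0_add)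
  next
    case (4 u a) then show ?case by (rule W0_scale)
  next
    case (5 u v) then show ?case by (rule W0_ae)
  next
    case (6 u) then show ?case by (rule W0D)
  next
    case (7 u v) then show ?case by (intro N_add W0D)
  next
    case (8 u a) then show ?case by (intro N_scale W0D)
  next
    case (9 u v) then show ?case by (intro N_ae W12_loc_borel W0D)
  next
    case (10 u) then show ?case by (intro N_zero W0D)
  next
    case (11 X) then show ?case by (intro W0_complete) auto
  next
    case (12 u u' v v') then show ?case by (intro ip_ae W0D)
  next
    case (13 u v) show ?case by (rule ip_commute)
  next
    case (14 u v w) then show ?case by (intro ip_add W0D)
  next
    case (15 u v a) then show ?case by (intro ip_scale W0D)
  next
    case 16 show ?case by (rule S.form_const_pos)
  next
    case 17 show ?case by simp
  next
    case (18 u) then show ?case by (intro ip_bounds W0D)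
  next
    case (19 u) then show ?case by (intro ip_bounds W0D)
  qed
  show ?thesis by (rule I.reflexive_banach)
qed

end

section \<open>Comparison of the two norms and of their closures\<close>

lemma (in busemann) sobolev_norm_le:
  assumes le: "\<And>x \<alpha>. 0 \<le> polar G1 x \<alpha>" "\<And>x \<alpha>. polar G1 x \<alpha> \<le> k * polar G2 x \<alpha>" and k: "k \<ge> 1"
    and [measurable]: "u \<in> borel_measurable borel" "(\<lambda>x. polar G2 x (Dweak A u x)) \<in> borel_measurable borel"
  shows "sobolev_norm A m G1 u \<le> ennreal k * sobolev_norm A m G2 u"
    "(\<integral>\<^sup>+x. ennreal ((polar G1 x (Dweak A u x))\<^sup>2) \<partial>m) \<le> ennreal (k\<^sup>2) * (\<integral>\<^sup>+x. ennreal ((polar G2 x (Dweak A u x))\<^sup>2) \<partial>m)"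
proof -
  have "(\<integral>\<^sup>+x. ennreal ((polar G1 x (Dweak A u x))\<^sup>2) \<partial>m) \<le> (\<integral>\<^sup>+x. ennreal (k\<^sup>2) * ennreal ((polar G2 x (Dweak A u x))\<^sup>2) \<partial>m)"
  proof (rule nn_integral_mono)
    fix x
    have "(polar G1 x (Dweak A u x))\<^sup>2 \<le> (k * polar G2 x (Dweak A u x))\<^sup>2" by (intro power_mono le)
    then show "ennreal ((polar G1 x (Dweak A u x))\<^sup>2) \<le> ennreal (k\<^sup>2) * ennreal ((polar G2 x (Dweak A u x))\<^sup>2)"
      by (simp add: ennreal_mult[symmetric] power_mult_distrib ennreal_leI)
  qed
  also have "\<dots> = ennreal (k\<^sup>2) * (\<integral>\<^sup>+x. ennreal ((polar G2 x (Dweak A u x))\<^sup>2) \<partial>m)"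
    by (rule nn_integral_cmult) measurable
  finally show grad: "(\<integral>\<^sup>+x. ennreal ((polar G1 x (Dweak A u x))\<^sup>2) \<partial>m) \<le> ennreal (k\<^sup>2) * (\<integral>\<^sup>+x. ennreal ((polar G2 x (Dweak A u x))\<^sup>2) \<partial>m)" .
  have "1 \<le> k\<^sup>2" using power_mono[of 1 k 2] k by simp
  then have "1 * (\<integral>\<^sup>+x. ennreal ((u x)\<^sup>2) \<partial>m) \<le> ennreal (k\<^sup>2) * (\<integral>\<^sup>+x. ennreal ((u x)\<^sup>2) \<partial>m)"
    by (intro mult_right_mono) (auto simp flip: ennreal_1 intro!: ennreal_leI)
  with grad have "(\<integral>\<^sup>+x. ennreal ((polar G1 x (Dweak A u x))\<^sup>2) \<partial>m) + (\<integral>\<^sup>+x. ennreal ((u x)\<^sup>2) \<partial>m) \<le>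
    ennreal (k\<^sup>2) * ((\<integral>\<^sup>+x. ennreal ((polar G2 x (Dweak A u x))\<^sup>2) \<partial>m) + (\<integral>\<^sup>+x. ennreal ((u x)\<^sup>2) \<partial>m))"
    unfolding distrib_left by (intro add_mono) simp_all
  from ennreal_sqrt_mono[OF this] show "sobolev_norm A m G1 u \<le> ennreal k * sobolev_norm A m G2 u"
    using k by (simp add: sobolev_norm_def ennreal_sqrt_mult ennreal_sqrt_ennreal)
qed

locale finsler_sobolev = reversible_bound A F + busemann A F m
  for A :: "('m::{t2_space, second_countable_topology}, 'n::finite) chart set" and F m
begin

sublocale sob: sobolev A F m "symm F" by unfold_locales

lemma norms_le:
  assumes "u \<in> W12_loc A"
  shows "sobolev_norm A m F u \<le> ennreal k1 * sobolev_norm A m (symm F) u"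
    "sobolev_norm A m (symm F) u \<le> ennreal k2 * sobolev_norm A m F u"
    "(\<integral>\<^sup>+x. ennreal ((polar F x (Dweak A u x))\<^sup>2) \<partial>m) \<le> ennreal (k1\<^sup>2) * (\<integral>\<^sup>+x. ennreal ((polar (symm F) x (Dweak A u x))\<^sup>2) \<partial>m)"
    "(\<integral>\<^sup>+x. ennreal ((polar (symm F) x (Dweak A u x))\<^sup>2) \<partial>m) \<le> ennreal (k2\<^sup>2) * (\<integral>\<^sup>+x. ennreal ((polar F x (Dweak A u x))\<^sup>2) \<partial>m)"
proof -
  note b = W12_loc_borel[OF assms]
  note mF = measurable_polar_section[OF measurable_Dweak[OF assms]]
  note mS = symm.measurable_polar_section[OF measurable_Dweak[OF assms]]
  note 1 = sobolev_norm_le[OF polar_G_nonneg polar_F_le k1_ge_1 b mS]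
  note 2 = sobolev_norm_le[OF symm.polar_G_nonneg polar_symm_le k2_ge_1 b mF]
  show "sobolev_norm A m F u \<le> ennreal k1 * sobolev_norm A m (symm F) u" by (rule 1)
  show "sobolev_norm A m (symm F) u \<le> ennreal k2 * sobolev_norm A m F u" by (rule 2)
  show "(\<integral>\<^sup>+x. ennreal ((polar F x (Dweak A u x))\<^sup>2) \<partial>m) \<le> ennreal (k1\<^sup>2) * (\<integral>\<^sup>+x. ennreal ((polar (symm F) x (Dweak A u x))\<^sup>2) \<partial>m)"
    by (rule 1)
  show "(\<integral>\<^sup>+x. ennreal ((polar (symm F) x (Dweak A u x))\<^sup>2) \<partial>m) \<le> ennreal (k2\<^sup>2) * (\<integral>\<^sup>+x. ennreal ((polar F x (Dweak A u x))\<^sup>2) \<partial>m)"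
    by (rule 2)
qed

lemma tendsto_norms_iff:
  assumes "u \<in> W12_loc A" "\<And>k::nat. \<phi> k \<in> C0_infinity A"
  shows "(\<lambda>k. sobolev_norm A m F (\<lambda>x. u x - \<phi> k x)) \<longlonglongrightarrow> 0 \<longleftrightarrow>
    (\<lambda>k. sobolev_norm A m (symm F) (\<lambda>x. u x - \<phi> k x)) \<longlonglongrightarrow> 0"
proof
  have d: "(\<lambda>x. u x - \<phi> k x) \<in> W12_loc A" for k
    by (intro W12_loc_diff assms C0_infinity_W12_loc)
  show "(\<lambda>k. sobolev_norm A m (symm F) (\<lambda>x. u x - \<phi> k x)) \<longlonglongrightarrow> 0"
    if lim: "(\<lambda>k. sobolev_norm A m F (\<lambda>x. u x - \<phi> k x)) \<longlonglongrightarrow> 0"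
    using ennreal_tendsto_cmult[OF _ lim, of "ennreal k2"] by (intro tendsto_0_if_le[OF norms_le(2)[OF d]]) simp
  show "(\<lambda>k. sobolev_norm A m F (\<lambda>x. u x - \<phi> k x)) \<longlonglongrightarrow> 0"
    if lim: "(\<lambda>k. sobolev_norm A m (symm F) (\<lambda>x. u x - \<phi> k x)) \<longlonglongrightarrow> 0"
    using ennreal_tendsto_cmult[OF _ lim, of "ennreal k1"] by (intro tendsto_0_if_le[OF norms_le(1)[OF d]]) simp
qed

text \<open>\<open>W12\<close> bounds the gradient term and leaves \<open>u\<close> locally square
  integrable. Global square integrability comes from a smooth function with compact support at
  finite distance, via \<open>u^2 \<le> 2 * ((u - \<phi>)^2 + \<phi>^2)\<close>.\<close>

lemma L2_if_approx:
  assumes u: "u \<in> W12_loc A" and \<phi>: "\<phi> \<in> C0_infinity A" and fin: "sobolev_norm A m F (\<lambda>x. u x - \<phi> x) < top"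
  shows "(\<integral>\<^sup>+x. ennreal ((u x)\<^sup>2) \<partial>m) < top"
proof -
  have [measurable]: "u \<in> borel_measurable m" "\<phi> \<in> borel_measurable m"
    using W12_loc_borel[OF u] C0_infinity_borel[OF \<phi>] by simp_all
  have f: "(\<integral>\<^sup>+x. ennreal ((u x - \<phi> x)\<^sup>2) \<partial>m) < top"
    using fin unfolding sobolev_norm_def ennreal_sqrt_less_top_iff by simp
  have "(\<integral>\<^sup>+x. ennreal ((u x)\<^sup>2) \<partial>m) \<le> (\<integral>\<^sup>+x. 2 * (ennreal ((u x - \<phi> x)\<^sup>2) + ennreal ((\<phi> x)\<^sup>2)) \<partial>m)"
  proof (rule nn_integral_mono)
    fix x
    have "(u x)\<^sup>2 \<le> 2 * ((u x - \<phi> x)\<^sup>2 + (\<phi> x)\<^sup>2)"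
      using zero_le_power2[of "u x - 2 * \<phi> x"] by (simp add: power2_eq_square algebra_simps)
    from ennreal_leI[OF this] show "ennreal ((u x)\<^sup>2) \<le> 2 * (ennreal ((u x - \<phi> x)\<^sup>2) + ennreal ((\<phi> x)\<^sup>2))"
      by (simp add: ennreal_mult)
  qed
  also have "\<dots> = 2 * ((\<integral>\<^sup>+x. ennreal ((u x - \<phi> x)\<^sup>2) \<partial>m) + (\<integral>\<^sup>+x. ennreal ((\<phi> x)\<^sup>2) \<partial>m))"
    by (simp add: nn_integral_cmult nn_integral_add)
  also have "\<dots> < top" using f C0_infinity_L2[OF \<phi>] by (simp add: ennreal_mult_less_top)
  finally show ?thesis .
qed

text \<open>Comparability of the norms makes the approximating sequences the same. Finiteness of the
  \<open>symm F\<close> norm, demanded in \<open>W0\<close>, follows from the gradient bound in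
  \<open>W12\<close> together with \<open>L2_if_approx\<close>.\<close>

lemma W12_0_eq: "W12_0 A F m = sob.W0"
proof (rule set_eqI, rule iffI)
  fix u assume "u \<in> W12_0 A F m"
  then obtain \<phi> where u: "u \<in> W12_loc A" and g: "(\<integral>\<^sup>+x. ennreal ((polar F x (Dweak A u x))\<^sup>2) \<partial>m) < top"
    and \<phi>: "\<forall>k::nat. \<phi> k \<in> C0_infinity A" and lim: "(\<lambda>k. sobolev_norm A m F (\<lambda>x. u x - \<phi> k x)) \<longlonglongrightarrow> 0"
    unfolding W12_0_def W12_def by blast
  have "\<forall>\<^sub>F k in sequentially. sobolev_norm A m F (\<lambda>x. u x - \<phi> k x) < top"
    by (rule order_tendstoD(2)[OF lim]) simp
  then obtain k where "sobolev_norm A m F (\<lambda>x. u x - \<phi> k x) < top" by (auto simp: eventually_sequentially)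
  with \<phi> have "(\<integral>\<^sup>+x. ennreal ((u x)\<^sup>2) \<partial>m) < top" using L2_if_approx[OF u] by blast
  moreover have "(\<integral>\<^sup>+x. ennreal ((polar (symm F) x (Dweak A u x))\<^sup>2) \<partial>m) < top"
    using norms_le(4)[OF u] g by (auto intro: le_less_trans simp: ennreal_mult_less_top)
  ultimately have "sobolev_norm A m (symm F) u < top"
    unfolding sobolev_norm_def ennreal_sqrt_less_top_iff by simp
  moreover have "(\<lambda>k. sobolev_norm A m (symm F) (\<lambda>x. u x - \<phi> k x)) \<longlonglongrightarrow> 0"
    using tendsto_norms_iff[OF u, of \<phi>] \<phi> lim by blast
  ultimately show "u \<in> sob.W0" unfolding sob.W0_def using u \<phi> by blast
next
  fix u assume "u \<in> sob.W0"
  then obtain \<phi> where u: "u \<in> W12_loc A" and f: "sobolev_norm A m (symm F) u < top"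
    and \<phi>: "\<forall>k::nat. \<phi> k \<in> C0_infinity A" and lim: "(\<lambda>k. sobolev_norm A m (symm F) (\<lambda>x. u x - \<phi> k x)) \<longlonglongrightarrow> 0"
    unfolding sob.W0_def by blast
  have "(\<integral>\<^sup>+x. ennreal ((polar (symm F) x (Dweak A u x))\<^sup>2) \<partial>m) < top"
    using f unfolding sobolev_norm_def ennreal_sqrt_less_top_iff by simp
  then have "(\<integral>\<^sup>+x. ennreal ((polar F x (Dweak A u x))\<^sup>2) \<partial>m) < top"
    using norms_le(3)[OF u] by (auto intro: le_less_trans simp: ennreal_mult_less_top)
  moreover have "(\<lambda>k. sobolev_norm A m F (\<lambda>x. u x - \<phi> k x)) \<longlonglongrightarrow> 0"
    using tendsto_norms_iff[OF u, of \<phi>] \<phi> lim by blast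
  ultimately show "u \<in> W12_0 A F m" unfolding W12_0_def W12_def using u \<phi> by blast
qed

lemma norm_lower:
  assumes "u \<in> W12_loc A"
  shows "ennreal (inverse k1) * sobolev_norm A m F u \<le> sobolev_norm A m (symm F) u"
proof -
  have "ennreal (inverse k1) * sobolev_norm A m F u \<le> ennreal (inverse k1) * (ennreal k1 * sobolev_norm A m (symm F) u)"
    by (intro mult_left_mono norms_le assms) simp
  also have "\<dots> = ennreal (inverse k1 * k1) * sobolev_norm A m (symm F) u"
    using k1_ge_1 by (subst ennreal_mult) (auto simp: mult.assoc)
  also have "inverse k1 * k1 = 1" using k1_ge_1 by simp
  finally show ?thesis by simp
qed

lemma powr_minus_half: "s > 0 \<Longrightarrow> s powr (- 1 / 2) = inverse (sqrt s)" for s :: real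
  using powr_minus[of s "1 / 2"] by (simp add: powr_half_sqrt)

lemma k1_powr: "((1 + r\<^sup>2) / 2) powr (- 1 / 2) = inverse k1"
  unfolding k1_def by (rule powr_minus_half) (simp add: add_pos_nonneg)

lemma k2_powr: "((1 + r powi (- 2)) / 2) powr (- 1 / 2) = k2"
proof -
  have "r powi (- 2) = inverse (r\<^sup>2)" by (simp add: power_int_minus)
  then show ?thesis unfolding k2_def
    using powr_minus_half[of "(1 + inverse (r\<^sup>2)) / 2"] by (simp add: add_pos_nonneg)
qed

end

theorem theorem1p1:
  fixes A :: "('m::{t2_space, second_countable_topology}, 'n::finite) chart set"
    and F :: "'m \<Rightarrow> real ^ 'n \<Rightarrow> real"
    and m :: "'m measure"
  assumes "finsler_manifold A F"
    and "finsler_complete A F"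
    and "is_busemann_measure A F m"
    and "reversibility F < \<infinity>"
  shows "reflexive_banach_mod_ae m (W12_0 A F m) (sobolev_norm A m (symm F)) \<and>
    equivalent_norms_on (W12_0 A F m) (sobolev_norm A m F) (sobolev_norm A m (symm F)) \<and>
    (let r = real_of_ereal (reversibility F) in \<forall>u\<in>W12_0 A F m.
       ennreal (((1 + r\<^sup>2) / 2) powr (- 1 / 2)) * sobolev_norm A m F u
         \<le> sobolev_norm A m (symm F) u \<and>
       sobolev_norm A m (symm F) u
         \<le> ennreal (((1 + r powi (- 2)) / 2) powr (- 1 / 2)) * sobolev_norm A m F u)"
proof -
  interpret metric_field A F by (rule finsler_metric_field[OF assms(1)])
  interpret finsler_sobolev A F m by unfold_locales (rule assms(4) assms(3))+
  have bounds: "ennreal (inverse k1) * sobolev_norm A m F u \<le> sobolev_norm A m (symm F) u \<and>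
      sobolev_norm A m (symm F) u \<le> ennreal k2 * sobolev_norm A m F u" if "u \<in> W12_0 A F m" for u
    using that sob.W0D(1) norm_lower norms_le(2) unfolding W12_0_eq by blast
  have "equivalent_norms_on (W12_0 A F m) (sobolev_norm A m F) (sobolev_norm A m (symm F))"
    unfolding equivalent_norms_on_def
  proof (intro exI conjI)
    show "inverse k1 > 0" "k2 > 0" using k1_ge_1 k2_ge_1 by simp_all
    show "\<forall>u\<in>W12_0 A F m. ennreal (inverse k1) * sobolev_norm A m F u \<le> sobolev_norm A m (symm F) u \<and>
        sobolev_norm A m (symm F) u \<le> ennreal k2 * sobolev_norm A m F u" using bounds by blast
  qed
  moreover have "reflexive_banach_mod_ae m (W12_0 A F m) (sobolev_norm A m (symm F))"
    unfolding W12_0_eq by (rule sob.reflexive_banach_W0)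
  \<comment> \<open>The \<open>r\<close> bound by \<open>let\<close> is the \<open>r\<close> of the
    locale, and the two powers are \<open>inverse k1\<close> and \<open>k2\<close>.\<close>
  ultimately show ?thesis
    unfolding Let_def r_def[symmetric] k1_powr k2_powr using bounds by blast
qed

end
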